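(* Let $q:\mathcal{S}_0=\bigsqcup_{\lambda\in\Lambda}S_\lambda\to Z$ and $q':\mathcal{S}'_0=\bigsqcup_{\lambda'\in\Lambda'}S'_{\lambda'}\to Z'$ be striped atlases with graphs $G=(\Lambda,H,\xi,\sigma)$ and $G'=(\Lambda',H',\xi',\sigma')$. (1) If $(h,k)$ is an equivalence of $q$ and $q'$, then $(\nu,\eta,\delta,\tau)$ is an isomorphism $G\to G'$, where $\nu(\lambda)$ is defined by $h(S_\lambda)=S'_{\nu(\lambda)}$, $\eta(X)=h(X)$ for $X\in H$, and, writing $h|_{S_\lambda}(x,y)=(\alpha(x,y),\beta(y))$ (with each $\alpha_y=\alpha(\cdot,y)$ a homeomorphism of $\mathbb{R}$ for interior $y$ and $\beta$ a homeomorphism of the $y$-intervals), $\delta(\lambda)=+1$ if the $\alpha_y$ are increasing and $-1$ otherwise, $\tau(\lambda)=+1$ if $\beta$ is increasing and $-1$ otherwise. (2) Conversely, every isomorphism $G\to G'$ is induced in this way by some equivalence of the striped atlases $q$ and $q'$.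
   Context: Strips, boundary intervals ($\partial_\pm S$), model strips, canonical foliations and foliated homeomorphisms: a strip is $S\subset\mathbb{R}^2$ with $\mathbb{R}\times(u,v)\subset S\subset\mathbb{R}\times[u,v]$, $u<v$, open in $\mathbb{R}\times[u,v]$; $\partial_-S=S\cap(\mathbb{R}\times\{u\})$, $\partial_+S=S\cap(\mathbb{R}\times\{v\})$; boundary intervals are the components of $\partial S=\partial_-S\cup\partial_+S$; leaves of the canonical foliation are the lines $\mathbb{R}\times\{t\}$, $t\in(u,v)$, and the boundary intervals. Each of $\partial_\pm S$ is linearly ordered by $(a,x)<(b,x)$ iff $a<b$, inducing a linear order on the boundary intervals in $\partial_-S$ and on those in $\partial_+S$. Striped atlas: a quotient map $q:\mathcal{S}_0=\bigsqcup_{\lambda\in\Lambda}S_\lambda\to Z$ onto a 2-manifold from an at most countable disjoint union of strips, together with families $\{X_\gamma\}_{\gamma\in\Gamma}$, $\{Y_\gamma\}_{\gamma\in\Gamma}$ of mutually distinct boundary intervals such that $q$ is injective off $\bigcup_\gamma(X_\gamma\cup Y_\gamma)$, $q(X_\gamma)=q(Y_\gamma)$, and $q|_{X_\gamma},q|_{Y_\gamma}$ are embeddings with closed images. Gluing maps $\phi_\gamma=(q|_{X_\gamma})^{-1}\circ q|_{Y_\gamma}:Y_\gamma\to X_\gamma$. Equivalence of atlases $q,q'$: a pair of foliated homeomorphisms $h:\mathcal{S}_0\to\mathcal{S}'_0$, $k:Z\to Z'$ with $q'\circ h=k\circ q$ (foliation on $Z$: images of the leaves of the strips). For a homeomorphism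 $f$ between open horizontal intervals let $\mathrm{or}(f)=+1$ if $f$ preserves the order of first coordinates and $-1$ otherwise. Graph of the atlas $q$: $G=(\Lambda,H,\xi,\sigma)$ where $\Lambda$ is the index set of strips (vertices); $H=\bigsqcup_\lambda(d_{-1}(\lambda)\sqcup d_{+1}(\lambda))$, where $d_{-1}(\lambda)$ (resp. $d_{+1}(\lambda)$) is the set of boundary intervals of $\partial_-S_\lambda$ (resp. $\partial_+S_\lambda$) with its linear order (half-edges), $d(\lambda)=d_{-1}(\lambda)\sqcup d_{+1}(\lambda)$; $\xi:H\to H$ is the involution with $\xi(X_\gamma)=Y_\gamma$, $\xi(Y_\gamma)=X_\gamma$ and $\xi(X)=X$ for all other $X$; unordered pairs $\{X,\xi(X)\}$ with $X\ne\xi(X)$ are closed edges, and $\sigma(X_\gamma,Y_\gamma)=\sigma(Y_\gamma,X_\gamma)=\mathrm{or}(\phi_\gamma)\in\{\pm1\}$. An isomorphism $G\to G'$ is a quadruple $(\nu,\eta,\delta,\tau)$ with bijections $\nu:\Lambda\to\Lambda'$, $\eta:H\to H'$ and maps $\delta,\tau:\Lambda\to\{\pm1\}$ such that: (a) $\eta(d_s(\lambda))=d'_{\tau(\lambda)s}(\nu(\lambda))$ for all $\lambda$ and $s\in\{\pm1\}$, and both restrictions $\eta|_{d_{\pm1}(\lambda)}$ are increasing if $\delta(\lambda)=+1$ and decreasing if $\delta(\lambda)=-1$; (b) $\xi'\circ\eta=\eta\circ\xi$; (c) for every closed edge $\{X,Y\}$ of $G$ with $X\in d(\lambda)$, $Y=\xi(X)\in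 d(\mu)$: $\delta(\lambda)\,\sigma(X,Y)=\sigma'(\eta(X),\eta(Y))\,\delta(\mu)$. *)

theory Defs
  imports "HOL-Analysis.Analysis"
begin

definition is_strip :: "(real \<times> real) set \<Rightarrow> bool" where
  "is_strip S \<longleftrightarrow> (\<exists>u v. u < v \<and> UNIV \<times> {u<..<v} \<subseteq> S \<and> S \<subseteq> UNIV \<times> {u..v} \<and>
      openin (subtopology euclidean (UNIV \<times> {u..v})) S)"

text \<open>For a strip, u and v are recovered as inf / sup of the second coordinates.\<close>
definition strip_lo :: "(real \<times> real) set \<Rightarrow> real" where
  "strip_lo S = Inf (snd ` S)"

definition strip_hi :: "(real \<times> real) set \<Rightarrow> real" where
  "strip_hi S = Sup (snd ` S)"

definition bd :: "int \<Rightarrow> (real \<times> real) set \<Rightarrow> (real \<times> real) set" where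
  "bd s S = (if s = -1 then S \<inter> (UNIV \<times> {strip_lo S}) else S \<inter> (UNIV \<times> {strip_hi S}))"

definition bdry_intervals :: "(real \<times> real) set \<Rightarrow> (real \<times> real) set set" where
  "bdry_intervals S = components (bd (-1) S) \<union> components (bd 1 S)"

definition strip_leaves :: "(real \<times> real) set \<Rightarrow> (real \<times> real) set set" where
  "strip_leaves S = {UNIV \<times> {t} | t. strip_lo S < t \<and> t < strip_hi S} \<union> bdry_intervals S"

record ('i, 'g, 'z) striped_atlas =
  Lam :: "'i set"
  strip :: "'i \<Rightarrow> (real \<times> real) set"
  Zsp :: "'z topology"
  qmap :: "'i \<times> (real \<times> real) \<Rightarrow> 'z"
  Gam :: "'g set"
  Xg :: "'g \<Rightarrow> ('i \<times> (real \<times> real)) set"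
  Yg :: "'g \<Rightarrow> ('i \<times> (real \<times> real)) set"

definition S0 :: "('i, 'g, 'z, 'm) striped_atlas_scheme \<Rightarrow> ('i \<times> (real \<times> real)) set" where
  "S0 A = Sigma (Lam A) (strip A)"

definition S0top :: "('i, 'g, 'z, 'm) striped_atlas_scheme \<Rightarrow> ('i \<times> (real \<times> real)) topology" where
  "S0top A = subtopology (prod_topology (discrete_topology UNIV) euclidean) (S0 A)"

definition d :: "('i, 'g, 'z, 'm) striped_atlas_scheme \<Rightarrow> int \<Rightarrow> 'i \<Rightarrow> ('i \<times> (real \<times> real)) set set" where
  "d A s lam = {{lam} \<times> B | B. B \<in> components (bd s (strip A lam))}"

definition dall :: "('i, 'g, 'z, 'm) striped_atlas_scheme \<Rightarrow> 'i \<Rightarrow> ('i \<times> (real \<times> real)) set set" where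
  "dall A lam = d A (-1) lam \<union> d A 1 lam"

definition H :: "('i, 'g, 'z, 'm) striped_atlas_scheme \<Rightarrow> ('i \<times> (real \<times> real)) set set" where
  "H A = (\<Union>lam\<in>Lam A. dall A lam)"

definition S0_leaves :: "('i, 'g, 'z, 'm) striped_atlas_scheme \<Rightarrow> ('i \<times> (real \<times> real)) set set" where
  "S0_leaves A = {{lam} \<times> L | lam L. lam \<in> Lam A \<and> L \<in> strip_leaves (strip A lam)}"

definition Z_leaves :: "('i, 'g, 'z, 'm) striped_atlas_scheme \<Rightarrow> 'z set set" where
  "Z_leaves A = (\<lambda>L. qmap A ` L) ` S0_leaves A"

definition is_2manifold :: "'z topology \<Rightarrow> bool" where
  "is_2manifold T \<longleftrightarrow> (\<forall>z\<in>topspace T. \<exists>U. openin T U \<and> z \<in> U \<and>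
     (\<exists>V :: (real \<times> real) set. openin (subtopology euclidean {p. snd p \<ge> 0}) V \<and>
        (subtopology T U) homeomorphic_space (subtopology euclidean V)))"

definition is_striped_atlas :: "('i, 'g, 'z, 'm) striped_atlas_scheme \<Rightarrow> bool" where
  "is_striped_atlas A \<longleftrightarrow>
     countable (Lam A) \<and>
     (\<forall>lam\<in>Lam A. is_strip (strip A lam)) \<and>
     is_2manifold (Zsp A) \<and>
     quotient_map (S0top A) (Zsp A) (qmap A) \<and>
     (\<forall>g\<in>Gam A. Xg A g \<in> H A \<and> Yg A g \<in> H A) \<and>
     inj_on (Xg A) (Gam A) \<and> inj_on (Yg A) (Gam A) \<and> Xg A ` Gam A \<inter> Yg A ` Gam A = {} \<and>
     inj_on (qmap A) (S0 A - (\<Union>g\<in>Gam A. Xg A g \<union> Yg A g)) \<and>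
     (\<forall>g\<in>Gam A. qmap A ` Xg A g = qmap A ` Yg A g \<and>
        embedding_map (subtopology (S0top A) (Xg A g)) (Zsp A) (qmap A) \<and>
        embedding_map (subtopology (S0top A) (Yg A g)) (Zsp A) (qmap A) \<and>
        closedin (Zsp A) (qmap A ` Xg A g) \<and> closedin (Zsp A) (qmap A ` Yg A g))"

definition xc :: "'i \<times> (real \<times> real) \<Rightarrow> real" where
  "xc p = fst (snd p)"

definition glue :: "('i, 'g, 'z, 'm) striped_atlas_scheme \<Rightarrow> 'g \<Rightarrow> 'i \<times> (real \<times> real) \<Rightarrow> 'i \<times> (real \<times> real)" where
  "glue A g y = (THE x. x \<in> Xg A g \<and> qmap A x = qmap A y)"

definition orient :: "('a \<times> (real \<times> real) \<Rightarrow> 'b \<times> (real \<times> real)) \<Rightarrow> ('a \<times> (real \<times> real)) set \<Rightarrow> int" where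
  "orient f P = (if \<forall>a\<in>P. \<forall>b\<in>P. xc a < xc b \<longrightarrow> xc (f a) < xc (f b) then 1 else -1)"

definition xi :: "('i, 'g, 'z, 'm) striped_atlas_scheme \<Rightarrow> ('i \<times> (real \<times> real)) set \<Rightarrow> ('i \<times> (real \<times> real)) set" where
  "xi A P = (if \<exists>g\<in>Gam A. P = Xg A g then Yg A (SOME g. g \<in> Gam A \<and> P = Xg A g)
             else if \<exists>g\<in>Gam A. P = Yg A g then Xg A (SOME g. g \<in> Gam A \<and> P = Yg A g)
             else P)"

definition sigma :: "('i, 'g, 'z, 'm) striped_atlas_scheme \<Rightarrow> ('i \<times> (real \<times> real)) set \<Rightarrow> ('i \<times> (real \<times> real)) set \<Rightarrow> int" where
  "sigma A P Q = (let g = (SOME g. g \<in> Gam A \<and> ((P = Xg A g \<and> Q = Yg A g) \<or> (P = Yg A g \<and> Q = Xg A g)))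
                  in orient (glue A g) (Yg A g))"

definition hlt :: "('i \<times> (real \<times> real)) set \<Rightarrow> ('i \<times> (real \<times> real)) set \<Rightarrow> bool" where
  "hlt P Q \<longleftrightarrow> (\<forall>p\<in>P. \<forall>q\<in>Q. xc p < xc q)"

definition is_graph_iso ::
  "('i, 'g, 'z, 'm) striped_atlas_scheme \<Rightarrow> ('j, 'h, 'w, 'n) striped_atlas_scheme \<Rightarrow>
   ('i \<Rightarrow> 'j) \<Rightarrow> (('i \<times> (real \<times> real)) set \<Rightarrow> ('j \<times> (real \<times> real)) set) \<Rightarrow>
   ('i \<Rightarrow> int) \<Rightarrow> ('i \<Rightarrow> int) \<Rightarrow> bool" where
  "is_graph_iso A B nu eta delta tau \<longleftrightarrow>
     bij_betw nu (Lam A) (Lam B) \<and> bij_betw eta (H A) (H B) \<and>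
     (\<forall>lam\<in>Lam A. delta lam \<in> {-1, 1} \<and> tau lam \<in> {-1, 1}) \<and>
     (\<forall>lam\<in>Lam A. \<forall>s\<in>{-1, 1::int}.
        eta ` d A s lam = d B (tau lam * s) (nu lam) \<and>
        (delta lam = 1 \<longrightarrow> (\<forall>P\<in>d A s lam. \<forall>Q\<in>d A s lam. hlt P Q \<longrightarrow> hlt (eta P) (eta Q))) \<and>
        (delta lam = -1 \<longrightarrow> (\<forall>P\<in>d A s lam. \<forall>Q\<in>d A s lam. hlt P Q \<longrightarrow> hlt (eta Q) (eta P)))) \<and>
     (\<forall>P\<in>H A. xi B (eta P) = eta (xi A P)) \<and>
     (\<forall>P\<in>H A. xi A P \<noteq> P \<longrightarrow> (\<forall>lam\<in>Lam A. \<forall>mu\<in>Lam A.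
        P \<in> dall A lam \<longrightarrow> xi A P \<in> dall A mu \<longrightarrow>
        delta lam * sigma A P (xi A P) = sigma B (eta P) (eta (xi A P)) * delta mu))"

definition foliated_homeo :: "'a topology \<Rightarrow> 'a set set \<Rightarrow> 'b topology \<Rightarrow> 'b set set \<Rightarrow> ('a \<Rightarrow> 'b) \<Rightarrow> bool" where
  "foliated_homeo T F T' F' f \<longleftrightarrow> homeomorphic_map T T' f \<and>
     (\<forall>L\<in>F. f ` L \<in> F') \<and> (\<forall>L'\<in>F'. \<exists>L\<in>F. f ` L = L')"

definition atlas_equiv ::
  "('i, 'g, 'z, 'm) striped_atlas_scheme \<Rightarrow> ('j, 'h, 'w, 'n) striped_atlas_scheme \<Rightarrow>
   ('i \<times> (real \<times> real) \<Rightarrow> 'j \<times> (real \<times> real)) \<Rightarrow> ('z \<Rightarrow> 'w) \<Rightarrow> bool" where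
  "atlas_equiv A B h k \<longleftrightarrow>
     foliated_homeo (S0top A) (S0_leaves A) (S0top B) (S0_leaves B) h \<and>
     foliated_homeo (Zsp A) (Z_leaves A) (Zsp B) (Z_leaves B) k \<and>
     (\<forall>p\<in>S0 A. qmap B (h p) = k (qmap A p))"

definition induced_nu :: "('i, 'g, 'z, 'm) striped_atlas_scheme \<Rightarrow> ('j, 'h, 'w, 'n) striped_atlas_scheme \<Rightarrow>
   ('i \<times> (real \<times> real) \<Rightarrow> 'j \<times> (real \<times> real)) \<Rightarrow> 'i \<Rightarrow> 'j" where
  "induced_nu A B h lam = (THE mu. mu \<in> Lam B \<and> h ` ({lam} \<times> strip A lam) = {mu} \<times> strip B mu)"

definition induced_delta :: "('i, 'g, 'z, 'm) striped_atlas_scheme \<Rightarrow>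
   ('i \<times> (real \<times> real) \<Rightarrow> 'j \<times> (real \<times> real)) \<Rightarrow> 'i \<Rightarrow> int" where
  "induced_delta A h lam =
     (if \<forall>y a b. strip_lo (strip A lam) < y \<and> y < strip_hi (strip A lam) \<and> a < b \<longrightarrow>
           fst (snd (h (lam, (a, y)))) < fst (snd (h (lam, (b, y)))) then 1 else -1)"

definition induced_tau :: "('i, 'g, 'z, 'm) striped_atlas_scheme \<Rightarrow>
   ('i \<times> (real \<times> real) \<Rightarrow> 'j \<times> (real \<times> real)) \<Rightarrow> 'i \<Rightarrow> int" where
  "induced_tau A h lam =
     (if \<forall>p\<in>strip A lam. \<forall>p'\<in>strip A lam. snd p < snd p' \<longrightarrow>
           snd (snd (h (lam, p))) < snd (snd (h (lam, p'))) then 1 else -1)"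

end

theory Submission
  imports Defs
begin

text \<open>
  Let \<open>mate\<close> be the involution of the disjoint union of the strips that exchanges the points of \<open>X\<^sub>\<gamma>\<close>
  and \<open>Y\<^sub>\<gamma>\<close> with the same image under \<open>q\<close> and fixes all other points. By invariance of domain the
  interior of a strip, and two collars folded together along a pair of glued boundary intervals, have
  open images in \<open>Z\<close>. A further point of a fibre of \<open>q\<close> would be a limit of interior points, so it cannot
  exist: the fibres are the pairs \<open>{p, mate p}\<close>, and an equivalence of atlases is the same as a foliated
  homeomorphism \<open>h\<close> of the strips that commutes with \<open>mate\<close>. Since \<open>\<xi>\<close> and \<open>\<sigma>\<close> record the action of
  \<open>mate\<close> on the boundary intervals and its monotonicity there, part (1) amounts to composing monotone maps
  along the two sides of \<open>h \<circ> mate = mate \<circ> h\<close>. For part (2) one chooses order isomorphisms of the boundary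
  intervals compatible with \<open>mate\<close> and extends them over each strip: in the coordinate \<open>s = x + f x\<close> the
  graph of a strictly increasing \<open>f\<close> is given by a pair of monotone Lipschitz functions of \<open>s\<close>; these
  are interpolated across the strip, with a multiple of the identity added in the interior.
\<close>

section \<open>Signed monotonicity\<close>

definition signed_mono_on :: "int \<Rightarrow> 'a set \<Rightarrow> ('a \<Rightarrow> real) \<Rightarrow> ('a \<Rightarrow> real) \<Rightarrow> bool" where
  "signed_mono_on e A c f \<longleftrightarrow> e \<in> {-1, 1} \<and> (\<forall>a\<in>A. \<forall>b\<in>A. c a < c b \<longrightarrow> e * f a < e * f b)"

lemma signed_mono_onI:
  fixes c f :: "'a \<Rightarrow> real"
  assumes "e \<in> {-1, 1}" "\<And>a b. a \<in> A \<Longrightarrow> b \<in> A \<Longrightarrow> c a < c b \<Longrightarrow> e * f a < e * f b"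
  shows "signed_mono_on e A c f"
  using assms by (simp add: signed_mono_on_def)

lemma signed_mono_onD: "signed_mono_on e A c f \<Longrightarrow> a \<in> A \<Longrightarrow> b \<in> A \<Longrightarrow> c a < c b \<Longrightarrow> e * f a < e * f b"
  by (simp add: signed_mono_on_def)

lemma signed_mono_on_sign: "signed_mono_on e A c f \<Longrightarrow> e \<in> {-1, 1}"
  by (simp add: signed_mono_on_def)

lemma signed_mono_on_subset: "signed_mono_on e A c f \<Longrightarrow> B \<subseteq> A \<Longrightarrow> signed_mono_on e B c f"
  unfolding signed_mono_on_def by blast

lemma signed_mono_on_cong:
  assumes "\<And>a. a \<in> A \<Longrightarrow> c a = c' a" "\<And>a. a \<in> A \<Longrightarrow> f a = f' a"
  shows "signed_mono_on e A c f \<longleftrightarrow> signed_mono_on e A c' f'"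
  using assms by (simp add: signed_mono_on_def)

lemma signed_mono_on_image: "signed_mono_on e (h ` A) c f \<longleftrightarrow> signed_mono_on e A (c \<circ> h) (f \<circ> h)"
  by (simp add: signed_mono_on_def)

lemma signed_mono_on_trans:
  assumes "signed_mono_on e A c f" "signed_mono_on e' A f g"
  shows "signed_mono_on (e * e') A c g"
  using assms unfolding signed_mono_on_def by fastforce

lemma signed_mono_on_sym:
  assumes "signed_mono_on e A c f" "\<And>a b. a \<in> A \<Longrightarrow> b \<in> A \<Longrightarrow> c a = c b \<Longrightarrow> f a = f b"
  shows "signed_mono_on e A f c"
proof (rule signed_mono_onI)
  show e: "e \<in> {-1, 1}"
    using assms(1) by (rule signed_mono_on_sign)
  show "e * c a < e * c b" if "a \<in> A" "b \<in> A" "f a < f b" for a b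
    using signed_mono_onD[OF assms(1), of a b] signed_mono_onD[OF assms(1), of b a] assms(2)[of a b]
      that e
    by (cases "c a" "c b" rule: linorder_cases) auto
qed

lemma signed_mono_on_unique:
  assumes "signed_mono_on e A c f" "signed_mono_on e' A c f" "a \<in> A" "b \<in> A" "c a < c b"
  shows "e = e'"
  using assms unfolding signed_mono_on_def by fastforce

lemma signed_mono_on_inj:
  assumes "signed_mono_on e A c f" "a \<in> A" "b \<in> A" "f a = f b"
  shows "c a = c b"
  using assms unfolding signed_mono_on_def by (metis less_irrefl linorder_neqE_linordered_idom)

lemma continuous_inj_signed_mono_on:
  fixes f :: "real \<Rightarrow> real"
  assumes "connected I" "continuous_on I f" "inj_on f I"
  obtains e where "signed_mono_on e I (\<lambda>x. x) f"
proof -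
  have "strict_mono_on I f \<or> strict_antimono_on I f"
    using assms injective_eq_monotone_map by (simp add: is_interval_connected_1)
  then have "signed_mono_on 1 I (\<lambda>x. x) f \<or> signed_mono_on (-1) I (\<lambda>x. x) f"
    by (auto simp: signed_mono_on_def monotone_on_def)
  then show thesis using that by blast
qed

lemma open_bounded_interval_real:
  fixes I :: "real set"
  assumes I: "open I" "connected I" "I \<noteq> {}" "bounded I"
  shows "I = {Inf I<..<Sup I}"
proof (intro equalityI subsetI)
  have bdd: "bdd_below I" "bdd_above I"
    using I(4) bounded_imp_bdd_below bounded_imp_bdd_above by auto
  fix x assume x: "x \<in> I"
  obtain b c where "b < x" "{b<..x} \<subseteq> I" "x < c" "{x..<c} \<subseteq> I"
    using open_left[OF I(1) x, of "x - 1"] open_right[OF I(1) x, of "x + 1"] by auto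
  then have "(b + x) / 2 \<in> I" "(x + c) / 2 \<in> I"
    by auto
  from cInf_lower[OF this(1) bdd(1)] cSup_upper[OF this(2) bdd(2)]
  have "Inf I \<le> (b + x) / 2" "(x + c) / 2 \<le> Sup I" .
  then show "x \<in> {Inf I<..<Sup I}"
    using \<open>b < x\<close> \<open>x < c\<close> by simp
next
  fix x assume "x \<in> {Inf I<..<Sup I}"
  then obtain a b where "a \<in> I" "a < x" "b \<in> I" "x < b"
    using I(3) by (metis cInf_lessD less_cSupD greaterThanLessThan_iff)
  then show "x \<in> I"
    using connectedD_interval[OF I(2)] by (meson less_imp_le)
qed

lemma affine_signed_iso:
  fixes a b c d :: real
  assumes "a < b" "c < d" and e: "e \<in> {-1, 1}"
  obtains f where "f ` {a<..<b} = {c<..<d}" "signed_mono_on e {a<..<b} (\<lambda>x. x) f"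
proof -
  define r where "r = (d - c) / (b - a)"
  define f where "f x = (c + d) / 2 + e * r * (x - (a + b) / 2)" for x
  have r: "r > 0" "r * ((b - a) / 2) = (d - c) / 2"
    using assms by (auto simp: r_def)
  have "f x \<in> {c<..<d} \<longleftrightarrow> x \<in> {a<..<b}" for x
  proof -
    have "f x \<in> {c<..<d} \<longleftrightarrow> \<bar>f x - (c + d) / 2\<bar> < (d - c) / 2"
      by (auto simp: abs_less_iff field_simps)
    also have "\<bar>f x - (c + d) / 2\<bar> = r * \<bar>x - (a + b) / 2\<bar>"
      using e r(1) by (auto simp: f_def abs_mult)
    also have "\<dots> < (d - c) / 2 \<longleftrightarrow> \<bar>x - (a + b) / 2\<bar> < (b - a) / 2"
      using r by (metis mult_less_cancel_left_pos)
    also have "\<dots> \<longleftrightarrow> x \<in> {a<..<b}"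
      by (auto simp: abs_less_iff field_simps)
    finally show ?thesis .
  qed
  moreover have "f ((a + b) / 2 + (y - (c + d) / 2) / (e * r)) = y" for y
    using e r(1) by (auto simp: f_def)
  ultimately have "f ` {a<..<b} = {c<..<d}"
    by (metis (no_types, lifting) image_eqI image_subset_iff subset_antisym subsetI)
  moreover have "signed_mono_on e {a<..<b} (\<lambda>x. x) f"
    by (rule signed_mono_onI[OF e]) (use e r(1) in \<open>auto simp: f_def\<close>)
  ultimately show thesis
    using that by blast
qed

lemma arctan_image_open_interval:
  fixes I :: "real set"
  assumes I: "open I" "connected I" "I \<noteq> {}"
  obtains a b where "a < b" "arctan ` I = {a<..<b}"
proof -
  have "bounded (arctan ` I)"
    by (rule bounded_subset[OF bounded_box[of "- (pi / 2)" "pi / 2"]])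
      (use arctan_lbound arctan_ubound in auto)
  moreover have "open (arctan ` I)"
    using I(1) by (intro invariance_of_domain continuous_intros) (auto simp: inj_on_def arctan_eq_iff)
  moreover have "connected (arctan ` I)"
    using I(2) by (intro connected_continuous_image continuous_intros)
  ultimately have "arctan ` I = {Inf (arctan ` I)<..<Sup (arctan ` I)}"
    using I(3) by (intro open_bounded_interval_real) auto
  then show thesis
    using that I(3) by (metis greaterThanLessThan_empty_iff image_is_empty not_le)
qed

lemma open_interval_signed_iso:
  fixes I J :: "real set"
  assumes I: "open I" "connected I" "I \<noteq> {}" and J: "open J" "connected J" "J \<noteq> {}" and e: "e \<in> {-1, 1}"
  obtains f where "f ` I = J" "signed_mono_on e I (\<lambda>x. x) f"
proof -
  obtain a b where ab: "a < b" "arctan ` I = {a<..<b}"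
    using I by (rule arctan_image_open_interval)
  obtain c d where cd: "c < d" "arctan ` J = {c<..<d}"
    using J by (rule arctan_image_open_interval)
  obtain g where g: "g ` arctan ` I = arctan ` J" "signed_mono_on e (arctan ` I) (\<lambda>x. x) g"
    using affine_signed_iso[OF ab(1) cd(1) e] ab(2) cd(2) by metis
  define f where "f = tan \<circ> g \<circ> arctan"
  have "f ` I = J"
    unfolding f_def image_comp[symmetric] g(1) by (simp add: image_comp tan_arctan)
  moreover have arctan_f: "arctan (f x) = g (arctan x)" if "x \<in> I" for x
  proof -
    have "g (arctan x) \<in> arctan ` J"
      using g(1) that by blast
    then show ?thesis
      by (auto simp: f_def tan_arctan)
  qed
  have "signed_mono_on e I (\<lambda>x. x) f"
  proof (rule signed_mono_onI[OF e])
    fix x y assume xy: "x \<in> I" "y \<in> I" "x < y"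
    then have "e * arctan (f x) < e * arctan (f y)"
      using signed_mono_onD[OF g(2), of "arctan x" "arctan y"] by (simp add: arctan_f arctan_less_iff)
    then show "e * f x < e * f y"
      using e by (auto simp: arctan_less_iff)
  qed
  ultimately show thesis
    using that by blast
qed

section \<open>Homeomorphisms\<close>

lemma homeomorphic_map_top_of_set:
  "homeomorphic_map (top_of_set S) (top_of_set T) f \<longleftrightarrow> (\<exists>g. homeomorphism S T f g)"
proof -
  have "homeomorphic_maps (top_of_set S) (top_of_set T) f g \<longleftrightarrow> homeomorphism S T f g" for g
    by (auto simp: homeomorphic_maps_def homeomorphism_def) (metis Pi_iff imageI)+
  then show ?thesis
    by (simp add: homeomorphic_map_maps)
qed

lemma homeomorphism_image_interior:
  fixes f :: "'a::euclidean_space \<Rightarrow> 'a"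
  assumes fg: "homeomorphism S T f g"
  shows "f ` interior S = interior T"
proof -
  have image_subset: "f ` interior S \<subseteq> interior T"
    if fg: "homeomorphism S T f g" for S T and f g :: "'a \<Rightarrow> 'a"
  proof (rule interior_maximal)
    show "f ` interior S \<subseteq> T"
      using homeomorphism_image1[OF fg] interior_subset by blast
    have "inj_on f (interior S)"
      using homeomorphism_apply1[OF fg] interior_subset by (metis inj_onI subsetD)
    then show "open (f ` interior S)"
      by (intro invariance_of_domain continuous_on_subset[OF homeomorphism_cont1[OF fg]] interior_subset
        open_interior)
  qed
  have "interior T = f ` g ` interior T"
    using homeomorphism_apply2[OF fg] interior_subset by (force simp: image_image)
  then show ?thesis
    using image_subset[OF fg] image_subset[OF homeomorphism_symD[OF fg]] by blast
qed

lemma connected_components_of_top_of_set: "connected_components_of (top_of_set S) = components S"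
proof -
  have "connected_component_of (top_of_set S) = connected_component S"
    by (auto simp: fun_eq_iff connected_component_of_def connected_component_def connectedin_subtopology)
  then show ?thesis
    by (simp add: connected_components_of_def components_def)
qed

lemma homeomorphic_map_image_components:
  "homeomorphic_map (top_of_set S) (top_of_set T) f \<Longrightarrow> components T = (`) f ` components S"
  unfolding connected_components_of_top_of_set[symmetric]
  by (rule homeomorphic_map_connected_components_of)

lemma quotient_maps_same_fibres:
  assumes p: "quotient_map X Y p" and r: "quotient_map X Z r"
    and fibres: "\<And>x y. x \<in> topspace X \<Longrightarrow> y \<in> topspace X \<Longrightarrow> p x = p y \<longleftrightarrow> r x = r y"
  shows "\<exists>k. homeomorphic_map Y Z k \<and> (\<forall>x\<in>topspace X. k (p x) = r x)"
proof -
  obtain k where k: "continuous_map Y Z k" "\<And>x. x \<in> topspace X \<Longrightarrow> k (p x) = r x"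
    using quotient_map_lift_exists[OF p quotient_imp_continuous_map[OF r]] fibres by metis
  have "quotient_map X Z (k \<circ> p)"
    by (rule quotient_map_eq[OF r]) (simp add: k(2))
  then have "quotient_map Y Z k"
    using quotient_map_from_composition[OF quotient_imp_continuous_map[OF p] k(1)] by blast
  moreover have "inj_on k (topspace Y)"
    using fibres k(2) by (auto simp: inj_on_def quotient_imp_surjective_map[OF p, symmetric])
  ultimately have "homeomorphic_map Y Z k"
    by (simp add: homeomorphic_map_def)
  then show ?thesis
    using k(2) by blast
qed

lemma continuous_inj_open_image_2manifold:
  fixes f :: "real \<times> real \<Rightarrow> 'z"
  assumes T: "is_2manifold T" and W: "open W" and f: "continuous_map (top_of_set W) T f"
    and inj: "inj_on f W"
  shows "openin T (f ` W)"
proof (subst openin_subopen, intro ballI)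
  fix z assume "z \<in> f ` W"
  then obtain w where w: "w \<in> W" "z = f w"
    by blast
  then have "z \<in> topspace T"
    using f by (auto simp: continuous_map_def)
  then obtain U V and \<phi> :: "'z \<Rightarrow> real \<times> real" where U: "openin T U" "z \<in> U"
    and chart: "homeomorphic_map (subtopology T U) (top_of_set V) \<phi>"
    using T unfolding is_2manifold_def homeomorphic_space by blast
  have topspace_U: "topspace (subtopology T U) = U"
    using openin_subset[OF U(1)] by (simp add: Int_absorb1)
  define W' where "W' = {w \<in> W. f w \<in> U}"
  have "openin (top_of_set W) W'"
    using openin_continuous_map_preimage[OF f U(1)] by (simp add: W'_def)
  then have W': "open W'"
    using W openin_open_trans by blast
  have "continuous_map (top_of_set W') (subtopology T U) f"
    using continuous_map_from_subtopology_mono[OF f, of W']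
    by (auto simp: W'_def continuous_map_in_subtopology)
  then have "continuous_map (top_of_set W') (top_of_set V) (\<phi> \<circ> f)"
    using homeomorphic_imp_continuous_map[OF chart] by (rule continuous_map_compose)
  then have chart_f: "continuous_on W' (\<phi> \<circ> f)" "(\<phi> \<circ> f) ` W' \<subseteq> V"
    by (auto simp: continuous_map_in_subtopology)
  have "inj_on \<phi> U"
    using homeomorphic_imp_injective_map[OF chart] topspace_U by simp
  then have "inj_on (\<phi> \<circ> f) W'"
    using inj by (auto simp: inj_on_def W'_def)
  then have "open ((\<phi> \<circ> f) ` W')"
    using chart_f(1) W' by (intro invariance_of_domain)
  then have "openin (top_of_set V) (\<phi> ` f ` W')"
    using chart_f(2) by (simp add: open_subset image_comp)
  moreover have "f ` W' \<subseteq> U"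
    by (auto simp: W'_def)
  ultimately have "openin (subtopology T U) (f ` W')"
    using homeomorphic_map_openness[OF chart, of "f ` W'"] topspace_U by metis
  then have "openin T (f ` W')"
    using U(1) openin_trans_full by blast
  then show "\<exists>V. openin T V \<and> z \<in> V \<and> V \<subseteq> f ` W"
    using w U(2) by (intro exI[of _ "f ` W'"]) (auto simp: W'_def)
qed

lemma connected_nonzero_sign:
  fixes f :: "'a::topological_space \<Rightarrow> real"
  assumes "connected K" "continuous_on K f" "\<And>x. x \<in> K \<Longrightarrow> f x \<noteq> 0"
  shows "\<exists>e\<in>{-1, 1 :: int}. \<forall>x\<in>K. 0 < e * f x"
proof -
  have "connected (f ` K)"
    using assms(1,2) by (rule connected_continuous_image[rotated])
  then have "(\<forall>x\<in>K. 0 < f x) \<or> (\<forall>x\<in>K. f x < 0)"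
    using assms(3) connectedD_interval[of "f ` K" _ _ 0] by (force simp: not_less)
  then show ?thesis
    by auto
qed

lemma continuous_on_le_closure:
  fixes f :: "'a::topological_space \<Rightarrow> real"
  assumes f: "continuous_on S f" and A: "A \<subseteq> S" and p: "p \<in> S" "p \<in> closure A"
    and bound: "\<And>a. a \<in> A \<Longrightarrow> f a \<le> c"
  shows "f p \<le> c"
proof -
  obtain C where C: "closed C" "{x \<in> S. f x \<le> c} = S \<inter> C"
    using continuous_closedin_preimage[OF f closed_atMost, of c]
    by (auto simp: closedin_closed vimage_def Int_def)
  then have "closure A \<subseteq> C"
    using A bound by (intro closure_minimal) auto
  then show ?thesis
    using C(2) p by blast
qed

section \<open>Strips\<close>

definition bd_height :: "int \<Rightarrow> (real \<times> real) set \<Rightarrow> real" where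
  "bd_height s S = (if s = -1 then strip_lo S else strip_hi S)"

definition bd_trace :: "int \<Rightarrow> (real \<times> real) set \<Rightarrow> real set" where
  "bd_trace s S = {x. (x, bd_height s S) \<in> S}"

lemma bd_eq_image_bd_trace: "bd s S = (\<lambda>x. (x, bd_height s S)) ` bd_trace s S"
  by (auto simp: bd_def bd_trace_def bd_height_def)

lemma strip_lo_hi_eq:
  assumes uv: "u < v" and sub: "UNIV \<times> {u<..<v} \<subseteq> S" "S \<subseteq> UNIV \<times> {u..v}"
  shows "strip_lo S = u" "strip_hi S = v"
proof -
  have mem: "w \<in> snd ` S" if "u < w" "w < v" for w
    using sub(1) that by force
  then have ne: "snd ` S \<noteq> {}"
    using dense[OF uv] by blast
  show "strip_lo S = u"
    unfolding strip_lo_def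
  proof (rule cInf_eq_non_empty[OF ne])
    show "y \<le> u" if "\<And>w. w \<in> snd ` S \<Longrightarrow> y \<le> w" for y
      using dense_ge_bounded[OF uv] mem that by blast
  qed (use sub(2) in auto)
  show "strip_hi S = v"
    unfolding strip_hi_def
  proof (rule cSup_eq_non_empty[OF ne])
    show "v \<le> y" if "\<And>w. w \<in> snd ` S \<Longrightarrow> w \<le> y" for y
      using dense_le_bounded[OF uv] mem that by blast
  qed (use sub(2) in auto)
qed

lemma is_strip_iff:
  "is_strip S \<longleftrightarrow> strip_lo S < strip_hi S \<and> UNIV \<times> {strip_lo S<..<strip_hi S} \<subseteq> S \<and>
     S \<subseteq> UNIV \<times> {strip_lo S..strip_hi S} \<and>
     openin (top_of_set (UNIV \<times> {strip_lo S..strip_hi S})) S" (is "_ \<longleftrightarrow> ?strip S")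
proof
  assume "is_strip S"
  then obtain u v where "u < v" "UNIV \<times> {u<..<v} \<subseteq> S" "S \<subseteq> UNIV \<times> {u..v}"
    "openin (top_of_set (UNIV \<times> {u..v})) S"
    by (auto simp: is_strip_def)
  moreover from strip_lo_hi_eq[OF this(1-3)] have "strip_lo S = u" "strip_hi S = v" .
  ultimately show "?strip S"
    by simp
qed (auto simp: is_strip_def)

lemma strip_lo_less_hi: "is_strip S \<Longrightarrow> strip_lo S < strip_hi S"
  by (simp add: is_strip_iff)

lemma mem_strip_iff:
  assumes "is_strip S"
  shows "(x, y) \<in> S \<longleftrightarrow>
    strip_lo S < y \<and> y < strip_hi S \<or> (\<exists>s\<in>{-1, 1}. y = bd_height s S \<and> x \<in> bd_trace s S)"
proof -
  have "UNIV \<times> {strip_lo S<..<strip_hi S} \<subseteq> S" "S \<subseteq> UNIV \<times> {strip_lo S..strip_hi S}"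
    using assms by (simp_all add: is_strip_iff)
  then have "(x, y) \<in> S \<Longrightarrow> strip_lo S \<le> y \<and> y \<le> strip_hi S"
    "strip_lo S < y \<Longrightarrow> y < strip_hi S \<Longrightarrow> (x, y) \<in> S"
    by auto
  then show ?thesis
    by (auto simp: bd_height_def bd_trace_def)
qed

lemma snd_strip_le: "is_strip S \<Longrightarrow> p \<in> S \<Longrightarrow> strip_lo S \<le> snd p \<and> snd p \<le> strip_hi S"
  by (auto simp: is_strip_iff)

lemma open_bd_trace:
  assumes S: "is_strip S"
  shows "open (bd_trace s S)"
proof -
  obtain T where T: "open T" "S = UNIV \<times> {strip_lo S..strip_hi S} \<inter> T"
    using S unfolding is_strip_iff openin_open by blast
  have "bd_height s S \<in> {strip_lo S..strip_hi S}"
    using strip_lo_less_hi[OF S] by (simp add: bd_height_def)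
  then have "bd_trace s S = (\<lambda>x. (x, bd_height s S)) -` T"
    unfolding bd_trace_def by (subst (2) T(2)) auto
  also have "open \<dots>"
    by (intro open_vimage T continuous_intros)
  finally show ?thesis .
qed

lemma interior_strip:
  assumes S: "is_strip S"
  shows "interior S = UNIV \<times> {strip_lo S<..<strip_hi S}"
proof
  have "interior S \<subseteq> interior (UNIV \<times> {strip_lo S..strip_hi S})"
    using S by (intro interior_mono) (simp add: is_strip_iff)
  then show "interior S \<subseteq> UNIV \<times> {strip_lo S<..<strip_hi S}"
    by (simp add: interior_Times)
  show "UNIV \<times> {strip_lo S<..<strip_hi S} \<subseteq> interior S"
    using S by (intro interior_maximal open_Times) (auto simp: is_strip_iff)
qed

lemma strip_subset_closure_interior:
  assumes S: "is_strip S"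
  shows "S \<subseteq> closure (interior S)"
  using S strip_lo_less_hi[OF S] by (simp add: interior_strip closure_Times is_strip_iff)

lemma connected_strip:
  assumes S: "is_strip S"
  shows "connected S"
proof (rule connected_intermediate_closure)
  show "connected (interior S)"
    unfolding interior_strip[OF S] by (intro connected_Times) auto
qed (use interior_subset strip_subset_closure_interior[OF S] in auto)

lemma strip_row_nonempty:
  assumes S: "is_strip S"
  obtains y where "strip_lo S < y" "y < strip_hi S" "\<And>x. (x, y) \<in> S"
  using dense[OF strip_lo_less_hi[OF S]] mem_strip_iff[OF S] by blast

lemma strip_nonempty: "is_strip S \<Longrightarrow> S \<noteq> {}"
  using strip_row_nonempty[of S] by fastforce

lemma bd_height_extremal:
  assumes "is_strip S" "s \<in> {-1, 1}" "p \<in> interior S"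
  shows "s * snd p < s * bd_height s S"
  using assms by (auto simp: interior_strip bd_height_def)

lemma bd_height_eq_iff:
  assumes "is_strip S" "s \<in> {-1, 1}" "r \<in> {-1, 1}"
  shows "bd_height s S = bd_height r S \<longleftrightarrow> s = r"
  using assms strip_lo_less_hi[OF assms(1)] by (auto simp: bd_height_def)

lemma bd_notin_interior:
  assumes "is_strip S" "snd p = bd_height s S"
  shows "p \<notin> interior S"
  using assms strip_lo_less_hi[OF assms(1)]
  by (auto simp: interior_strip bd_height_def mem_Times_iff split: if_splits)

lemma strip_boundary_cases:
  assumes "is_strip S" "p \<in> S" "p \<notin> interior S"
  obtains s where "s \<in> {-1, 1}" "snd p = bd_height s S" "fst p \<in> bd_trace s S"
  using assms mem_strip_iff[OF assms(1), of "fst p" "snd p"] by (auto simp: interior_strip mem_Times_iff)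

lemma components_bd:
  "components (bd s S) = (\<lambda>I. (\<lambda>x. (x, bd_height s S)) ` I) ` components (bd_trace s S)"
proof -
  have "homeomorphism (bd_trace s S) (bd s S) (\<lambda>x. (x, bd_height s S)) fst"
    unfolding bd_eq_image_bd_trace by (rule homeomorphismI) (auto intro!: continuous_intros)
  then show ?thesis
    using homeomorphic_map_image_components homeomorphic_map_top_of_set by blast
qed

lemma strip_leaves_eq:
  "strip_leaves S = (\<lambda>y. UNIV \<times> {y}) ` {strip_lo S<..<strip_hi S} \<union> (\<Union>s\<in>{-1, 1}. components (bd s S))"
  by (auto simp: strip_leaves_def bdry_intervals_def)

section \<open>Foliated homeomorphisms of strips\<close>

definition strip_homeo ::
  "int \<Rightarrow> int \<Rightarrow> (real \<times> real) set \<Rightarrow> (real \<times> real) set \<Rightarrow> (real \<times> real \<Rightarrow> real \<times> real) \<Rightarrow> bool" where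
  "strip_homeo \<delta> \<tau> S T F \<longleftrightarrow>
     homeomorphic_map (top_of_set S) (top_of_set T) F \<and>
     (\<forall>y. signed_mono_on \<delta> {p \<in> S. snd p = y} fst (fst \<circ> F)) \<and>
     signed_mono_on \<tau> S snd (snd \<circ> F) \<and>
     (\<forall>p\<in>S. \<forall>q\<in>S. snd p = snd q \<longrightarrow> snd (F p) = snd (F q))"

lemma strip_homeo_homeomorphism:
  assumes "strip_homeo \<delta> \<tau> S T F"
  obtains G where "homeomorphism S T F G"
  using assms by (auto simp: strip_homeo_def homeomorphic_map_top_of_set)

lemma strip_homeo_row_mono: "strip_homeo \<delta> \<tau> S T F \<Longrightarrow> signed_mono_on \<delta> {p \<in> S. snd p = y} fst (fst \<circ> F)"
  by (simp add: strip_homeo_def)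

lemma strip_homeo_height_mono: "strip_homeo \<delta> \<tau> S T F \<Longrightarrow> signed_mono_on \<tau> S snd (snd \<circ> F)"
  by (simp add: strip_homeo_def)

lemma strip_homeo_signs: "strip_homeo \<delta> \<tau> S T F \<Longrightarrow> \<delta> \<in> {-1, 1} \<and> \<tau> \<in> {-1, 1}"
  unfolding strip_homeo_def using signed_mono_on_sign by blast

lemma strip_homeo_image: "strip_homeo \<delta> \<tau> S T F \<Longrightarrow> F ` S = T"
  by (meson strip_homeo_homeomorphism homeomorphism_image1)

lemma strip_homeo_snd_eq_iff:
  assumes F: "strip_homeo \<delta> \<tau> S T F" and "p \<in> S" "q \<in> S"
  shows "snd (F p) = snd (F q) \<longleftrightarrow> snd p = snd q"
proof
  show "snd (F p) = snd (F q) \<Longrightarrow> snd p = snd q"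
    using signed_mono_on_inj[OF strip_homeo_height_mono[OF F] assms(2,3)] by simp
  show "snd p = snd q \<Longrightarrow> snd (F p) = snd (F q)"
    using F assms(2,3) unfolding strip_homeo_def by blast
qed

lemma image_level_set_subset:
  assumes "\<And>p q. p \<in> S \<Longrightarrow> q \<in> S \<Longrightarrow> g p = g q \<Longrightarrow> g' (F p) = g' (F q)" "F ` S \<subseteq> T"
  shows "\<exists>z. F ` {p \<in> S. g p = y} \<subseteq> {q \<in> T. g' q = z}"
proof (cases "\<exists>p\<in>S. g p = y")
  case True
  then obtain p where p: "p \<in> S" "g p = y"
    by blast
  have "g' (F q) = g' (F p)" if "q \<in> S" "g q = y" for q
    using assms(1)[OF that(1) p(1)] that(2) p(2) by simp
  then have "F ` {p \<in> S. g p = y} \<subseteq> {q \<in> T. g' q = g' (F p)}"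
    using assms(2) by blast
  then show ?thesis ..
qed blast

lemma strip_homeo_compose:
  assumes F: "strip_homeo \<delta> \<tau> S T F" and G: "strip_homeo \<delta>' \<tau>' T U G"
  shows "strip_homeo (\<delta> * \<delta>') (\<tau> * \<tau>') S U (G \<circ> F)"
proof -
  note FT = strip_homeo_image[OF F]
  have "signed_mono_on (\<delta> * \<delta>') {p \<in> S. snd p = y} fst (fst \<circ> (G \<circ> F))" (is "signed_mono_on _ ?row _ _")
    for y
  proof (rule signed_mono_on_trans[OF strip_homeo_row_mono[OF F]])
    have "\<exists>z. F ` ?row \<subseteq> {q \<in> T. snd q = z}"
      by (intro image_level_set_subset[where g = snd and g' = snd])
        (simp_all add: strip_homeo_snd_eq_iff[OF F] FT)
    then obtain z where "F ` ?row \<subseteq> {q \<in> T. snd q = z}" ..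
    from signed_mono_on_subset[OF strip_homeo_row_mono[OF G] this]
    show "signed_mono_on \<delta>' ?row (fst \<circ> F) (fst \<circ> (G \<circ> F))"
      by (simp add: signed_mono_on_image comp_assoc)
  qed
  moreover have "signed_mono_on (\<tau> * \<tau>') S snd (snd \<circ> (G \<circ> F))"
    using signed_mono_on_trans[OF strip_homeo_height_mono[OF F]] strip_homeo_height_mono[OF G]
    unfolding FT[symmetric] signed_mono_on_image by (simp add: comp_assoc)
  moreover have "homeomorphic_map (top_of_set S) (top_of_set U) (G \<circ> F)"
    using F G unfolding strip_homeo_def by (meson homeomorphic_map_compose)
  moreover have "\<forall>p\<in>S. \<forall>q\<in>S. snd p = snd q \<longrightarrow> snd ((G \<circ> F) p) = snd ((G \<circ> F) q)"
    using strip_homeo_snd_eq_iff[OF F] strip_homeo_snd_eq_iff[OF G] FT by (metis comp_apply imageI)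
  ultimately show ?thesis
    unfolding strip_homeo_def by blast
qed

lemma strip_homeo_inverse:
  assumes F: "strip_homeo \<delta> \<tau> S T F" and FG: "homeomorphism S T F G"
  shows "strip_homeo \<delta> \<tau> T S G"
proof -
  have G: "G q \<in> S" "F (G q) = q" if "q \<in> T" for q
    using that homeomorphism_image2[OF FG] homeomorphism_apply2[OF FG] by auto
  have snd_G: "snd (G p) = snd (G q) \<longleftrightarrow> snd p = snd q" if "p \<in> T" "q \<in> T" for p q
    using strip_homeo_snd_eq_iff[OF F, of "G p" "G q"] G that by simp
  have "signed_mono_on \<delta> {q \<in> T. snd q = y} fst (fst \<circ> G)" (is "signed_mono_on _ ?row _ _") for y
  proof (rule signed_mono_on_sym)
    have "\<exists>z. G ` ?row \<subseteq> {p \<in> S. snd p = z}"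
      by (intro image_level_set_subset[where g = snd and g' = snd]) (use snd_G G(1) in auto)
    then obtain z where "G ` ?row \<subseteq> {p \<in> S. snd p = z}" ..
    from signed_mono_on_subset[OF strip_homeo_row_mono[OF F] this]
    have "signed_mono_on \<delta> ?row (fst \<circ> G) (fst \<circ> F \<circ> G)"
      by (simp add: signed_mono_on_image)
    then show "signed_mono_on \<delta> ?row (fst \<circ> G) fst"
      by (rule signed_mono_on_cong[THEN iffD1, rotated -1]) (simp_all add: G)
    show "fst a = fst b" if "a \<in> ?row" "b \<in> ?row" "(fst \<circ> G) a = (fst \<circ> G) b" for a b
    proof -
      have ab: "a \<in> T" "b \<in> T" "snd a = snd b"
        using that by auto
      then have "G a = G b"
        using that(3) snd_G[of a b] by (intro prod_eqI) auto
      then show ?thesis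
        using G(2)[OF ab(1)] G(2)[OF ab(2)] by metis
    qed
  qed
  moreover have "signed_mono_on \<tau> T snd (snd \<circ> G)"
  proof (rule signed_mono_on_sym)
    have "signed_mono_on \<tau> (G ` T) snd (snd \<circ> F)"
      using strip_homeo_height_mono[OF F] homeomorphism_image2[OF FG] by simp
    then have "signed_mono_on \<tau> T (snd \<circ> G) (snd \<circ> F \<circ> G)"
      by (simp add: signed_mono_on_image)
    then show "signed_mono_on \<tau> T (snd \<circ> G) snd"
      by (rule signed_mono_on_cong[THEN iffD1, rotated -1]) (simp_all add: G)
  qed (use snd_G in simp)
  moreover have "homeomorphic_map (top_of_set T) (top_of_set S) G"
    using homeomorphism_symD[OF FG] homeomorphic_map_top_of_set by blast
  ultimately show ?thesis
    unfolding strip_homeo_def using snd_G by blast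
qed

lemma strip_homeo_interior:
  assumes "strip_homeo \<delta> \<tau> S T F"
  shows "F ` interior S = interior T"
  using assms by (meson strip_homeo_homeomorphism homeomorphism_image_interior)

lemma homeomorphism_bd_height:
  assumes FG: "homeomorphism S T F G" and mono: "signed_mono_on \<tau> S snd (snd \<circ> F)"
    and S: "is_strip S" and T: "is_strip T" and s: "s \<in> {-1, 1}" and p: "p \<in> S" "snd p = bd_height s S"
  shows "snd (F p) = bd_height (\<tau> * s) T"
proof -
  have "F p \<notin> interior T"
  proof
    assume "F p \<in> interior T"
    then have "p \<in> interior S"
      using homeomorphism_apply1[OF FG p(1)] homeomorphism_image_interior[OF homeomorphism_symD[OF FG]]
      by force
    then show False
      using bd_notin_interior[OF S p(2)] by contradiction
  qed
  moreover have "F p \<in> T"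
    using p(1) homeomorphism_image1[OF FG] by blast
  ultimately obtain r where r: "r \<in> {-1, 1}" "snd (F p) = bd_height r T"
    using T by (meson strip_boundary_cases)
  obtain y where y: "strip_lo S < y" "y < strip_hi S" "\<And>x. (x, y) \<in> S"
    using strip_row_nonempty[OF S] by blast
  then have q: "(0, y) \<in> interior S" "(0, y) \<in> S"
    by (auto simp: interior_strip[OF S])
  then have "F (0, y) \<in> interior T"
    using homeomorphism_image_interior[OF FG] by blast
  from bd_height_extremal[OF T r(1) this] r(2)
  have "r * snd (F (0, y)) < r * snd (F p)"
    by simp
  moreover have "\<tau> * s * snd (F (0, y)) < \<tau> * s * snd (F p)"
    using bd_height_extremal[OF S s q(1)] p s
      signed_mono_onD[OF mono, of "(0, y)" p] signed_mono_onD[OF mono, of p "(0, y)"] q(2) by auto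
  ultimately have "r = \<tau> * s"
    using r(1) s signed_mono_on_sign[OF mono] by auto
  then show ?thesis
    using r(2) by simp
qed

lemma strip_homeo_bd_height:
  assumes F: "strip_homeo \<delta> \<tau> S T F"
    and "is_strip S" "is_strip T" "s \<in> {-1, 1}" "p \<in> S" "snd p = bd_height s S"
  shows "snd (F p) = bd_height (\<tau> * s) T"
  using strip_homeo_homeomorphism[OF F]
    homeomorphism_bd_height[OF _ strip_homeo_height_mono[OF F] assms(2-)] by metis

lemma strip_homeo_row:
  assumes F: "strip_homeo \<delta> \<tau> S T F" and T: "is_strip T"
    and y: "UNIV \<times> {y} \<subseteq> interior S"
  obtains z where "F ` (UNIV \<times> {y}) = UNIV \<times> {z}" "UNIV \<times> {z} \<subseteq> interior T"
proof -
  obtain G where FG: "homeomorphism S T F G"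
    using F by (rule strip_homeo_homeomorphism)
  have row: "(x, y) \<in> S" for x
    using y interior_subset by blast
  define z where "z = snd (F (0, y))"
  have "F (0, y) \<in> interior T"
    using strip_homeo_interior[OF F] y by blast
  then have z: "UNIV \<times> {z} \<subseteq> interior T"
    by (auto simp: interior_strip[OF T] z_def mem_Times_iff)
  have "F ` (UNIV \<times> {y}) = UNIV \<times> {z}"
  proof (intro equalityI subsetI)
    fix q assume "q \<in> F ` (UNIV \<times> {y})"
    then show "q \<in> UNIV \<times> {z}"
      using strip_homeo_snd_eq_iff[OF F row row] by (auto simp: z_def mem_Times_iff)
  next
    fix q :: "real \<times> real" assume q: "q \<in> UNIV \<times> {z}"
    then have "q \<in> T"
      using z interior_subset by blast
    then have Gq: "G q \<in> S" "F (G q) = q"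
      using homeomorphism_image2[OF FG] homeomorphism_apply2[OF FG] by auto
    then have "snd (G q) = y"
      using strip_homeo_snd_eq_iff[OF F Gq(1) row[of 0]] q by (auto simp: z_def)
    then show "q \<in> F ` (UNIV \<times> {y})"
      using Gq(2) by (metis UNIV_I SigmaI imageI prod.collapse singletonI)
  qed
  then show thesis
    using that z by blast
qed

lemma strip_homeo_bd:
  assumes F: "strip_homeo \<delta> \<tau> S T F" and S: "is_strip S" and T: "is_strip T" and s: "s \<in> {-1, 1}"
  shows "F ` bd s S = bd (\<tau> * s) T"
proof -
  have bd_subset: "F ` bd s S \<subseteq> bd (\<tau> * s) T"
    if F: "strip_homeo \<delta> \<tau> S T F" and S: "is_strip S" and T: "is_strip T" and s: "s \<in> {-1, 1}"
      for S T F s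
  proof
    fix q assume "q \<in> F ` bd s S"
    then obtain p where p: "q = F p" "p \<in> S" "snd p = bd_height s S"
      by (auto simp: bd_eq_image_bd_trace bd_trace_def)
    have "snd q = bd_height (\<tau> * s) T" "q \<in> T"
      using strip_homeo_bd_height[OF F S T s p(2,3)] strip_homeo_image[OF F] p by auto
    then show "q \<in> bd (\<tau> * s) T"
      by (cases q) (auto simp: bd_eq_image_bd_trace bd_trace_def)
  qed
  obtain G where FG: "homeomorphism S T F G"
    using F by (rule strip_homeo_homeomorphism)
  have ts: "\<tau> * s \<in> {-1, 1}" "\<tau> * (\<tau> * s) = s"
    using strip_homeo_signs[OF F] s by auto
  have "G ` bd (\<tau> * s) T \<subseteq> bd s S"
    using bd_subset[OF strip_homeo_inverse[OF F FG] T S ts(1)] ts(2) by simp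
  moreover have "bd (\<tau> * s) T = F ` G ` bd (\<tau> * s) T"
    using homeomorphism_apply2[OF FG] by (force simp: image_image bd_def)
  ultimately show ?thesis
    using bd_subset[OF F S T s] by blast
qed

lemma strip_homeo_components_bd:
  assumes F: "strip_homeo \<delta> \<tau> S T F" and S: "is_strip S" and T: "is_strip T" and s: "s \<in> {-1, 1}"
  shows "components (bd (\<tau> * s) T) = (`) F ` components (bd s S)"
proof (rule homeomorphic_map_image_components)
  have "bd r U \<subseteq> U" for r U
    by (auto simp: bd_def)
  then show "homeomorphic_map (top_of_set (bd s S)) (top_of_set (bd (\<tau> * s) T)) F"
    using F strip_homeo_bd[OF F S T s]
      homeomorphic_map_subtopologies[of "top_of_set S" "top_of_set T" F "bd s S" "bd (\<tau> * s) T"]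
    by (simp add: strip_homeo_def subtopology_subtopology inf.absorb2)
qed

lemma strip_homeo_leaf:
  assumes F: "strip_homeo \<delta> \<tau> S T F" and S: "is_strip S" and T: "is_strip T" and L: "L \<in> strip_leaves S"
  shows "F ` L \<in> strip_leaves T"
proof -
  consider (interior) y where "UNIV \<times> {y} \<subseteq> interior S" "L = UNIV \<times> {y}"
    | (boundary) s where "s \<in> {-1, 1}" "L \<in> components (bd s S)"
    using L by (auto simp: strip_leaves_eq interior_strip[OF S])
  then show ?thesis
  proof cases
    case interior
    obtain z where "F ` L = UNIV \<times> {z}" "UNIV \<times> {z} \<subseteq> interior T"
      using strip_homeo_row[OF F T interior(1)] interior(2) by blast
    then show ?thesis
      by (auto simp: strip_leaves_eq interior_strip[OF T])
  next
    case boundary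
    then have "F ` L \<in> components (bd (\<tau> * s) T)" "\<tau> * s \<in> {-1, 1}"
      using strip_homeo_components_bd[OF F S T] strip_homeo_signs[OF F] by auto
    then show ?thesis
      by (auto simp: strip_leaves_eq)
  qed
qed

lemma strip_leaf_subset:
  assumes S: "is_strip S" and L: "L \<in> strip_leaves S"
  shows "L \<subseteq> S"
proof -
  have "bd s S \<subseteq> S" for s
    by (auto simp: bd_def)
  moreover have "UNIV \<times> {strip_lo S<..<strip_hi S} \<subseteq> S"
    using S by (simp add: is_strip_iff)
  ultimately show ?thesis
    using L in_components_subset[of L] by (auto simp: strip_leaves_eq) blast+
qed

lemma strip_homeo_image_leaves:
  assumes F: "strip_homeo \<delta> \<tau> S T F" and S: "is_strip S" and T: "is_strip T"
  shows "(`) F ` strip_leaves S = strip_leaves T"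
proof -
  obtain G where FG: "homeomorphism S T F G"
    using F by (rule strip_homeo_homeomorphism)
  have "M \<in> (`) F ` strip_leaves S" if M: "M \<in> strip_leaves T" for M
  proof
    show "G ` M \<in> strip_leaves S"
      using strip_homeo_leaf[OF strip_homeo_inverse[OF F FG] T S M] .
    show "M = F ` G ` M"
      using homeomorphism_apply2[OF FG] strip_leaf_subset[OF T M] by (force simp: image_image)
  qed
  then show ?thesis
    using strip_homeo_leaf[OF F S T] by blast
qed

section \<open>Extending boundary maps over a strip\<close>

definition mono_nonexpansive :: "(real \<Rightarrow> real) \<Rightarrow> bool" where
  "mono_nonexpansive X \<longleftrightarrow> mono X \<and> mono (\<lambda>s. s - X s)"

lemma mono_nonexpansive_mono: "mono_nonexpansive X \<Longrightarrow> mono X"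
  by (simp add: mono_nonexpansive_def)

lemma mono_nonexpansive_complement: "mono_nonexpansive X \<Longrightarrow> mono_nonexpansive (\<lambda>s. s - X s)"
  by (simp add: mono_nonexpansive_def)

lemma continuous_on_mono_nonexpansive:
  assumes "mono_nonexpansive X"
  shows "continuous_on A X"
proof -
  have "X s \<le> X t" "X t - X s \<le> t - s" if "s \<le> t" for s t
    using assms that monoD[of X s t] monoD[of "\<lambda>s. s - X s" s t] by (auto simp: mono_nonexpansive_def)
  then have "dist (X s) (X t) \<le> 1 * dist s t" for s t
    by (cases s t rule: linorder_le_cases) (fastforce simp: dist_real_def)+
  then have "1-lipschitz_on A X"
    by (auto intro: lipschitz_onI)
  then show ?thesis
    by (rule lipschitz_on_continuous_on)
qed

lemma mono_nonexpansive_INF: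
  assumes P: "P \<noteq> {}" and bdd: "\<And>s. bdd_below ((\<lambda>x. m x s) ` P)"
    and m: "\<And>x. x \<in> P \<Longrightarrow> mono_nonexpansive (m x)"
  shows "mono_nonexpansive (\<lambda>s. INF x\<in>P. m x s)"
  unfolding mono_nonexpansive_def
proof (intro conjI monoI)
  fix s t :: real assume st: "s \<le> t"
  have m_mono: "m x s \<le> m x t" "m x t - (t - s) \<le> m x s" if "x \<in> P" for x
    using m[OF that] st monoD[of "m x" s t] monoD[of "\<lambda>s. s - m x s" s t]
    by (auto simp: mono_nonexpansive_def)
  show "(INF x\<in>P. m x s) \<le> (INF x\<in>P. m x t)"
    using m_mono(1) by (intro cINF_mono[OF P bdd]) blast
  have "(INF x\<in>P. m x t) - (t - s) \<le> (INF x\<in>P. m x s)"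
  proof (rule cINF_greatest[OF P])
    fix x assume x: "x \<in> P"
    then show "(INF x\<in>P. m x t) - (t - s) \<le> m x s"
      using cINF_lower[OF bdd x, of t] m_mono(2)[OF x] by linarith
  qed
  then show "s - (INF x\<in>P. m x s) \<le> t - (INF x\<in>P. m x t)"
    by simp
qed

text \<open>Although \<open>f\<close> may jump, its graph is a Lipschitz curve in the coordinate \<open>s = x + f x\<close>.\<close>

lemma graph_mono_nonexpansive_parametrization:
  fixes f :: "real \<Rightarrow> real"
  assumes f: "strict_mono_on P f"
  obtains X where "mono_nonexpansive X" "\<And>x. x \<in> P \<Longrightarrow> X (x + f x) = x"
proof (cases "P = {}")
  case True
  then show thesis
    using that[of "\<lambda>s. s"] by (simp add: mono_nonexpansive_def mono_def)
next
  case False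
  define m where "m x s = x + max 0 (s - (x + f x))" for x s
  have lower: "min x (s - f x) \<le> m y s" if "x \<in> P" "y \<in> P" for x y s
    using strict_mono_onD[OF f that] strict_mono_onD[OF f that(2,1)]
    by (cases x y rule: linorder_cases) (auto simp: m_def)
  then have bdd: "bdd_below ((\<lambda>x. m x s) ` P)" for s
    using False unfolding bdd_below_def by blast
  have "mono_nonexpansive (\<lambda>s. INF x\<in>P. m x s)"
    by (rule mono_nonexpansive_INF[OF False bdd]) (auto simp: mono_nonexpansive_def mono_def m_def)
  moreover have "(INF y\<in>P. m y (x + f x)) = x" if "x \<in> P" for x
  proof (rule antisym)
    show "(INF y\<in>P. m y (x + f x)) \<le> x"
      using cINF_lower[OF bdd that, of "x + f x"] by (simp add: m_def)
    show "x \<le> (INF y\<in>P. m y (x + f x))"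
      using lower[OF that, of _ "x + f x"] by (intro cINF_greatest[OF False]) auto
  qed
  ultimately show thesis
    by (rule that)
qed

lemma open_graph_mono_nonexpansive_parametrization:
  fixes f :: "real \<Rightarrow> real"
  assumes f: "strict_mono_on P f" and P: "open P" "open (f ` P)"
  obtains X where "mono_nonexpansive X" "\<And>x. x \<in> P \<Longrightarrow> X (x + f x) = x" "open ((\<lambda>x. x + f x) ` P)"
proof -
  obtain X where X: "mono_nonexpansive X" "\<And>x. x \<in> P \<Longrightarrow> X (x + f x) = x"
    using graph_mono_nonexpansive_parametrization[OF f] by blast
  have "continuous_on P f"
    using f by (intro continuous_onI_mono P) (auto simp: le_less strict_mono_on_def)
  then have "continuous_on P (\<lambda>x. x + f x)"
    by (intro continuous_intros)
  moreover have "inj_on (\<lambda>x. x + f x) P"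
    by (rule inj_on_inverseI[of _ X]) (rule X(2))
  ultimately have "open ((\<lambda>x. x + f x) ` P)"
    using P(1) by (intro invariance_of_domain)
  then show thesis
    using that X by blast
qed

lemma continuous_on_row_inverse:
  fixes U :: "real \<times> 'a::topological_space \<Rightarrow> real"
  assumes U: "continuous_on (UNIV \<times> K) U" and D: "D \<subseteq> UNIV \<times> K"
    and mono: "\<And>y. y \<in> K \<Longrightarrow> mono (\<lambda>s. U (s, y))"
    and rows: "\<And>y. open {s. (s, y) \<in> D}" "\<And>y. strict_mono_on {s. (s, y) \<in> D} (\<lambda>s. U (s, y))"
    and inverse: "\<And>q. q \<in> S \<Longrightarrow> (g q, snd q) \<in> D" "\<And>q. q \<in> S \<Longrightarrow> U (g q, snd q) = fst q"
  shows "continuous_on S g"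
  unfolding continuous_on_def
proof (intro ballI tendstoI)
  fix q and \<epsilon> :: real assume q: "q \<in> S" and \<epsilon>: "0 < \<epsilon>"
  have K: "snd p \<in> K" if "p \<in> S" for p
    using inverse(1)[OF that] D by auto
  have gap: "continuous_on S (\<lambda>p. fst p - U (s, snd p))" for s
    by (intro continuous_intros continuous_on_compose2[OF U]) (use K in auto)
  obtain r where r: "0 < r" "ball (g q) r \<subseteq> {s. (s, snd q) \<in> D}"
    using rows(1)[of "snd q"] inverse(1)[OF q] unfolding open_contains_ball by blast
  define h where "h = min r \<epsilon> / 2"
  have h: "0 < h" "h < r" "h < \<epsilon>"
    using r(1) \<epsilon> by (auto simp: h_def)
  have "(g q - h, snd q) \<in> D" "(g q + h, snd q) \<in> D"
    using r(2) h by (auto simp: subset_iff dist_real_def)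
  then have gaps: "0 < fst q - U (g q - h, snd q)" "fst q - U (g q + h, snd q) < 0"
    using strict_mono_onD[OF rows(2)[of "snd q"], of "g q - h" "g q"]
      strict_mono_onD[OF rows(2)[of "snd q"], of "g q" "g q + h"] inverse[OF q] h(1) by simp_all
  have "((\<lambda>p. fst p - U (s, snd p)) \<longlongrightarrow> fst q - U (s, snd q)) (at q within S)" for s
    using gap q unfolding continuous_on_def by blast
  from order_tendstoD(1)[OF this gaps(1)] order_tendstoD(2)[OF this gaps(2)]
  have "\<forall>\<^sub>F p in at q within S. 0 < fst p - U (g q - h, snd p)"
    "\<forall>\<^sub>F p in at q within S. fst p - U (g q + h, snd p) < 0" .
  moreover have "\<forall>\<^sub>F p in at q within S. p \<in> S"
    by (simp add: eventually_at_filter)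
  ultimately show "\<forall>\<^sub>F p in at q within S. dist (g p) (g q) < \<epsilon>"
  proof eventually_elim
    case (elim p)
    then have "U (g q - h, snd p) < U (g p, snd p)" "U (g p, snd p) < U (g q + h, snd p)"
      using inverse(2) by simp_all
    then have "g q - h < g p" "g p < g q + h"
      using monoD[OF mono[OF K[OF elim(3)]]] by (meson not_le)+
    then show ?case
      using h(3) by (simp add: dist_real_def abs_less_iff)
  qed
qed

lemma homeomorphism_increasing_rows:
  fixes U :: "real \<times> 'a::topological_space \<Rightarrow> real"
  assumes U: "continuous_on (UNIV \<times> K) U" and D: "D \<subseteq> UNIV \<times> K"
    and mono: "\<And>y. y \<in> K \<Longrightarrow> mono (\<lambda>s. U (s, y))"
    and rows: "\<And>y. open {s. (s, y) \<in> D}" "\<And>y. strict_mono_on {s. (s, y) \<in> D} (\<lambda>s. U (s, y))"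
  shows "\<exists>G. homeomorphism D ((\<lambda>p. (U p, snd p)) ` D) (\<lambda>p. (U p, snd p)) G"
proof -
  let ?F = "\<lambda>p. (U p, snd p)" and ?S = "(\<lambda>p. (U p, snd p)) ` D"
  define G where "G = inv_into D ?F"
  have "s = t" if "(s, y) \<in> D" "(t, y) \<in> D" "U (s, y) = U (t, y)" for s t y
    using strict_mono_on_eq[OF rows(2)[of y], of s t] that by simp
  then have "inj_on ?F D"
    by (auto simp: inj_on_def)
  then have GF: "G (U (s, y), y) = (s, y)" if "(s, y) \<in> D" for s y
    using inv_into_f_f[OF _ that] by (fastforce simp: G_def)
  then have "continuous_on ?S (\<lambda>q. fst (G q))"
    by (intro continuous_on_row_inverse[OF U D mono rows]) auto
  then have "continuous_on ?S (\<lambda>q. (fst (G q), snd q))"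
    by (intro continuous_on_Pair continuous_on_snd continuous_on_id)
  then have "continuous_on ?S G"
    by (rule continuous_on_eq) (auto simp: GF)
  moreover have "continuous_on D ?F"
    by (intro continuous_intros continuous_on_subset[OF U D])
  ultimately have "homeomorphism D ?S ?F G"
    by (intro homeomorphismI) (auto simp: GF)
  then show ?thesis
    by blast
qed

definition unit_strip :: "real set \<Rightarrow> real set \<Rightarrow> (real \<times> real) set" where
  "unit_strip P Q = {(x, y). 0 < y \<and> y < 1 \<or> y = 0 \<and> x \<in> P \<or> y = 1 \<and> x \<in> Q}"

definition blend :: "(real \<Rightarrow> real) \<Rightarrow> (real \<Rightarrow> real) \<Rightarrow> real \<times> real \<Rightarrow> real" where
  "blend X Y = (\<lambda>(s, y). (1 - y)\<^sup>2 * X s + 2 * y * (1 - y) * s + y\<^sup>2 * Y s)"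

lemma blend_growth:
  assumes X: "mono X" "mono Y" and st: "s \<le> t"
  shows "2 * y * (1 - y) * (t - s) \<le> blend X Y (t, y) - blend X Y (s, y)"
proof -
  have "0 \<le> (1 - y)\<^sup>2 * (X t - X s)" "0 \<le> y\<^sup>2 * (Y t - Y s)"
    using monoD[OF X(1) st] monoD[OF X(2) st] by simp_all
  moreover have "blend X Y (t, y) - blend X Y (s, y) =
      2 * y * (1 - y) * (t - s) + (1 - y)\<^sup>2 * (X t - X s) + y\<^sup>2 * (Y t - Y s)"
    by (simp add: blend_def algebra_simps)
  ultimately show ?thesis
    by linarith
qed

lemma continuous_on_blend:
  assumes "mono_nonexpansive X" "mono_nonexpansive Y"
  shows "continuous_on A (blend X Y)"
proof -
  have "continuous_on A (\<lambda>p. Z (fst p))" if "mono_nonexpansive Z" for Z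
    by (rule continuous_on_compose2[OF continuous_on_mono_nonexpansive[OF that, of UNIV]
          continuous_on_fst[OF continuous_on_id] subset_UNIV])
  from this[OF assms(1)] this[OF assms(2)] show ?thesis
    unfolding blend_def case_prod_unfold by (intro continuous_intros)
qed

lemma blend_surj:
  assumes X: "mono_nonexpansive X" "mono_nonexpansive Y" and y: "0 < y" "y < 1"
  obtains s where "blend X Y (s, y) = x"
proof -
  define c r where "c = 2 * y * (1 - y)" and "r = \<bar>x - blend X Y (0, y)\<bar> / c"
  have "c > 0"
    using y by (simp add: c_def)
  then have r: "r \<ge> 0" "c * r = \<bar>x - blend X Y (0, y)\<bar>"
    by (auto simp: r_def)
  note growth = blend_growth[OF X[THEN mono_nonexpansive_mono], of _ _ y, folded c_def]
  have "blend X Y (- r, y) \<le> x" "x \<le> blend X Y (r, y)"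
    using growth[of "- r" 0] growth[of 0 r] r by auto
  moreover have "continuous_on {- r..r} (\<lambda>s. blend X Y (s, y))"
    by (intro continuous_on_compose2[OF continuous_on_blend[OF X, of UNIV]] continuous_intros
      subset_UNIV)
  ultimately show thesis
    using IVT'[of "\<lambda>s. blend X Y (s, y)" "- r" x r] r(1) that by auto
qed

lemma blend_row_strict_mono:
  assumes X: "mono X" "mono Y" and inj: "inj_on X E" "inj_on Y E'"
  shows "strict_mono_on {s. (s, y) \<in> unit_strip E E'} (\<lambda>s. blend X Y (s, y))"
proof (rule strict_mono_onI)
  fix s t assume st: "s \<in> {s. (s, y) \<in> unit_strip E E'}" "t \<in> {s. (s, y) \<in> unit_strip E E'}" "s < t"
  consider (interior) "0 < y" "y < 1" | (bottom) "y = 0" "s \<in> E" "t \<in> E" | (top) "y = 1" "s \<in> E'" "t \<in> E'"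
    using st by (auto simp: unit_strip_def)
  then show "blend X Y (s, y) < blend X Y (t, y)"
  proof cases
    case interior
    then have "0 < 2 * y * (1 - y) * (t - s)"
      using st(3) by simp
    then show ?thesis
      using blend_growth[OF X, of s t y] st(3) by linarith
  next
    case bottom
    then show ?thesis
      using monoD[OF X(1), of s t] inj_onD[OF inj(1), of s t] st(3) by (force simp: blend_def)
  next
    case top
    then show ?thesis
      using monoD[OF X(2), of s t] inj_onD[OF inj(2), of s t] st(3) by (force simp: blend_def)
  qed
qed

lemma image_blend_unit_strip:
  assumes X: "mono_nonexpansive X" "mono_nonexpansive Y"
  shows "(\<lambda>p. (blend X Y p, snd p)) ` unit_strip E E' = unit_strip (X ` E) (Y ` E')"
proof (intro equalityI subsetI)
  fix q assume "q \<in> unit_strip (X ` E) (Y ` E')"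
  then obtain x y where q: "q = (x, y)"
    and "0 < y \<and> y < 1 \<or> y = 0 \<and> x \<in> X ` E \<or> y = 1 \<and> x \<in> Y ` E'"
    by (auto simp: unit_strip_def)
  then consider (interior) "0 < y" "y < 1" | (bottom) s where "y = 0" "x = X s" "s \<in> E"
    | (top) s where "y = 1" "x = Y s" "s \<in> E'"
    by blast
  then have "\<exists>s. (s, y) \<in> unit_strip E E' \<and> x = blend X Y (s, y)"
  proof cases
    case interior
    then show ?thesis
      using blend_surj[OF X interior, of x] by (auto simp: unit_strip_def)
  qed (auto simp: unit_strip_def blend_def)
  then show "q \<in> (\<lambda>p. (blend X Y p, snd p)) ` unit_strip E E'"
    using q by force
qed (auto simp: unit_strip_def blend_def)

lemma strip_homeo_blend:
  assumes X: "mono_nonexpansive X" "mono_nonexpansive Y"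
    and E: "open E" "open E'" "inj_on X E" "inj_on Y E'"
  shows "strip_homeo 1 1 (unit_strip E E') (unit_strip (X ` E) (Y ` E')) (\<lambda>p. (blend X Y p, snd p))"
proof -
  let ?D = "unit_strip E E'"
  note mono = X[THEN mono_nonexpansive_mono]
  note strict = blend_row_strict_mono[OF mono E(3,4)]
  have "\<exists>G. homeomorphism ?D ((\<lambda>p. (blend X Y p, snd p)) ` ?D) (\<lambda>p. (blend X Y p, snd p)) G"
  proof (rule homeomorphism_increasing_rows[OF continuous_on_blend[OF X] _ _ _ strict])
    show "?D \<subseteq> UNIV \<times> {0..1}"
      by (auto simp: unit_strip_def)
    show "mono (\<lambda>s. blend X Y (s, y))" if y: "y \<in> {0..1}" for y
    proof (rule monoI)
      fix s t :: real assume "s \<le> t"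
      moreover from this y have "0 \<le> 2 * y * (1 - y) * (t - s)"
        by simp
      ultimately show "blend X Y (s, y) \<le> blend X Y (t, y)"
        using blend_growth[OF mono] by (meson diff_ge_0_iff_ge order_trans)
    qed
    have "{s. (s, y) \<in> ?D}
        = (if 0 < y \<and> y < 1 then UNIV else if y = 0 then E else if y = 1 then E' else {})" for y
      by (auto simp: unit_strip_def)
    then show "open {s. (s, y) \<in> ?D}" for y
      using E(1,2) by simp
  qed
  then have "homeomorphic_map (top_of_set ?D) (top_of_set (unit_strip (X ` E) (Y ` E')))
      (\<lambda>p. (blend X Y p, snd p))"
    by (simp add: homeomorphic_map_top_of_set image_blend_unit_strip[OF X])
  moreover have "signed_mono_on 1 {p \<in> ?D. snd p = y} fst (fst \<circ> (\<lambda>p. (blend X Y p, snd p)))" for y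
    using strict_mono_onD[OF strict] by (auto simp: signed_mono_on_def)
  ultimately show ?thesis
    by (simp add: strip_homeo_def signed_mono_on_def)
qed

lemma unit_strip_extension:
  assumes f: "strict_mono_on P f" "open P" "open (f ` P)"
    and g: "strict_mono_on Q g" "open Q" "open (g ` Q)"
  obtains F where "strip_homeo 1 1 (unit_strip P Q) (unit_strip (f ` P) (g ` Q)) F"
    "\<And>x. x \<in> P \<Longrightarrow> F (x, 0) = (f x, 0)" "\<And>x. x \<in> Q \<Longrightarrow> F (x, 1) = (g x, 1)"
proof -
  obtain X where X: "mono_nonexpansive X" "\<And>x. x \<in> P \<Longrightarrow> X (x + f x) = x" "open ((\<lambda>x. x + f x) ` P)"
    using open_graph_mono_nonexpansive_parametrization[OF f] by blast
  obtain Y where Y: "mono_nonexpansive Y" "\<And>x. x \<in> Q \<Longrightarrow> Y (x + g x) = x" "open ((\<lambda>x. x + g x) ` Q)"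
    using open_graph_mono_nonexpansive_parametrization[OF g] by blast
  define E E' where "E = (\<lambda>x. x + f x) ` P" and "E' = (\<lambda>x. x + g x) ` Q"
  define U V where "U = (\<lambda>p. (blend X Y p, snd p))"
    and "V = (\<lambda>p. (blend (\<lambda>s. s - X s) (\<lambda>s. s - Y s) p, snd p))"
  have images: "X ` E = P" "Y ` E' = Q" "(\<lambda>s. s - X s) ` E = f ` P" "(\<lambda>s. s - Y s) ` E' = g ` Q"
    using X(2) Y(2) by (force simp: E_def E'_def image_image)+
  have inj: "inj_on X E" "inj_on Y E'" "inj_on (\<lambda>s. s - X s) E" "inj_on (\<lambda>s. s - Y s) E'"
    using X(2) Y(2) strict_mono_on_eq[OF f(1)] strict_mono_on_eq[OF g(1)]
    by (auto simp: inj_on_def E_def E'_def)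
  have U: "strip_homeo 1 1 (unit_strip E E') (unit_strip P Q) U"
    using strip_homeo_blend[OF X(1) Y(1) _ _ inj(1,2)] X(3) Y(3)
    by (simp add: images U_def E_def[symmetric] E'_def[symmetric])
  have V: "strip_homeo 1 1 (unit_strip E E') (unit_strip (f ` P) (g ` Q)) V"
    using strip_homeo_blend[OF X(1)[THEN mono_nonexpansive_complement]
      Y(1)[THEN mono_nonexpansive_complement] _ _ inj(3,4)] X(3) Y(3)
    by (simp add: images V_def E_def[symmetric] E'_def[symmetric])
  obtain G where G: "homeomorphism (unit_strip E E') (unit_strip P Q) U G"
    using U by (rule strip_homeo_homeomorphism)
  have "strip_homeo 1 1 (unit_strip P Q) (unit_strip (f ` P) (g ` Q)) (V \<circ> G)"
    using strip_homeo_compose[OF strip_homeo_inverse[OF U G] V] by simp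
  moreover have "(V \<circ> G) (x, 0) = (f x, 0)" if "x \<in> P" for x
    using homeomorphism_apply1[OF G, of "(x + f x, 0)"] X(2)[OF that] that
    by (simp add: U_def V_def blend_def unit_strip_def E_def)
  moreover have "(V \<circ> G) (x, 1) = (g x, 1)" if "x \<in> Q" for x
    using homeomorphism_apply1[OF G, of "(x + g x, 1)"] Y(2)[OF that] that
    by (simp add: U_def V_def blend_def unit_strip_def E'_def)
  ultimately show thesis
    by (rule that)
qed

definition place :: "int \<Rightarrow> real \<Rightarrow> real \<Rightarrow> real \<times> real \<Rightarrow> real \<times> real" where
  "place \<delta> a b p = (\<delta> * fst p, (1 - snd p) * a + snd p * b)"

lemma homeomorphism_place:
  assumes "\<delta> \<in> {-1, 1}" "a \<noteq> b"
  shows "homeomorphism UNIV UNIV (place \<delta> a b) (\<lambda>q :: real \<times> real. (\<delta> * fst q, (snd q - a) / (b - a)))"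
proof (rule homeomorphismI)
  show "(\<delta> * fst (place \<delta> a b p), (snd (place \<delta> a b p) - a) / (b - a)) = p" for p :: "real \<times> real"
  proof -
    have "(1 - snd p) * a + snd p * b - a = snd p * (b - a)"
      by (simp add: algebra_simps)
    then show ?thesis
      using assms by (auto simp: place_def)
  qed
  show "place \<delta> a b (\<delta> * fst q, (snd q - a) / (b - a)) = q" for q :: "real \<times> real"
  proof -
    have "(1 - (snd q - a) / (b - a)) * a + (snd q - a) / (b - a) * b
        = a + (snd q - a) / (b - a) * (b - a)"
      by (simp only: algebra_simps)
    then show ?thesis
      using assms by (auto simp: place_def prod_eq_iff)
  qed
qed (use assms in \<open>auto simp: place_def[abs_def] intro!: continuous_intros\<close>)

lemma place_in_strip_iff:
  assumes S: "is_strip S" and \<tau>: "\<tau> \<in> {-1, 1}"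
  shows "place \<delta> (bd_height (- \<tau>) S) (bd_height \<tau> S) p \<in> S \<longleftrightarrow>
    p \<in> unit_strip ((\<lambda>x. \<delta> * x) -` bd_trace (- \<tau>) S) ((\<lambda>x. \<delta> * x) -` bd_trace \<tau> S)"
proof -
  define a b where "a = bd_height (- \<tau>) S" and "b = bd_height \<tau> S"
  obtain x y where p: "p = (x, y)"
    by fastforce
  define h where "h = (1 - y) * a + y * b"
  have h: "h - a = y * (b - a)" "b - h = (1 - y) * (b - a)"
    by (simp_all add: h_def algebra_simps)
  have lh: "strip_lo S < strip_hi S"
    using S by (rule strip_lo_less_hi)
  then have "a \<noteq> b"
    using \<tau> by (auto simp: a_def b_def bd_height_def)
  then have "h = a \<longleftrightarrow> y = 0" "h = b \<longleftrightarrow> y = 1"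
    using h by (metis eq_iff_diff_eq_0 mult_eq_0_iff right_minus_eq)+
  moreover have "strip_lo S < h \<and> h < strip_hi S \<longleftrightarrow> 0 < (h - a) * (b - h)"
    using \<tau> lh by (auto simp: a_def b_def bd_height_def zero_less_mult_iff)
  moreover have "(h - a) * (b - h) = y * (1 - y) * (b - a)\<^sup>2"
    unfolding h power2_eq_square by (simp add: mult_ac)
  moreover have "0 < y * (1 - y) * (b - a)\<^sup>2 \<longleftrightarrow> 0 < y \<and> y < 1"
    using \<open>a \<noteq> b\<close> by (auto simp: zero_less_mult_iff)
  moreover have "{-1, 1} = {- \<tau>, \<tau>}"
    using \<tau> by auto
  moreover have "place \<delta> a b p = (\<delta> * x, h)"
    by (simp add: place_def p h_def)
  ultimately show ?thesis
    by (simp add: mem_strip_iff[OF S] unit_strip_def p flip: a_def b_def)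
qed

lemma strip_homeo_place:
  assumes S: "is_strip S" and signs: "\<delta> \<in> {-1, 1}" "\<tau> \<in> {-1, 1}"
  shows "strip_homeo \<delta> \<tau> (unit_strip ((\<lambda>x. \<delta> * x) -` bd_trace (- \<tau>) S) ((\<lambda>x. \<delta> * x) -` bd_trace \<tau> S)) S
    (place \<delta> (bd_height (- \<tau>) S) (bd_height \<tau> S))" (is "strip_homeo _ _ ?U _ ?f")
proof -
  have heights: "0 < \<tau> * (bd_height \<tau> S - bd_height (- \<tau>) S)"
    using signs(2) strip_lo_less_hi[OF S] by (auto simp: bd_height_def)
  then have "bd_height (- \<tau>) S \<noteq> bd_height \<tau> S"
    by auto
  then obtain g where g: "homeomorphism UNIV UNIV ?f g"
    using homeomorphism_place[OF signs(1)] by blast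
  have "?f ` ?U = S"
    using place_in_strip_iff[OF S signs(2), of \<delta>] homeomorphism_apply2[OF g]
    by (metis (no_types, lifting) UNIV_I image_eqI image_subsetI subsetI subset_antisym)
  then have "homeomorphism ?U S ?f g"
    using g by (rule homeomorphism_of_subsets[rotated -1]) auto
  then have "homeomorphic_map (top_of_set ?U) (top_of_set S) ?f"
    by (auto simp: homeomorphic_map_top_of_set)
  moreover have "signed_mono_on \<delta> {p \<in> ?U. snd p = y} fst (fst \<circ> ?f)" for y
    using signs(1) by (auto simp: signed_mono_on_def place_def)
  moreover have "signed_mono_on \<tau> ?U snd (snd \<circ> ?f)"
  proof (rule signed_mono_onI[OF signs(2)])
    fix p q :: "real \<times> real" assume "snd p < snd q"
    then have "0 < (snd q - snd p) * (\<tau> * (bd_height \<tau> S - bd_height (- \<tau>) S))"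
      using heights by simp
    also have "\<dots> = \<tau> * (snd \<circ> ?f) q - \<tau> * (snd \<circ> ?f) p"
      by (simp add: place_def algebra_simps)
    finally show "\<tau> * (snd \<circ> ?f) p < \<tau> * (snd \<circ> ?f) q"
      by simp
  qed
  moreover have "\<forall>p\<in>?U. \<forall>q\<in>?U. snd p = snd q \<longrightarrow> snd (?f p) = snd (?f q)"
    by (simp add: place_def)
  ultimately show ?thesis
    unfolding strip_homeo_def by blast
qed

lemma strip_extension:
  fixes f :: "int \<Rightarrow> real \<Rightarrow> real"
  assumes S: "is_strip S" and T: "is_strip T" and signs: "\<delta> \<in> {-1, 1}" "\<tau> \<in> {-1, 1}"
    and mono: "\<And>s. s \<in> {-1, 1} \<Longrightarrow> signed_mono_on \<delta> (bd_trace s S) (\<lambda>x. x) (f s)"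
    and image: "\<And>s. s \<in> {-1, 1} \<Longrightarrow> f s ` bd_trace s S = bd_trace (\<tau> * s) T"
  obtains F where "strip_homeo \<delta> \<tau> S T F"
    "\<And>s x. s \<in> {-1, 1} \<Longrightarrow> x \<in> bd_trace s S \<Longrightarrow> F (x, bd_height s S) = (f s x, bd_height (\<tau> * s) T)"
proof -
  define g where "g s x = \<delta> * f s x" for s x
  have \<delta>_square: "real_of_int \<delta> * (real_of_int \<delta> * x) = x" for x
    using signs(1) by auto
  have g_image: "g s ` bd_trace s S = (\<lambda>x. \<delta> * x) -` bd_trace (\<tau> * s) T" if "s \<in> {-1, 1}" for s
    unfolding image[OF that, symmetric] by (auto simp: g_def \<delta>_square image_iff) (metis \<delta>_square)
  have g_open: "open (g s ` bd_trace s S)" if "s \<in> {-1, 1}" for s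
    unfolding g_image[OF that] by (intro open_vimage open_bd_trace[OF T] continuous_intros)
  have g_mono: "strict_mono_on (bd_trace s S) (g s)" if "s \<in> {-1, 1}" for s
    using mono[OF that] by (auto simp: signed_mono_on_def strict_mono_on_def g_def)
  obtain F where F: "strip_homeo 1 1 (unit_strip (bd_trace (-1) S) (bd_trace 1 S))
      (unit_strip (g (-1) ` bd_trace (-1) S) (g 1 ` bd_trace 1 S)) F"
    and F_bd: "\<And>x. x \<in> bd_trace (-1) S \<Longrightarrow> F (x, 0) = (g (-1) x, 0)"
      "\<And>x. x \<in> bd_trace 1 S \<Longrightarrow> F (x, 1) = (g 1 x, 1)"
    using unit_strip_extension[of "bd_trace (-1) S" "g (-1)" "bd_trace 1 S" "g 1"] g_mono g_open
      open_bd_trace[OF S]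
    by auto
  let ?p = "place 1 (bd_height (-1) S) (bd_height 1 S)"
    and ?q = "place \<delta> (bd_height (- \<tau>) T) (bd_height \<tau> T)"
  have p: "strip_homeo 1 1 (unit_strip (bd_trace (-1) S) (bd_trace 1 S)) S ?p"
    using strip_homeo_place[OF S, of 1 1] by simp
  then obtain p' where p': "homeomorphism (unit_strip (bd_trace (-1) S) (bd_trace 1 S)) S ?p p'"
    by (rule strip_homeo_homeomorphism)
  have q: "strip_homeo \<delta> \<tau> (unit_strip (g (-1) ` bd_trace (-1) S) (g 1 ` bd_trace 1 S)) T ?q"
    using strip_homeo_place[OF T signs] g_image by simp
  have "strip_homeo \<delta> \<tau> S T (?q \<circ> (F \<circ> p'))"
    using strip_homeo_compose[OF strip_homeo_compose[OF strip_homeo_inverse[OF p p'] F] q] by simp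
  moreover have "(?q \<circ> (F \<circ> p')) (x, bd_height s S) = (f s x, bd_height (\<tau> * s) T)"
    if s: "s \<in> {-1, 1}" and x: "x \<in> bd_trace s S" for s x
  proof -
    have "(x, if s = -1 then 0 else 1) \<in> unit_strip (bd_trace (-1) S) (bd_trace 1 S)"
      using s x by (auto simp: unit_strip_def)
    from homeomorphism_apply1[OF p' this] show ?thesis
      using F_bd s x by (auto simp: place_def g_def \<delta>_square)
  qed
  ultimately show thesis
    by (rule that)
qed

section \<open>Signs of a foliated homeomorphism\<close>

lemma signed_mono_on_snd_strip:
  assumes S: "is_strip S" and f: "continuous_on S f" and mono: "signed_mono_on \<tau> (interior S) snd f"
  shows "signed_mono_on \<tau> S snd f"
proof (rule signed_mono_onI[OF signed_mono_on_sign[OF mono]])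
  fix p q assume p: "p \<in> S" and q: "q \<in> S" and pq: "snd p < snd q"
  obtain u where u: "snd p < u" "u < snd q"
    using dense[OF pq] by blast
  obtain v where v: "u < v" "v < snd q"
    using dense[OF u(2)] by blast
  have bounds: "strip_lo S \<le> snd p" "snd q \<le> strip_hi S"
    using snd_strip_le[OF S] p q by auto
  have interior: "(0, u) \<in> interior S" "(0, v) \<in> interior S"
    using bounds u v by (auto simp: interior_strip[OF S])
  have cont: "continuous_on S (\<lambda>p. \<tau> * f p)" "continuous_on S (\<lambda>p. - (\<tau> * f p))"
    by (intro continuous_intros f)+
  have "\<tau> * f p \<le> \<tau> * f (0, u)"
  proof (rule continuous_on_le_closure[OF cont(1) _ p])
    show "UNIV \<times> {strip_lo S<..<u} \<subseteq> S"
      using bounds u v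
      by (intro subset_trans[OF _ interior_subset[of S]]) (auto simp: interior_strip[OF S])
    show "p \<in> closure (UNIV \<times> {strip_lo S<..<u})"
      using bounds u by (simp add: closure_Times mem_Times_iff)
    show "\<tau> * f a \<le> \<tau> * f (0, u)" if "a \<in> UNIV \<times> {strip_lo S<..<u}" for a
      using signed_mono_onD[OF mono _ interior(1), of a] that bounds u
      by (auto simp: interior_strip[OF S] less_imp_le)
  qed
  moreover have "- (\<tau> * f q) \<le> - (\<tau> * f (0, v))"
  proof (rule continuous_on_le_closure[OF cont(2) _ q])
    show "UNIV \<times> {v<..<strip_hi S} \<subseteq> S"
      using bounds u v
      by (intro subset_trans[OF _ interior_subset[of S]]) (auto simp: interior_strip[OF S])
    show "q \<in> closure (UNIV \<times> {v<..<strip_hi S})"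
      using bounds v by (simp add: closure_Times mem_Times_iff)
    show "- (\<tau> * f a) \<le> - (\<tau> * f (0, v))" if "a \<in> UNIV \<times> {v<..<strip_hi S}" for a
      using signed_mono_onD[OF mono interior(2), of a] that bounds u v
      by (auto simp: interior_strip[OF S] less_imp_le)
  qed
  moreover have "\<tau> * f (0, u) < \<tau> * f (0, v)"
    using signed_mono_onD[OF mono interior] v(1) by simp
  ultimately show "\<tau> * f p < \<tau> * f q"
    by linarith
qed

lemma connected_row_pairs:
  assumes S: "is_strip S"
  shows "connected {((a, b), y). a < b \<and> (a, y) \<in> S \<and> (b, y) \<in> S}" (is "connected ?K")
proof (rule connected_intermediate_closure)
  let ?R = "{p :: real \<times> real. fst p < snd p} \<times> {strip_lo S<..<strip_hi S}"
  have halfplane: "{p :: real \<times> real. fst p < snd p} = {p. inner (1, -1) p < 0}"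
    by (auto simp: inner_prod_def)
  show "connected ?R"
    unfolding halfplane by (intro connected_Times convex_connected convex_halfspace_lt) auto
  show "?R \<subseteq> ?K"
    using mem_strip_iff[OF S] by auto
  have "?K \<subseteq> {p. fst p < snd p} \<times> {strip_lo S..strip_hi S}"
    using snd_strip_le[OF S] by force
  then show "?K \<subseteq> closure ?R"
    using strip_lo_less_hi[OF S] closure_subset[of "{p :: real \<times> real. fst p < snd p}"]
    by (auto simp: closure_Times)
qed

context
  fixes S T :: "(real \<times> real) set" and F G :: "real \<times> real \<Rightarrow> real \<times> real"
  assumes S: "is_strip S" and T: "is_strip T" and FG: "homeomorphism S T F G"
    and leaf: "\<And>L. L \<in> strip_leaves S \<Longrightarrow> F ` L \<in> strip_leaves T"
begin

lemma interior_row_image: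
  assumes y: "y \<in> {strip_lo S<..<strip_hi S}"
  obtains z where "F ` (UNIV \<times> {y}) = UNIV \<times> {z}"
proof -
  have "F ` (UNIV \<times> {y}) \<subseteq> F ` interior S"
    using y by (intro image_mono) (auto simp: interior_strip[OF S])
  then have sub: "F ` (UNIV \<times> {y}) \<subseteq> interior T"
    by (simp add: homeomorphism_image_interior[OF FG])
  have "F ` (UNIV \<times> {y}) \<notin> components (bd s T)" for s
  proof
    assume "F ` (UNIV \<times> {y}) \<in> components (bd s T)"
    then have "F (0, y) \<in> bd s T"
      using in_components_subset by blast
    then have "F (0, y) \<notin> interior T"
      using bd_notin_interior[OF T] by (auto simp: bd_eq_image_bd_trace)
    then show False
      using sub by blast
  qed
  moreover have "F ` (UNIV \<times> {y}) \<in> strip_leaves T"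
    using y by (intro leaf) (auto simp: strip_leaves_eq)
  ultimately show thesis
    using that by (auto simp: strip_leaves_eq)
qed

lemma interior_in_strip: "y \<in> {strip_lo S<..<strip_hi S} \<Longrightarrow> (x, y) \<in> S"
  using mem_strip_iff[OF S] by simp

lemma snd_interior_row:
  assumes "y \<in> {strip_lo S<..<strip_hi S}"
  shows "snd (F (a, y)) = snd (F (b, y))"
proof -
  obtain z where "F ` (UNIV \<times> {y}) = UNIV \<times> {z}"
    using assms by (rule interior_row_image)
  then have "F (a, y) \<in> UNIV \<times> {z}" "F (b, y) \<in> UNIV \<times> {z}"
    by blast+
  then show ?thesis
    by auto
qed

lemma height_mono_exists: "\<exists>\<tau>. signed_mono_on \<tau> S snd (snd \<circ> F)"
proof -
  let ?I = "{strip_lo S<..<strip_hi S}" and ?\<beta> = "\<lambda>y. snd (F (0, y))"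
  have "continuous_on ?I ?\<beta>"
    by (intro continuous_intros continuous_on_compose2[OF homeomorphism_cont1[OF FG]])
      (auto intro: interior_in_strip)
  moreover have "inj_on ?\<beta> ?I"
  proof (rule inj_onI)
    fix y y' assume y: "y \<in> ?I" "y' \<in> ?I" "?\<beta> y = ?\<beta> y'"
    obtain z where z: "F ` (UNIV \<times> {y}) = UNIV \<times> {z}"
      using y(1) by (rule interior_row_image)
    then have "F (0, y) \<in> UNIV \<times> {z}"
      by blast
    then have "F (0, y') \<in> F ` (UNIV \<times> {y})"
      using y(3) by (auto simp: z mem_Times_iff)
    then obtain a where "F (0, y') = F (a, y)"
      by blast
    then show "y = y'"
      using homeomorphism_apply1[OF FG interior_in_strip] y(1,2) by (metis snd_conv)
  qed
  ultimately obtain \<tau> where \<tau>: "signed_mono_on \<tau> ?I (\<lambda>y. y) ?\<beta>"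
    using continuous_inj_signed_mono_on[OF connected_Ioo] by blast
  have "signed_mono_on \<tau> (interior S) snd (snd \<circ> F)"
  proof (rule signed_mono_onI[OF signed_mono_on_sign[OF \<tau>]])
    have \<beta>: "(snd \<circ> F) r = ?\<beta> (snd r)" "snd r \<in> ?I" if "r \<in> interior S" for r
      using that snd_interior_row[of "snd r" "fst r" 0]
      by (simp_all add: interior_strip[OF S] mem_Times_iff)
    fix p q assume pq: "p \<in> interior S" "q \<in> interior S" "snd p < snd q"
    then show "\<tau> * (snd \<circ> F) p < \<tau> * (snd \<circ> F) q"
      using signed_mono_onD[OF \<tau> \<beta>(2) \<beta>(2)] unfolding \<beta>(1)[OF pq(1)] \<beta>(1)[OF pq(2)] by blast
  qed
  moreover have "continuous_on S (snd \<circ> F)"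
    using homeomorphism_cont1[OF FG] by (simp add: continuous_on_snd o_def)
  ultimately show ?thesis
    using signed_mono_on_snd_strip[OF S] by blast
qed

lemma snd_row:
  assumes p: "p \<in> S" and q: "q \<in> S" and pq: "snd p = snd q"
  shows "snd (F p) = snd (F q)"
proof (cases "p \<in> interior S")
  case True
  then show ?thesis
    using snd_interior_row[of "snd p" "fst p" "fst q"] unfolding interior_strip[OF S] mem_Times_iff
    by (metis pq prod.collapse)
next
  case False
  then obtain s where s: "s \<in> {-1, 1}" "snd p = bd_height s S"
    using S p by (meson strip_boundary_cases)
  obtain \<tau> where "signed_mono_on \<tau> S snd (snd \<circ> F)"
    using height_mono_exists by blast
  from homeomorphism_bd_height[OF FG this S T s(1)] show ?thesis
    using p q s(2) pq by metis
qed

lemma row_mono_exists: "\<exists>\<delta>. \<forall>y. signed_mono_on \<delta> {p \<in> S. snd p = y} fst (fst \<circ> F)"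
proof -
  define K where "K = {((a, b), y). a < b \<and> (a, y) \<in> S \<and> (b, y) \<in> S}"
  define \<phi> where "\<phi> = (\<lambda>((a, b), y). fst (F (b, y)) - fst (F (a, y)))"
  have "continuous_on K \<phi>"
    unfolding \<phi>_def case_prod_unfold
    by (intro continuous_intros continuous_on_compose2[OF homeomorphism_cont1[OF FG]]) (auto simp: K_def)
  moreover have "\<phi> k \<noteq> 0" if "k \<in> K" for k
  proof -
    obtain a b y where "k = ((a, b), y)"
      by (metis surj_pair)
    then have k: "k = ((a, b), y)" "a < b" "(a, y) \<in> S" "(b, y) \<in> S"
      using that by (auto simp: K_def)
    have "F (a, y) \<noteq> F (b, y)"
      using homeomorphism_apply1[OF FG] k by (metis less_irrefl prod.inject)
    then have "fst (F (a, y)) \<noteq> fst (F (b, y))"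
      using snd_row[OF k(3,4)] by (simp add: prod_eq_iff)
    then show ?thesis
      by (simp add: k(1) \<phi>_def)
  qed
  ultimately have "\<exists>\<delta>\<in>{-1, 1 :: int}. \<forall>k\<in>K. 0 < \<delta> * \<phi> k"
    by (rule connected_nonzero_sign[OF connected_row_pairs[OF S, folded K_def]])
  then obtain \<delta> :: int where \<delta>: "\<delta> \<in> {-1, 1}" "\<And>k. k \<in> K \<Longrightarrow> 0 < \<delta> * \<phi> k"
    by blast
  have "signed_mono_on \<delta> {p \<in> S. snd p = y} fst (fst \<circ> F)" for y
  proof (rule signed_mono_onI[OF \<delta>(1)])
    fix p q assume pq: "p \<in> {p \<in> S. snd p = y}" "q \<in> {p \<in> S. snd p = y}" "fst p < fst q"
    then obtain a b where "p = (a, y)" "q = (b, y)"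
      by (cases p; cases q) auto
    then show "\<delta> * (fst \<circ> F) p < \<delta> * (fst \<circ> F) q"
      using \<delta>(2)[of "((a, b), y)"] pq by (simp add: K_def \<phi>_def right_diff_distrib)
  qed
  then show ?thesis
    by blast
qed

lemma foliated_homeomorphism_strip_homeo: "\<exists>\<delta> \<tau>. strip_homeo \<delta> \<tau> S T F"
proof -
  obtain \<tau> where "signed_mono_on \<tau> S snd (snd \<circ> F)"
    using height_mono_exists by blast
  moreover obtain \<delta> where "\<forall>y. signed_mono_on \<delta> {p \<in> S. snd p = y} fst (fst \<circ> F)"
    using row_mono_exists by blast
  moreover have "homeomorphic_map (top_of_set S) (top_of_set T) F"
    using FG by (auto simp: homeomorphic_map_top_of_set)
  ultimately show ?thesis
    unfolding strip_homeo_def using snd_row by blast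
qed

end

section \<open>Disjoint unions\<close>

lemma continuous_map_sum_topology:
  assumes \<nu>: "\<nu> \<in> I \<rightarrow> J" and F: "\<And>i. i \<in> I \<Longrightarrow> continuous_map (X i) (Y (\<nu> i)) (F i)"
  shows "continuous_map (sum_topology X I) (sum_topology Y J) (\<lambda>(i, x). (\<nu> i, F i x))"
    (is "continuous_map ?X ?Y ?h")
  unfolding continuous_map_def
proof (intro conjI allI impI)
  show "?h \<in> topspace ?X \<rightarrow> topspace ?Y"
    using \<nu> F by (auto simp: continuous_map_def Pi_iff)
  fix V assume V: "openin ?Y V"
  have "openin (X i) {x. (i, x) \<in> {p \<in> topspace ?X. ?h p \<in> V}}" if i: "i \<in> I" for i
  proof -
    have "openin (Y (\<nu> i)) {y. (\<nu> i, y) \<in> V}"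
      using V i \<nu> by (auto simp: openin_sum_topology)
    from openin_continuous_map_preimage[OF F[OF i] this] show ?thesis
      using i by simp
  qed
  then show "openin ?X {p \<in> topspace ?X. ?h p \<in> V}"
    by (auto simp: openin_sum_topology)
qed

lemma homeomorphic_map_sum_topology:
  assumes \<nu>: "bij_betw \<nu> I J" and F: "\<And>i. i \<in> I \<Longrightarrow> homeomorphic_map (X i) (Y (\<nu> i)) (F i)"
  shows "homeomorphic_map (sum_topology X I) (sum_topology Y J) (\<lambda>(i, x). (\<nu> i, F i x))"
proof -
  obtain G where G: "\<And>i. i \<in> I \<Longrightarrow> homeomorphic_maps (X i) (Y (\<nu> i)) (F i) (G i)"
    using F unfolding homeomorphic_map_maps by metis
  define \<mu> where "\<mu> = inv_into I \<nu>"
  have \<mu>: "\<mu> j \<in> I" "\<nu> (\<mu> j) = j" if "j \<in> J" for j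
    using that \<nu> by (auto simp: \<mu>_def bij_betw_def inv_into_into f_inv_into_f)
  have \<nu>_in: "\<nu> i \<in> J" "\<mu> (\<nu> i) = i" if "i \<in> I" for i
    using that \<nu> by (auto simp: \<mu>_def bij_betw_def)
  have inverse: "G i (F i x) = x" if "i \<in> I" "x \<in> topspace (X i)" for i x
    using G[OF that(1)] that(2) by (simp add: homeomorphic_maps_def)
  have "F (\<mu> j) (G (\<mu> j) y) = y" if "j \<in> J" "y \<in> topspace (Y j)" for j y
    using G[OF \<mu>(1)[OF that(1)]] \<mu>(2)[OF that(1)] that(2) by (simp add: homeomorphic_maps_def)
  moreover have "continuous_map (sum_topology X I) (sum_topology Y J) (\<lambda>(i, x). (\<nu> i, F i x))"
    using \<nu>_in G by (intro continuous_map_sum_topology) (auto simp: homeomorphic_maps_def)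
  moreover have "continuous_map (sum_topology Y J) (sum_topology X I) (\<lambda>(j, y). (\<mu> j, G (\<mu> j) y))"
  proof (intro continuous_map_sum_topology)
    show "continuous_map (Y j) (X (\<mu> j)) (G (\<mu> j))" if "j \<in> J" for j
      using G[OF \<mu>(1)[OF that]] \<mu>(2)[OF that] by (simp add: homeomorphic_maps_def)
  qed (use \<mu>(1) in blast)
  ultimately have "homeomorphic_maps (sum_topology X I) (sum_topology Y J)
      (\<lambda>(i, x). (\<nu> i, F i x)) (\<lambda>(j, y). (\<mu> j, G (\<mu> j) y))"
    using \<nu>_in(2) \<mu>(2) inverse by (auto simp: homeomorphic_maps_def)
  then show ?thesis
    by (rule homeomorphic_maps_imp_map)
qed

lemma homeomorphic_maps_sum_summand:
  assumes "i \<in> I"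
  shows "homeomorphic_maps (X i) (subtopology (sum_topology X I) ({i} \<times> topspace (X i))) (Pair i) snd"
proof -
  have "homeomorphic_map (X i) (subtopology (sum_topology X I) (Pair i ` topspace (X i))) (Pair i)"
    using embedding_map_component_injection[OF assms, of X] by (simp add: embedding_map_def)
  moreover have "Pair i ` topspace (X i) = {i} \<times> topspace (X i)"
    by auto
  ultimately obtain g
    where g: "homeomorphic_maps (X i) (subtopology (sum_topology X I) ({i} \<times> topspace (X i))) (Pair i) g"
    by (auto simp: homeomorphic_map_maps)
  then show ?thesis
  proof (rule homeomorphic_maps_eq)
    show "g y = snd y" if "y \<in> topspace (subtopology (sum_topology X I) ({i} \<times> topspace (X i)))" for y
      using that g by (cases y) (auto simp: homeomorphic_maps_def)
  qed simp
qed

lemma connectedin_sum_summand: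
  assumes "i \<in> I" "connected_space (X i)"
  shows "connectedin (sum_topology X I) ({i} \<times> topspace (X i))"
proof -
  have "connectedin (sum_topology X I) (Pair i ` topspace (X i))"
    using assms continuous_map_component_injection connectedin_continuous_map_image connectedin_topspace
    by metis
  moreover have "Pair i ` topspace (X i) = {i} \<times> topspace (X i)"
    by auto
  ultimately show ?thesis
    by simp
qed

lemma connected_components_of_sum_topology:
  assumes X: "\<And>i. i \<in> I \<Longrightarrow> connected_space (X i)" "\<And>i. i \<in> I \<Longrightarrow> topspace (X i) \<noteq> {}"
  shows "connected_components_of (sum_topology X I) = (\<lambda>i. {i} \<times> topspace (X i)) ` I"
proof -
  let ?C = "\<lambda>i. {i} \<times> topspace (X i)"
  have clopen: "openin (sum_topology X I) (?C i)" "closedin (sum_topology X I) (?C i)" if "i \<in> I" for i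
    using that by (auto simp: openin_sum_topology closedin_sum_topology Collect_conj_eq)
  have eq_summand: "D = ?C i"
    if D: "D \<in> connected_components_of (sum_topology X I)" and i: "i \<in> I"
      and meet: "\<not> disjnt D (?C i)" for D i
  proof
    show "?C i \<subseteq> D"
      by (rule connected_components_of_maximal[OF D connectedin_sum_summand meet]) (use i X(1) in auto)
    show "D \<subseteq> ?C i"
      using connectedin_clopen_cases[OF connectedin_connected_components_of[OF D] clopen(2,1)[OF i]] meet
      by blast
  qed
  show ?thesis
  proof (intro equalityI subsetI)
    fix D assume D: "D \<in> connected_components_of (sum_topology X I)"
    then obtain i x where "(i, x) \<in> D" "i \<in> I" "x \<in> topspace (X i)"
      using nonempty_connected_components_of[OF D] connected_components_of_subset[OF D] by fastforce
    then show "D \<in> ?C ` I"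
      using eq_summand[OF D] by (force simp: disjnt_iff)
  next
    fix D assume "D \<in> ?C ` I"
    then obtain i where i: "i \<in> I" "D = ?C i"
      by blast
    obtain x where "x \<in> topspace (X i)"
      using X(2)[OF i(1)] by blast
    then have "(i, x) \<in> D" "(i, x) \<in> topspace (sum_topology X I)"
      using i by auto
    then obtain E where "E \<in> connected_components_of (sum_topology X I)" "(i, x) \<in> E"
      by (metis Union_connected_components_of UnionE)
    then show "D \<in> connected_components_of (sum_topology X I)"
      using eq_summand[OF _ i(1)] \<open>(i, x) \<in> D\<close> i(2) by (metis disjnt_iff)
  qed
qed

section \<open>The strips of an atlas\<close>

definition bd_point :: "('i, 'g, 'z, 'm) striped_atlas_scheme \<Rightarrow> int \<Rightarrow> 'i \<Rightarrow> real \<Rightarrow> 'i \<times> (real \<times> real)"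
  where
  "bd_point A s l x = (l, (x, bd_height s (strip A l)))"

definition S0_interior :: "('i, 'g, 'z, 'm) striped_atlas_scheme \<Rightarrow> ('i \<times> (real \<times> real)) set" where
  "S0_interior A = (SIGMA l:Lam A. interior (strip A l))"

lemma xc_bd_point [simp]: "xc (bd_point A s l x) = x"
  by (simp add: xc_def bd_point_def)

lemma bd_point_in_S0_iff: "bd_point A s l x \<in> S0 A \<longleftrightarrow> l \<in> Lam A \<and> x \<in> bd_trace s (strip A l)"
  by (simp add: bd_point_def S0_def bd_trace_def)

lemma d_eq_components: "d A s l = (\<lambda>I. bd_point A s l ` I) ` components (bd_trace s (strip A l))"
proof -
  have "d A s l = (\<lambda>B. {l} \<times> B) ` components (bd s (strip A l))"
    by (auto simp: d_def)
  moreover have "{l} \<times> (\<lambda>x. (x, bd_height s (strip A l))) ` I = bd_point A s l ` I" for I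
    by (auto simp: bd_point_def)
  ultimately show ?thesis
    by (simp add: components_bd image_image)
qed

lemma Union_d: "\<Union> (d A s l) = bd_point A s l ` bd_trace s (strip A l)"
  by (simp add: d_eq_components image_Union[symmetric] Union_components)

lemma H_eq: "H A = (\<Union>l\<in>Lam A. \<Union>s\<in>{-1, 1}. d A s l)"
  by (auto simp: H_def dall_def)

lemma S0top_eq_sum_topology: "S0top A = sum_topology (\<lambda>l. top_of_set (strip A l)) (Lam A)"
  unfolding topology_eq
proof (intro allI iffI)
  fix W assume W: "openin (S0top A) W"
  then have sub: "W \<subseteq> S0 A"
    using openin_subset by (fastforce simp: S0top_def)
  have "openin (top_of_set (strip A l)) {p. (l, p) \<in> W}" if "l \<in> Lam A" for l
  proof -
    have "continuous_map (top_of_set (strip A l)) (S0top A) (Pair l)"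
      using that
      by (auto simp: S0top_def S0_def continuous_map_in_subtopology continuous_map_pairwise o_def)
    from openin_continuous_map_preimage[OF this W]
    have "openin (top_of_set (strip A l)) {p \<in> strip A l. (l, p) \<in> W}"
      by simp
    also have "{p \<in> strip A l. (l, p) \<in> W} = {p. (l, p) \<in> W}"
      using sub by (auto simp: S0_def)
    finally show ?thesis .
  qed
  then show "openin (sum_topology (\<lambda>l. top_of_set (strip A l)) (Lam A)) W"
    using sub by (auto simp: openin_sum_topology S0_def)
next
  fix W assume "openin (sum_topology (\<lambda>l. top_of_set (strip A l)) (Lam A)) W"
  then obtain V where V: "W = Sigma (Lam A) V" "\<And>l. l \<in> Lam A \<Longrightarrow> openin (top_of_set (strip A l)) (V l)"
    by (auto simp: openin_sum_topology_alt)
  then obtain T where T: "\<And>l. l \<in> Lam A \<Longrightarrow> open (T l)" "\<And>l. l \<in> Lam A \<Longrightarrow> V l = strip A l \<inter> T l"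
    unfolding openin_open by metis
  have "openin (prod_topology (discrete_topology UNIV) euclidean) (\<Union>l\<in>Lam A. {l} \<times> T l)"
    by (intro openin_Union ballI) (auto simp: openin_prod_Times_iff T)
  moreover have "W = (\<Union>l\<in>Lam A. {l} \<times> T l) \<inter> S0 A"
    using T(2) by (auto simp: V(1) S0_def)
  ultimately show "openin (S0top A) W"
    unfolding S0top_def openin_subtopology by blast
qed

lemma topspace_S0top [simp]: "topspace (S0top A) = S0 A"
  by (simp add: S0top_def)

lemma Hausdorff_S0top: "Hausdorff_space (S0top A)"
  unfolding S0top_def
  by (intro Hausdorff_space_subtopology)
    (simp add: Hausdorff_space_prod_topology Hausdorff_space_discrete_topology)

lemma S0_separation:
  assumes "p \<in> S0 A" "q \<in> S0 A" "p \<noteq> q"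
  obtains U V where "openin (S0top A) U" "openin (S0top A) V" "p \<in> U" "q \<in> V" "disjnt U V"
  using Hausdorff_S0top[of A] assms unfolding Hausdorff_space_def topspace_S0top by metis

lemma continuous_map_xc: "continuous_map (S0top A) euclideanreal xc"
proof -
  have "continuous_map (S0top A) euclidean snd"
    unfolding S0top_def by (intro continuous_map_from_subtopology continuous_map_snd)
  then have "continuous_map (S0top A) euclideanreal (fst \<circ> snd)"
    by (rule continuous_map_compose) (simp add: continuous_on_fst)
  then show ?thesis
    by (simp add: xc_def[abs_def] o_def)
qed

lemma continuous_map_into_S0top:
  assumes l: "l \<in> Lam A" and f: "continuous_on W f" "f ` W \<subseteq> strip A l"
  shows "continuous_map (top_of_set W) (S0top A) (\<lambda>w. (l, f w))"
proof -
  have "continuous_map (top_of_set W) (top_of_set (strip A l)) f"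
    using f by (simp add: continuous_map_in_subtopology image_subset_iff_funcset)
  moreover have "continuous_map (top_of_set (strip A l)) (S0top A) (Pair l)"
    unfolding S0top_eq_sum_topology by (rule continuous_map_component_injection[OF l])
  ultimately have "continuous_map (top_of_set W) (S0top A) (Pair l \<circ> f)"
    by (rule continuous_map_compose)
  then show ?thesis
    by (simp add: o_def)
qed

lemma homeomorphic_maps_S0_summand:
  "l \<in> Lam A \<Longrightarrow>
    homeomorphic_maps (top_of_set (strip A l)) (subtopology (S0top A) ({l} \<times> strip A l)) (Pair l) snd"
  using homeomorphic_maps_sum_summand[of l "Lam A" "\<lambda>l. top_of_set (strip A l)"]
  by (simp add: S0top_eq_sum_topology)

locale striped =
  fixes A :: "('i, 'g, 'z, 'm) striped_atlas_scheme"
  assumes atlas: "is_striped_atlas A"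
begin

lemma is_strip_strip: "l \<in> Lam A \<Longrightarrow> is_strip (strip A l)"
  using atlas by (simp add: is_striped_atlas_def)

lemma manifold: "is_2manifold (Zsp A)"
  and quotient: "quotient_map (S0top A) (Zsp A) (qmap A)"
  using atlas by (simp_all add: is_striped_atlas_def)

lemma continuous_qmap: "continuous_map (S0top A) (Zsp A) (qmap A)"
  using quotient by (rule quotient_imp_continuous_map)

lemma inj_on_unglued: "inj_on (qmap A) (S0 A - (\<Union>g\<in>Gam A. Xg A g \<union> Yg A g))"
  using atlas by (simp add: is_striped_atlas_def)

lemma S0_interior_subset: "S0_interior A \<subseteq> S0 A"
  using interior_subset by (fastforce simp: S0_interior_def S0_def)

lemma S0_interior_dense:
  assumes N: "openin (S0top A) N" and p: "p \<in> N"
  obtains w where "w \<in> N" "w \<in> S0_interior A"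
proof -
  obtain l z where lz: "p = (l, z)" "l \<in> Lam A" "z \<in> strip A l"
    using openin_subset[OF N] p by (auto simp: S0_def)
  then have "openin (top_of_set (strip A l)) {z. (l, z) \<in> N}"
    using N by (simp add: S0top_eq_sum_topology openin_sum_topology)
  then obtain T where T: "open T" "{z. (l, z) \<in> N} = strip A l \<inter> T"
    by (auto simp: openin_open)
  have "z \<in> T \<inter> closure (interior (strip A l))"
    using strip_subset_closure_interior[OF is_strip_strip[OF lz(2)]] lz p T(2) by blast
  then obtain w where "w \<in> T" "w \<in> interior (strip A l)"
    using open_Int_closure_eq_empty[OF T(1)] by blast
  then have "(l, w) \<in> N" "(l, w) \<in> S0_interior A"
    using T(2) lz(2) interior_subset by (auto simp: S0_interior_def)
  then show thesis
    by (rule that)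
qed

lemma bd_point_eq_iff:
  assumes "l \<in> Lam A" "s \<in> {-1, 1}" "r \<in> {-1, 1}"
  shows "bd_point A s l x = bd_point A r m y \<longleftrightarrow> l = m \<and> s = r \<and> x = y"
  using bd_height_eq_iff[OF is_strip_strip assms(2,3)] assms by (auto simp: bd_point_def)

lemma bd_point_notin_S0_interior:
  assumes "l \<in> Lam A"
  shows "bd_point A s l x \<notin> S0_interior A"
  using bd_notin_interior[OF is_strip_strip[OF assms]] by (auto simp: S0_interior_def bd_point_def)

lemma d_cases:
  assumes l: "l \<in> Lam A" and P: "P \<in> d A s l"
  obtains I where "open I" "connected I" "I \<noteq> {}" "P = bd_point A s l ` I"
proof -
  obtain I where "I \<in> components (bd_trace s (strip A l))" "P = bd_point A s l ` I"
    using P by (auto simp: d_eq_components)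
  then show thesis
    using that open_components[OF open_bd_trace[OF is_strip_strip[OF l]]]
      in_components_connected in_components_nonempty by metis
qed

lemma H_cases:
  assumes "P \<in> H A"
  obtains l s I where "l \<in> Lam A" "s \<in> {-1, 1}" "P \<in> d A s l"
    "open I" "connected I" "I \<noteq> {}" "P = bd_point A s l ` I"
proof -
  obtain l s where ls: "l \<in> Lam A" "s \<in> {-1, 1}" "P \<in> d A s l"
    using assms unfolding H_eq by blast
  from d_cases[OF ls(1,3)] that[OF ls] show thesis
    by blast
qed

lemma d_overlap:
  assumes l: "l \<in> Lam A" and signs: "s \<in> {-1, 1}" "r \<in> {-1, 1}"
    and PQ: "P \<in> d A s l" "Q \<in> d A r m" and p: "p \<in> P" "p \<in> Q"
  shows "l = m \<and> s = r \<and> P = Q"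
proof -
  obtain I J where I: "I \<in> components (bd_trace s (strip A l))" "P = bd_point A s l ` I"
    and J: "J \<in> components (bd_trace r (strip A m))" "Q = bd_point A r m ` J"
    using PQ by (auto simp: d_eq_components)
  obtain x y where x: "x \<in> I" "p = bd_point A s l x" and y: "y \<in> J" "p = bd_point A r m y"
    using p I(2) J(2) by blast
  then have "l = m" "s = r" "x = y"
    using bd_point_eq_iff[OF l signs] by metis+
  moreover from this have "I = J"
    using components_eq I(1) J(1) x(1) y(1) by blast
  ultimately show ?thesis
    using I(2) J(2) by simp
qed

lemma H_disjoint: "P \<in> H A \<Longrightarrow> Q \<in> H A \<Longrightarrow> p \<in> P \<Longrightarrow> p \<in> Q \<Longrightarrow> P = Q"
  unfolding H_eq using d_overlap by blast

lemma d_subset_S0: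
  assumes "l \<in> Lam A" "P \<in> d A s l"
  shows "P \<subseteq> S0 A"
proof -
  have "P \<subseteq> bd_point A s l ` bd_trace s (strip A l)"
    using assms(2) by (auto simp flip: Union_d)
  also have "\<dots> \<subseteq> S0 A"
    using assms(1) by (auto simp: bd_point_in_S0_iff)
  finally show ?thesis .
qed

lemma H_subset_S0: "P \<in> H A \<Longrightarrow> P \<subseteq> S0 A"
  unfolding H_eq using d_subset_S0 by blast

lemma H_disjoint_S0_interior: "P \<in> H A \<Longrightarrow> p \<in> P \<Longrightarrow> p \<notin> S0_interior A"
  by (elim H_cases) (use bd_point_notin_S0_interior in blast)

lemma S0_boundary_cases:
  assumes "p \<in> S0 A" "p \<notin> S0_interior A"
  obtains P where "P \<in> H A" "p \<in> P"
proof -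
  obtain l z where lz: "p = (l, z)" "l \<in> Lam A" "z \<in> strip A l" "z \<notin> interior (strip A l)"
    using assms by (auto simp: S0_def S0_interior_def)
  then obtain s where "s \<in> {-1, 1}" "snd z = bd_height s (strip A l)" "fst z \<in> bd_trace s (strip A l)"
    using strip_boundary_cases[OF is_strip_strip] by metis
  then have "p \<in> \<Union> (d A s l)" "d A s l \<subseteq> H A"
    using lz by (auto simp: Union_d H_eq bd_point_def prod_eq_iff image_iff)
  then show thesis
    using that by blast
qed

lemma H_inj_on_xc: "P \<in> H A \<Longrightarrow> inj_on xc P"
  by (elim H_cases) (auto simp: inj_on_def)

lemma H_nontrivial:
  assumes "P \<in> H A"
  obtains a b where "a \<in> P" "b \<in> P" "xc a < xc b"
proof -
  obtain l s I where I: "open I" "I \<noteq> {}" "P = bd_point A s l ` I"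
    using assms by (rule H_cases)
  then obtain x where "x \<in> I"
    by blast
  then obtain b where "x < b" "{x..<b} \<subseteq> I"
    using open_right[OF I(1), of x "x + 1"] by auto
  then have "(x + b) / 2 \<in> I"
    by auto
  then have "bd_point A s l x \<in> P" "bd_point A s l ((x + b) / 2) \<in> P"
    using I(3) \<open>x \<in> I\<close> by auto
  then show thesis
    using that[of "bd_point A s l x" "bd_point A s l ((x + b) / 2)"] \<open>x < b\<close> by simp
qed

end

section \<open>Mates\<close>

definition glued :: "('i, 'g, 'z, 'm) striped_atlas_scheme \<Rightarrow> ('i \<times> (real \<times> real)) set
    \<Rightarrow> ('i \<times> (real \<times> real)) set \<Rightarrow> bool" where
  "glued A P Q \<longleftrightarrow> (\<exists>g\<in>Gam A. {P, Q} = {Xg A g, Yg A g})"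

definition mate :: "('i, 'g, 'z, 'm) striped_atlas_scheme \<Rightarrow> 'i \<times> (real \<times> real) \<Rightarrow> 'i \<times> (real \<times> real)"
  where
  "mate A p = (if \<exists>P Q. glued A P Q \<and> p \<in> P
     then THE q. \<exists>P Q. glued A P Q \<and> p \<in> P \<and> q \<in> Q \<and> qmap A q = qmap A p
     else p)"

lemma glued_sym: "glued A P Q \<Longrightarrow> glued A Q P"
  by (simp add: glued_def insert_commute)

lemma sigma_commute: "sigma A P Q = sigma A Q P"
proof -
  have "(\<lambda>g. g \<in> Gam A \<and> ((P = Xg A g \<and> Q = Yg A g) \<or> (P = Yg A g \<and> Q = Xg A g))) =
    (\<lambda>g. g \<in> Gam A \<and> ((Q = Xg A g \<and> P = Yg A g) \<or> (Q = Yg A g \<and> P = Xg A g)))"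
    by auto
  then show ?thesis
    unfolding sigma_def by (simp only:)
qed

lemma orient_eq:
  assumes "signed_mono_on e P xc (xc \<circ> f)" "a \<in> P" "b \<in> P" "xc a < xc b"
  shows "orient f P = e"
  using assms unfolding orient_def signed_mono_on_def by force

context striped
begin

lemma glued_props:
  assumes "glued A P Q"
  shows "P \<in> H A" "Q \<in> H A" "P \<noteq> Q" "qmap A ` P = qmap A ` Q"
    "embedding_map (subtopology (S0top A) P) (Zsp A) (qmap A)"
proof -
  obtain g where g: "g \<in> Gam A" "P = Xg A g \<and> Q = Yg A g \<or> P = Yg A g \<and> Q = Xg A g"
    using assms by (auto simp: glued_def doubleton_eq_iff)
  show "P \<in> H A" "Q \<in> H A" "P \<noteq> Q"
    using g atlas unfolding is_striped_atlas_def by blast+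
  have "qmap A ` Xg A g = qmap A ` Yg A g"
    using g(1) atlas unfolding is_striped_atlas_def by blast
  then show "qmap A ` P = qmap A ` Q"
    using g(2) by auto
  show "embedding_map (subtopology (S0top A) P) (Zsp A) (qmap A)"
    using g atlas unfolding is_striped_atlas_def by auto
qed

lemma inj_on_S0_interior: "inj_on (qmap A) (S0_interior A)"
proof (rule inj_on_subset[OF inj_on_unglued])
  have "P \<inter> S0_interior A = {}" if "P \<in> H A" for P
    using H_disjoint_S0_interior[OF that] by blast
  moreover have "Xg A g \<in> H A" "Yg A g \<in> H A" if "g \<in> Gam A" for g
    using that atlas by (simp_all add: is_striped_atlas_def)
  ultimately show "S0_interior A \<subseteq> S0 A - (\<Union>g\<in>Gam A. Xg A g \<union> Yg A g)"
    using S0_interior_subset by blast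
qed

lemma glued_inj_on: "glued A P Q \<Longrightarrow> inj_on (qmap A) P"
  using glued_props(5) homeomorphic_imp_injective_map H_subset_S0[OF glued_props(1)]
  by (fastforce simp: embedding_map_def Int_absorb1)

lemma xi_eq_glued:
  assumes PQ: "glued A P Q"
  shows "xi A P = Q"
proof -
  have inj: "inj_on (Xg A) (Gam A)" "inj_on (Yg A) (Gam A)" "Xg A ` Gam A \<inter> Yg A ` Gam A = {}"
    using atlas unfolding is_striped_atlas_def by blast+
  obtain g where g: "g \<in> Gam A" "P = Xg A g \<and> Q = Yg A g \<or> P = Yg A g \<and> Q = Xg A g"
    using PQ by (auto simp: glued_def doubleton_eq_iff)
  have "(SOME h. h \<in> Gam A \<and> Xg A g = Xg A h) = g" "(SOME h. h \<in> Gam A \<and> Yg A g = Yg A h) = g"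
    using inj(1,2) g(1) by (auto intro!: some_equality simp: inj_on_def)
  moreover have "\<not> (\<exists>h\<in>Gam A. Yg A g = Xg A h)"
    using inj(3) g(1) by auto
  ultimately show ?thesis
    using g by (auto simp: xi_def)
qed

lemma glued_iff_xi: "glued A P Q \<longleftrightarrow> xi A P = Q \<and> Q \<noteq> P"
proof
  assume "xi A P = Q \<and> Q \<noteq> P"
  moreover have "glued A P (xi A P)" if "glued A P Q'" for Q'
    using that xi_eq_glued by blast
  moreover have "xi A P = P" if "\<nexists>Q. glued A P Q"
    using that unfolding xi_def glued_def by auto
  ultimately show "glued A P Q"
    by blast
qed (use xi_eq_glued glued_props(3) in blast)

lemma xi_in_H: "P \<in> H A \<Longrightarrow> xi A P \<in> H A"
  using glued_iff_xi glued_props(2) by metis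

lemma mate_eqI:
  assumes PQ: "glued A P Q" and p: "p \<in> P" and q: "q \<in> Q" "qmap A q = qmap A p"
  shows "mate A p = q"
proof -
  have "(THE q. \<exists>P Q. glued A P Q \<and> p \<in> P \<and> q \<in> Q \<and> qmap A q = qmap A p) = q"
  proof (rule the_equality)
    show "\<exists>P Q. glued A P Q \<and> p \<in> P \<and> q \<in> Q \<and> qmap A q = qmap A p"
      using assms by blast
    fix q' assume "\<exists>P Q. glued A P Q \<and> p \<in> P \<and> q' \<in> Q \<and> qmap A q' = qmap A p"
    then obtain P' Q' where q': "glued A P' Q'" "p \<in> P'" "q' \<in> Q'" "qmap A q' = qmap A p"
      by blast
    then have "P' = P"
      using H_disjoint[OF glued_props(1)[OF q'(1)] glued_props(1)[OF PQ]] p by blast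
    then have "Q' = Q"
      using xi_eq_glued PQ q'(1) by blast
    then show "q' = q"
      using glued_inj_on[OF glued_sym[OF PQ]] q q'(3,4) by (simp add: inj_on_def)
  qed
  then show ?thesis
    using PQ p by (auto simp: mate_def)
qed

lemma mate_glued:
  assumes PQ: "glued A P Q" and p: "p \<in> P"
  shows "mate A p \<in> Q" "qmap A (mate A p) = qmap A p"
proof -
  obtain q where "q \<in> Q" "qmap A q = qmap A p"
    using glued_props(4)[OF PQ] p by (metis imageE imageI)
  then show "mate A p \<in> Q" "qmap A (mate A p) = qmap A p"
    using mate_eqI[OF PQ p] by auto
qed

lemma mate_unglued: "(\<And>P Q. glued A P Q \<Longrightarrow> p \<notin> P) \<Longrightarrow> mate A p = p"
  unfolding mate_def by metis

lemma mate_mate: "mate A (mate A p) = p"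
proof (cases "\<exists>P Q. glued A P Q \<and> p \<in> P")
  case True
  then obtain P Q where PQ: "glued A P Q" "p \<in> P"
    by blast
  then show ?thesis
    by (intro mate_eqI[OF glued_sym]) (auto simp: mate_glued)
next
  case False
  then have "mate A p = p"
    by (intro mate_unglued) blast
  then show ?thesis
    by simp
qed

lemma qmap_mate: "qmap A (mate A p) = qmap A p"
  using mate_glued(2) mate_unglued by metis

lemma mate_in_S0: "p \<in> S0 A \<Longrightarrow> mate A p \<in> S0 A"
  using mate_glued(1) mate_unglued H_subset_S0 glued_props(2) by (metis subsetD)

lemma mate_S0_interior: "p \<in> S0_interior A \<Longrightarrow> mate A p = p"
  using H_disjoint_S0_interior glued_props(1) by (intro mate_unglued) blast

lemma mate_xi_fixed:
  assumes P: "P \<in> H A" "xi A P = P" and p: "p \<in> P"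
  shows "mate A p = p"
proof (rule mate_unglued)
  fix P' Q assume glued: "glued A P' Q"
  then have "P' \<noteq> P"
    using P(2) by (auto simp: glued_iff_xi)
  then show "p \<notin> P'"
    using H_disjoint[OF P(1) glued_props(1)[OF glued] p] by blast
qed

lemma mate_image:
  assumes P: "P \<in> H A"
  shows "mate A ` P = xi A P"
proof (cases "xi A P = P")
  case True
  then show ?thesis
    using mate_xi_fixed[OF P] by (auto simp: image_iff)
next
  case False
  then have glued: "glued A P (xi A P)"
    using glued_iff_xi by blast
  show ?thesis
  proof
    show "mate A ` P \<subseteq> xi A P"
      using mate_glued(1)[OF glued] by blast
    show "xi A P \<subseteq> mate A ` P"
      using mate_glued(1)[OF glued_sym[OF glued]] mate_mate by (metis imageI subsetI)
  qed
qed

lemma continuous_map_mate: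
  assumes PQ: "glued A P Q"
  shows "continuous_map (subtopology (S0top A) P) (S0top A) (mate A)"
proof -
  have top: "topspace (subtopology (S0top A) P) = P" "topspace (subtopology (S0top A) Q) = Q"
    using H_subset_S0 glued_props(1,2)[OF PQ] by (auto simp: Int_absorb1)
  obtain g where g:
    "homeomorphic_maps (subtopology (S0top A) Q) (subtopology (Zsp A) (qmap A ` Q)) (qmap A) g"
    using glued_props(5)[OF glued_sym[OF PQ]] top(2)
    by (auto simp: embedding_map_def homeomorphic_map_maps)
  have "continuous_map (subtopology (S0top A) P) (subtopology (Zsp A) (qmap A ` Q)) (qmap A)"
    using continuous_map_from_subtopology[OF continuous_qmap] glued_props(4)[OF PQ] top(1)
    by (auto simp: continuous_map_in_subtopology)
  moreover have "continuous_map (subtopology (Zsp A) (qmap A ` Q)) (S0top A) g"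
    using g by (auto simp: homeomorphic_maps_def continuous_map_in_subtopology)
  ultimately have "continuous_map (subtopology (S0top A) P) (S0top A) (g \<circ> qmap A)"
    by (rule continuous_map_compose)
  then show ?thesis
  proof (rule continuous_map_eq)
    fix p assume "p \<in> topspace (subtopology (S0top A) P)"
    then have "p \<in> P"
      using top(1) by simp
    then show "(g \<circ> qmap A) p = mate A p"
      using g mate_glued[OF PQ, of p] top(2) by (force simp: homeomorphic_maps_def)
  qed
qed

lemma continuous_on_mate:
  assumes PQ: "glued A (bd_point A s l ` I) Q" and l: "l \<in> Lam A"
  shows "continuous_on I (\<lambda>x. xc (mate A (bd_point A s l x)))"
proof -
  have "bd_point A s l ` I \<subseteq> S0 A"
    using H_subset_S0 glued_props(1)[OF PQ] by blast
  then have "(\<lambda>x. (x, bd_height s (strip A l))) ` I \<subseteq> strip A l"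
    by (auto simp: bd_point_def S0_def)
  then have "continuous_map (top_of_set I) (S0top A) (bd_point A s l)"
    unfolding bd_point_def[abs_def] by (intro continuous_map_into_S0top[OF l] continuous_intros)
  then have "continuous_map (top_of_set I) (subtopology (S0top A) (bd_point A s l ` I)) (bd_point A s l)"
    by (auto simp: continuous_map_in_subtopology)
  from continuous_map_compose[OF continuous_map_compose[OF this continuous_map_mate[OF PQ]]
    continuous_map_xc]
  show ?thesis
    by (simp add: o_def)
qed

lemma mate_mono_exists:
  assumes PQ: "glued A P Q"
  shows "\<exists>e. signed_mono_on e P xc (xc \<circ> mate A)"
proof -
  obtain l s I where P: "l \<in> Lam A" "connected I" "P = bd_point A s l ` I"
    using glued_props(1)[OF PQ] by (rule H_cases)
  have "inj_on (\<lambda>x. xc (mate A (bd_point A s l x))) I"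
  proof (rule inj_onI)
    fix x y assume xy: "x \<in> I" "y \<in> I" "xc (mate A (bd_point A s l x)) = xc (mate A (bd_point A s l y))"
    then have "mate A (bd_point A s l x) \<in> Q" "mate A (bd_point A s l y) \<in> Q"
      using mate_glued(1)[OF PQ] P(3) by auto
    then have "mate A (bd_point A s l x) = mate A (bd_point A s l y)"
      using inj_onD[OF H_inj_on_xc[OF glued_props(2)[OF PQ]] xy(3)] by blast
    then show "x = y"
      by (metis mate_mate xc_bd_point)
  qed
  then obtain e where "signed_mono_on e I (\<lambda>x. x) (\<lambda>x. xc (mate A (bd_point A s l x)))"
    using continuous_inj_signed_mono_on[OF P(2) continuous_on_mate[OF PQ[unfolded P(3)] P(1)]] by blast
  then show ?thesis
    unfolding P(3) signed_mono_on_image by (auto simp: o_def)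
qed

lemma sigma_Xg_Yg:
  assumes g: "g \<in> Gam A"
  shows "sigma A (Xg A g) (Yg A g) = orient (mate A) (Yg A g)"
proof -
  have inj: "inj_on (Xg A) (Gam A)" "Xg A ` Gam A \<inter> Yg A ` Gam A = {}"
    using atlas unfolding is_striped_atlas_def by blast+
  have "(SOME h. h \<in> Gam A \<and>
      ((Xg A g = Xg A h \<and> Yg A g = Yg A h) \<or> (Xg A g = Yg A h \<and> Yg A g = Xg A h))) = g"
  proof (rule some_equality)
    fix h assume h:
      "h \<in> Gam A \<and> ((Xg A g = Xg A h \<and> Yg A g = Yg A h) \<or> (Xg A g = Yg A h \<and> Yg A g = Xg A h))"
    have "Xg A g \<noteq> Yg A h"
      using inj(2) g h by blast
    then show "h = g"
      using inj(1) g h by (auto simp: inj_on_def)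
  qed (use g in simp)
  then have "sigma A (Xg A g) (Yg A g) = orient (glue A g) (Yg A g)"
    by (simp add: sigma_def)
  moreover have "glue A g y = mate A y" if y: "y \<in> Yg A g" for y
  proof -
    have YX: "glued A (Yg A g) (Xg A g)"
      using g by (auto simp: glued_def)
    show ?thesis
      unfolding glue_def
    proof (rule the_equality)
      show "mate A y \<in> Xg A g \<and> qmap A (mate A y) = qmap A y"
        using mate_glued[OF YX y] by simp
      show "x = mate A y" if "x \<in> Xg A g \<and> qmap A x = qmap A y" for x
        using mate_eqI[OF YX y, of x] that by simp
    qed
  qed
  ultimately show ?thesis
    by (simp add: orient_def)
qed

lemma mate_signed_mono_on:
  assumes PQ: "glued A P Q"
  shows "signed_mono_on (sigma A P Q) P xc (xc \<circ> mate A)"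
proof -
  obtain g where g: "g \<in> Gam A" "P = Xg A g \<and> Q = Yg A g \<or> P = Yg A g \<and> Q = Xg A g"
    using PQ by (auto simp: glued_def doubleton_eq_iff)
  then have YX: "glued A (Yg A g) (Xg A g)"
    by (auto simp: glued_def)
  obtain e where e: "signed_mono_on e (Yg A g) xc (xc \<circ> mate A)"
    using mate_mono_exists[OF YX] by blast
  obtain a b where "a \<in> Yg A g" "b \<in> Yg A g" "xc a < xc b"
    using glued_props(1)[OF YX] by (rule H_nontrivial)
  then have "sigma A P Q = e"
    using sigma_Xg_Yg[OF g(1)] orient_eq[OF e] g(2) sigma_commute[of A P Q] by metis
  moreover have "signed_mono_on e (Xg A g) xc (xc \<circ> mate A)"
  proof -
    have "mate A ` Yg A g = Xg A g"
      using mate_image glued_props(1)[OF YX] YX glued_iff_xi by metis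
    moreover have "signed_mono_on e (Yg A g) (xc \<circ> mate A) xc"
      by (rule signed_mono_on_sym[OF e])
        (use H_inj_on_xc[OF glued_props(1)[OF YX]] in \<open>auto simp: inj_on_def\<close>)
    then have "signed_mono_on e (mate A ` Yg A g) xc (xc \<circ> mate A)"
      by (simp add: signed_mono_on_image o_def mate_mate)
    ultimately show ?thesis
      by simp
  qed
  ultimately show ?thesis
    using e g(2) by auto
qed

end

section \<open>Fibres of the quotient map\<close>

definition collar ::
  "('i, 'g, 'z, 'm) striped_atlas_scheme \<Rightarrow> int \<Rightarrow> 'i \<Rightarrow> real \<times> real \<Rightarrow> 'i \<times> (real \<times> real)" where
  "collar A s l = (\<lambda>(x, t). (l, (x, bd_height s (strip A l) - s * \<bar>t\<bar>)))"

definition strip_width :: "(real \<times> real) set \<Rightarrow> real" where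
  "strip_width S = strip_hi S - strip_lo S"

definition folded_collars ::
  "('i, 'g, 'z, 'm) striped_atlas_scheme \<Rightarrow> int \<Rightarrow> 'i \<Rightarrow> int \<Rightarrow> 'i \<Rightarrow> real \<times> real \<Rightarrow> 'i \<times> (real \<times> real)" where
  "folded_collars A s l r m = (\<lambda>(x, t).
     if 0 \<le> t then collar A s l (x, t) else collar A r m (xc (mate A (bd_point A s l x)), t))"

lemma collar_0 [simp]: "collar A s l (x, 0) = bd_point A s l x"
  by (simp add: collar_def bd_point_def)

context striped
begin

lemma interior_chart:
  assumes w: "w \<in> S0_interior A" and N: "openin (S0top A) N" "w \<in> N"
  obtains V where "openin (Zsp A) V" "qmap A w \<in> V" "V \<subseteq> qmap A ` (N \<inter> S0_interior A)"
proof -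
  obtain l z where lz: "w = (l, z)" "l \<in> Lam A" "z \<in> interior (strip A l)"
    using w by (auto simp: S0_interior_def)
  obtain T where T: "open T" "{z. (l, z) \<in> N} = strip A l \<inter> T"
    using N(1) lz(2) by (auto simp: S0top_eq_sum_topology openin_sum_topology openin_open)
  define W where "W = interior (strip A l) \<inter> T"
  have W: "open W" "W \<subseteq> strip A l"
    using T(1) interior_subset by (auto simp: W_def)
  have W_in: "(l, z) \<in> N \<inter> S0_interior A" if "z \<in> W" for z
    using that T(2) W(2) lz(2) by (auto simp: W_def S0_interior_def)
  have "continuous_map (top_of_set W) (Zsp A) (qmap A \<circ> Pair l)"
    using continuous_map_into_S0top[OF lz(2) continuous_on_id, of W] W(2) continuous_qmap
    by (intro continuous_map_compose[where X' = "S0top A"]) auto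
  moreover have "inj_on (qmap A \<circ> Pair l) W"
  proof (rule inj_onI)
    fix y z assume yz: "y \<in> W" "z \<in> W" "(qmap A \<circ> Pair l) y = (qmap A \<circ> Pair l) z"
    then show "y = z"
      using inj_onD[OF inj_on_S0_interior, of "(l, y)" "(l, z)"] W_in by simp
  qed
  ultimately have "openin (Zsp A) ((qmap A \<circ> Pair l) ` W)"
    by (rule continuous_inj_open_image_2manifold[OF manifold W(1)])
  moreover have "z \<in> W"
    using N(2) T(2) lz interior_subset by (auto simp: W_def)
  ultimately show thesis
    using that[of "(qmap A \<circ> Pair l) ` W"] W_in lz(1) by (auto simp: image_subset_iff)
qed

lemma fibre_limit:
  assumes V: "openin (Zsp A) V" "V \<subseteq> qmap A ` M" and p: "p \<in> S0 A" "qmap A p \<in> V"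
    and N: "openin (S0top A) N" "p \<in> N"
  obtains w w' where "w \<in> N" "w \<in> S0_interior A" "w' \<in> M" "qmap A w' = qmap A w"
proof -
  have "openin (S0top A) (N \<inter> {z \<in> S0 A. qmap A z \<in> V})"
    using N(1) openin_continuous_map_preimage[OF continuous_qmap V(1)] by auto
  then obtain w where w: "w \<in> N" "qmap A w \<in> V" "w \<in> S0_interior A"
    using S0_interior_dense p N(2) by blast
  then obtain w' where "w' \<in> M" "qmap A w' = qmap A w"
    using V(2) by auto
  then show thesis
    using that w by blast
qed

lemma fibre_S0_interior:
  assumes w: "w \<in> S0_interior A" and p: "p \<in> S0 A" and eq: "qmap A p = qmap A w"
  shows "p = w"
proof (rule ccontr)
  assume "p \<noteq> w"
  then obtain N M where NM: "openin (S0top A) N" "openin (S0top A) M" "p \<in> N" "w \<in> M" "disjnt N M"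
    using S0_separation[of p A w] w p S0_interior_subset by blast
  obtain V where V: "openin (Zsp A) V" "qmap A w \<in> V" "V \<subseteq> qmap A ` (M \<inter> S0_interior A)"
    using interior_chart[OF w NM(2,4)] by blast
  obtain v v' where v: "v \<in> N" "v \<in> S0_interior A" "v' \<in> M \<inter> S0_interior A" "qmap A v' = qmap A v"
    using fibre_limit[OF V(1,3) p _ NM(1,3)] V(2) eq by metis
  then have "v' = v"
    using inj_onD[OF inj_on_S0_interior v(4)] by blast
  then show False
    using v(1,3) NM(5) unfolding disjnt_def by blast
qed

lemma collar_in_S0_interior:
  assumes "l \<in> Lam A" "s \<in> {-1, 1}" "t \<noteq> 0" "2 * \<bar>t\<bar> < strip_width (strip A l)"
  shows "collar A s l (x, t) \<in> S0_interior A"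
  using assms
  by (auto simp: collar_def S0_interior_def interior_strip is_strip_strip bd_height_def strip_width_def)

lemma collar_eqD:
  assumes "l \<in> Lam A" "s \<in> {-1, 1}" "r \<in> {-1, 1}"
    and t: "2 * \<bar>t\<bar> < strip_width (strip A l)" "2 * \<bar>t'\<bar> < strip_width (strip A m)"
    and eq: "collar A s l (x, t) = collar A r m (x', t')"
  shows "bd_point A s l x = bd_point A r m x'" "\<bar>t\<bar> = \<bar>t'\<bar>"
proof -
  have lm: "l = m" "x = x'"
    and heights: "bd_height s (strip A l) - s * \<bar>t\<bar> = bd_height r (strip A l) - r * \<bar>t'\<bar>"
    using eq by (auto simp: collar_def)
  then have "s = r"
    using assms(2,3) t by (auto simp: bd_height_def strip_width_def)
  then show "bd_point A s l x = bd_point A r m x'" "\<bar>t\<bar> = \<bar>t'\<bar>"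
    using lm heights assms(2) by auto
qed

lemma continuous_map_collar:
  assumes l: "l \<in> Lam A" and s: "s \<in> {-1, 1}" and f: "continuous_on W f"
    and range: "\<And>w. w \<in> W \<Longrightarrow> fst (f w) \<in> bd_trace s (strip A l)"
      "\<And>w. w \<in> W \<Longrightarrow> 2 * \<bar>snd (f w)\<bar> < strip_width (strip A l)"
  shows "continuous_map (top_of_set W) (S0top A) (\<lambda>w. collar A s l (f w))"
proof -
  have "collar A s l (f w) \<in> S0 A" if "w \<in> W" for w
  proof (cases "snd (f w) = 0")
    case True
    then show ?thesis
      using range(1)[OF that] l bd_point_in_S0_iff[of A s l] by (metis collar_0 prod.collapse)
  next
    case False
    then show ?thesis
      using collar_in_S0_interior[OF l s _ range(2)[OF that], of "fst (f w)"] S0_interior_subset by auto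
  qed
  then have "(\<lambda>w. (fst (f w), bd_height s (strip A l) - s * \<bar>snd (f w)\<bar>)) ` W \<subseteq> strip A l"
    by (auto simp: collar_def S0_def case_prod_unfold)
  then show ?thesis
    unfolding collar_def case_prod_unfold by (intro continuous_map_into_S0top[OF l] continuous_intros f)
qed

context
  fixes s r :: int and l m :: 'i and I J :: "real set" and e :: real
  assumes vertices: "l \<in> Lam A" "m \<in> Lam A" and signs: "s \<in> {-1, 1}" "r \<in> {-1, 1}"
    and glued: "glued A (bd_point A s l ` I) (bd_point A r m ` J)"
    and width: "2 * e \<le> strip_width (strip A l)" "2 * e \<le> strip_width (strip A m)"
begin

lemma mate_bd_point:
  assumes "x \<in> I"
  shows "bd_point A r m (xc (mate A (bd_point A s l x))) = mate A (bd_point A s l x)"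
  using mate_glued(1)[OF glued, of "bd_point A s l x"] assms by auto

lemma glued_sides_disjoint:
  assumes "x \<in> I" "x' \<in> I"
  shows "bd_point A s l x \<noteq> mate A (bd_point A s l x')"
  using H_disjoint[OF glued_props(1,2)[OF glued], of "bd_point A s l x"] glued_props(3)[OF glued]
    mate_glued(1)[OF glued, of "bd_point A s l x'"] assms by auto

lemma bd_trace_sides:
  assumes "x \<in> I"
  shows "x \<in> bd_trace s (strip A l)" "xc (mate A (bd_point A s l x)) \<in> bd_trace r (strip A m)"
proof -
  have "bd_point A s l x \<in> S0 A"
    using H_subset_S0[OF glued_props(1)[OF glued]] assms by blast
  then show "x \<in> bd_trace s (strip A l)" "xc (mate A (bd_point A s l x)) \<in> bd_trace r (strip A m)"
    using mate_in_S0[of "bd_point A s l x"] mate_bd_point[OF assms] by (metis bd_point_in_S0_iff)+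
qed

lemma continuous_map_collars:
  "continuous_map (top_of_set (I \<times> {-e<..<e})) (S0top A) (collar A s l)"
  "continuous_map (top_of_set (I \<times> {-e<..<e})) (S0top A)
      (\<lambda>w. collar A r m (xc (mate A (bd_point A s l (fst w))), snd w))"
proof -
  show "continuous_map (top_of_set (I \<times> {-e<..<e})) (S0top A) (collar A s l)"
    by (rule continuous_map_collar[OF vertices(1) signs(1) continuous_on_id])
      (use bd_trace_sides(1) width in auto)
  have "continuous_on (I \<times> {-e<..<e}) (\<lambda>w. xc (mate A (bd_point A s l (fst w))))"
    by (rule continuous_on_compose2[OF continuous_on_mate[OF glued vertices(1)]
          continuous_on_fst[OF continuous_on_id]]) auto
  then have "continuous_on (I \<times> {-e<..<e}) (\<lambda>w. (xc (mate A (bd_point A s l (fst w))), snd w))"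
    by (intro continuous_on_Pair continuous_on_snd continuous_on_id)
  then show "continuous_map (top_of_set (I \<times> {-e<..<e})) (S0top A)
      (\<lambda>w. collar A r m (xc (mate A (bd_point A s l (fst w))), snd w))"
    by (rule continuous_map_collar[OF vertices(2) signs(2)]) (use bd_trace_sides(2) width in auto)
qed

lemma folded_collars_in_S0_interior:
  assumes "t \<noteq> 0" "\<bar>t\<bar> < e"
  shows "folded_collars A s l r m (x, t) \<in> S0_interior A"
proof -
  have "2 * \<bar>t\<bar> < strip_width (strip A l)" "2 * \<bar>t\<bar> < strip_width (strip A m)"
    using assms(2) width by linarith+
  then show ?thesis
    using assms(1) by (simp add: folded_collars_def collar_in_S0_interior[OF vertices(1) signs(1)]
        collar_in_S0_interior[OF vertices(2) signs(2)])
qed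

lemma folded_collars_in_S0:
  assumes "x \<in> I" "\<bar>t\<bar> < e"
  shows "folded_collars A s l r m (x, t) \<in> S0 A"
proof (cases "t = 0")
  case True
  then show ?thesis
    using bd_trace_sides(1)[OF assms(1)] vertices(1) by (simp add: folded_collars_def bd_point_in_S0_iff)
next
  case False
  then show ?thesis
    using folded_collars_in_S0_interior assms(2) S0_interior_subset by blast
qed

lemma folded_collars_eqD:
  assumes x: "x \<in> I" "x' \<in> I" and t: "\<bar>t\<bar> < e" "\<bar>t'\<bar> < e"
    and eq: "folded_collars A s l r m (x, t) = folded_collars A s l r m (x', t')"
  shows "(x, t) = (x', t')"
proof -
  note widths = order_less_le_trans[OF _ width(1)] order_less_le_trans[OF _ width(2)]
  let ?y = "xc (mate A (bd_point A s l x))" and ?y' = "xc (mate A (bd_point A s l x'))"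
  consider (upper) "0 \<le> t" "0 \<le> t'" | (lower) "t < 0" "t' < 0" | (opposite) "0 \<le> t \<longleftrightarrow> t' < 0"
    by linarith
  then show ?thesis
  proof cases
    case upper
    then show ?thesis
      using collar_eqD[OF vertices(1) signs(1,1) widths(1) widths(1), of t t' x x'] eq t
      by (simp add: folded_collars_def bd_point_def)
  next
    case lower
    then have "mate A (bd_point A s l x) = mate A (bd_point A s l x')" "\<bar>t\<bar> = \<bar>t'\<bar>"
      using collar_eqD[OF vertices(2) signs(2,2) widths(2) widths(2), of t t' ?y ?y']
        eq t mate_bd_point[OF x(1)] mate_bd_point[OF x(2)]
      by (simp_all add: folded_collars_def)
    then show ?thesis
      using lower by (metis abs_of_neg minus_equation_iff mate_mate xc_bd_point)
  next
    case opposite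
    have "0 \<le> t \<Longrightarrow> bd_point A s l x = mate A (bd_point A s l x')"
      using collar_eqD(1)[OF vertices(1) signs widths, of t t' x ?y'] opposite eq t
        mate_bd_point[OF x(2)]
      by (simp add: folded_collars_def)
    moreover have "t < 0 \<Longrightarrow> bd_point A s l x' = mate A (bd_point A s l x)"
      using collar_eqD(1)[OF vertices(1) signs widths, of t' t x' ?y] opposite eq t
        mate_bd_point[OF x(1)]
      by (simp add: folded_collars_def)
    ultimately show ?thesis
      using glued_sides_disjoint[OF x] glued_sides_disjoint[OF x(2,1)] by (meson not_less)
  qed
qed

lemma inj_on_qmap_folded_collars: "inj_on (qmap A \<circ> folded_collars A s l r m) (I \<times> {-e<..<e})"
proof (rule inj_onI)
  let ?c = "folded_collars A s l r m"
  fix w w' assume "w \<in> I \<times> {-e<..<e}" "w' \<in> I \<times> {-e<..<e}" and "(qmap A \<circ> ?c) w = (qmap A \<circ> ?c) w'"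
  then obtain x t x' t' where w: "w = (x, t)" "w' = (x', t')" and x: "x \<in> I" "x' \<in> I"
    and t: "\<bar>t\<bar> < e" "\<bar>t'\<bar> < e" and eq: "qmap A (?c (x, t)) = qmap A (?c (x', t'))"
    by (cases w; cases w') auto
  show "w = w'"
  proof (cases "t = 0 \<and> t' = 0")
    case True
    then have "qmap A (bd_point A s l x) = qmap A (bd_point A s l x')"
      using eq by (simp add: folded_collars_def)
    from inj_onD[OF glued_inj_on[OF glued] this] x have "bd_point A s l x = bd_point A s l x'"
      by blast
    then show ?thesis
      using True w by (simp add: bd_point_def)
  next
    case False
    then have "?c (x, t) \<in> S0_interior A \<or> ?c (x', t') \<in> S0_interior A"
      using folded_collars_in_S0_interior t by auto
    then have "?c (x, t) = ?c (x', t')"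
      using fibre_S0_interior folded_collars_in_S0 x t eq by metis
    then show ?thesis
      unfolding w by (rule folded_collars_eqD[OF x t])
  qed
qed

lemma continuous_map_folded_collars:
  "continuous_map (top_of_set (I \<times> {-e<..<e})) (Zsp A) (qmap A \<circ> folded_collars A s l r m)"
proof -
  let ?X = "top_of_set (I \<times> {-e<..<e})"
  let ?c1 = "collar A s l" and ?c2 = "\<lambda>w. collar A r m (xc (mate A (bd_point A s l (fst w))), snd w)"
  have "continuous_map ?X (Zsp A) (\<lambda>w. if 0 \<le> snd w then (qmap A \<circ> ?c1) w else (qmap A \<circ> ?c2) w)"
  proof (rule continuous_map_cases_le)
    show "continuous_map ?X euclideanreal (\<lambda>w. 0)" "continuous_map ?X euclideanreal snd"
      by (auto intro!: continuous_intros)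
    show "continuous_map (subtopology ?X {w \<in> topspace ?X. 0 \<le> snd w}) (Zsp A) (qmap A \<circ> ?c1)"
      "continuous_map (subtopology ?X {w \<in> topspace ?X. snd w \<le> 0}) (Zsp A) (qmap A \<circ> ?c2)"
      by (intro continuous_map_from_subtopology continuous_map_compose[OF _ continuous_qmap]
        continuous_map_collars)+
    show "(qmap A \<circ> ?c1) w = (qmap A \<circ> ?c2) w" if "w \<in> topspace ?X" "0 = snd w" for w
      using that by (auto simp: mate_bd_point qmap_mate)
  qed
  then show ?thesis
    by (rule continuous_map_eq) (auto simp: folded_collars_def)
qed

end

lemma glued_chart:
  assumes PQ: "glued A P Q" and p: "p \<in> P" and N: "openin (S0top A) N" "p \<in> N"
    and M: "openin (S0top A) M" "mate A p \<in> M"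
  obtains V where "openin (Zsp A) V" "qmap A p \<in> V" "V \<subseteq> qmap A ` (N \<union> M)"
proof -
  obtain l s I where l: "l \<in> Lam A" "s \<in> {-1, 1}" "open I" "P = bd_point A s l ` I"
    using glued_props(1)[OF PQ] by (rule H_cases)
  obtain m r J where m: "m \<in> Lam A" "r \<in> {-1, 1}" "Q = bd_point A r m ` J"
    using glued_props(2)[OF PQ] by (rule H_cases)
  define e where "e = min (strip_width (strip A l)) (strip_width (strip A m)) / 2"
  have e: "2 * e \<le> strip_width (strip A l)" "2 * e \<le> strip_width (strip A m)" "0 < e"
    using strip_lo_less_hi[OF is_strip_strip] l(1) m(1) by (auto simp: e_def strip_width_def)
  note fold = l(1) m(1) l(2) m(2) PQ[unfolded l(4) m(3)] e(1,2)
  let ?D = "I \<times> {-e<..<e}" and ?f = "qmap A \<circ> folded_collars A s l r m"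
  define W where "W = {w \<in> ?D. collar A s l w \<in> N} \<inter>
    {w \<in> ?D. collar A r m (xc (mate A (bd_point A s l (fst w))), snd w) \<in> M}"
  have "openin (top_of_set ?D) W"
    using openin_continuous_map_preimage[OF continuous_map_collars(1)[OF fold] N(1)]
      openin_continuous_map_preimage[OF continuous_map_collars(2)[OF fold] M(1)]
    unfolding W_def by (simp add: openin_Int)
  moreover have "open ?D"
    using l(3) by (intro open_Times open_greaterThanLessThan)
  ultimately have W: "open W" "W \<subseteq> ?D"
    by (rule openin_open_trans, auto simp: W_def)
  have "openin (Zsp A) (?f ` W)"
    by (intro continuous_inj_open_image_2manifold[OF manifold W(1)]
        continuous_map_from_subtopology_mono[OF continuous_map_folded_collars[OF fold] W(2)]
        inj_on_subset[OF inj_on_qmap_folded_collars[OF fold] W(2)])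
  moreover have "?f ` W \<subseteq> qmap A ` (N \<union> M)"
    by (auto simp: W_def folded_collars_def)
  moreover have "qmap A p \<in> ?f ` W"
  proof -
    obtain x where x: "x \<in> I" "p = bd_point A s l x"
      using p l(4) by blast
    then have "(x, 0) \<in> W"
      using N(2) M(2) e(3) mate_bd_point[OF fold x(1)] by (simp add: W_def)
    then show ?thesis
      using x(2) by (force simp: folded_collars_def)
  qed
  ultimately show thesis
    using that by blast
qed

lemma fibre_glued:
  assumes PQ: "glued A P Q" and p: "p \<in> P" and z: "z \<in> S0 A" and eq: "qmap A z = qmap A p"
  shows "z = p \<or> z = mate A p"
proof (rule ccontr)
  assume neq: "\<not> ?thesis"
  have p_in: "p \<in> S0 A" "mate A p \<in> S0 A"
    using H_subset_S0 glued_props(1)[OF PQ] p mate_in_S0 by blast+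
  obtain N1 M1 where sep1: "openin (S0top A) N1" "openin (S0top A) M1" "z \<in> N1" "p \<in> M1" "disjnt N1 M1"
    using S0_separation[OF z p_in(1)] neq by blast
  obtain N2 M2
    where sep2: "openin (S0top A) N2" "openin (S0top A) M2" "z \<in> N2" "mate A p \<in> M2" "disjnt N2 M2"
    using S0_separation[OF z p_in(2)] neq by blast
  obtain V where V: "openin (Zsp A) V" "qmap A p \<in> V" "V \<subseteq> qmap A ` (M1 \<union> M2)"
    using glued_chart[OF PQ p sep1(2,4) sep2(2,4)] by blast
  have N: "openin (S0top A) (N1 \<inter> N2)" "z \<in> N1 \<inter> N2"
    using sep1 sep2 by auto
  obtain v v' where v: "v \<in> N1 \<inter> N2" "v \<in> S0_interior A" "v' \<in> M1 \<union> M2" "qmap A v' = qmap A v"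
    using fibre_limit[OF V(1,3) z _ N] V(2) eq by metis
  have "v' \<in> S0 A"
    using v(3) openin_subset[OF sep1(2)] openin_subset[OF sep2(2)] by auto
  then have "v' = v"
    using fibre_S0_interior[OF v(2)] v(4) by blast
  then show False
    using v(1,3) sep1(5) sep2(5) unfolding disjnt_def by blast
qed

lemma qmap_eq_iff:
  assumes p: "p \<in> S0 A" and z: "z \<in> S0 A"
  shows "qmap A z = qmap A p \<longleftrightarrow> z = p \<or> z = mate A p"
proof
  assume eq: "qmap A z = qmap A p"
  consider (p_glued) P Q where "glued A P Q" "p \<in> P" | (z_glued) P Q where "glued A P Q" "z \<in> P"
    | (unglued) "\<And>P Q. glued A P Q \<Longrightarrow> p \<notin> P \<and> z \<notin> P"
    by blast
  then show "z = p \<or> z = mate A p"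
  proof cases
    case p_glued
    then show ?thesis
      using fibre_glued z eq by blast
  next
    case z_glued
    then have "p = z \<or> p = mate A z"
      using fibre_glued p eq[symmetric] by blast
    then show ?thesis
      using mate_mate by metis
  next
    case unglued
    then have "p \<notin> Xg A g \<union> Yg A g" "z \<notin> Xg A g \<union> Yg A g" if "g \<in> Gam A" for g
      using that glued_sym unfolding glued_def by blast+
    then show ?thesis
      using inj_onD[OF inj_on_unglued eq] p z by blast
  qed
next
  show "z = p \<or> z = mate A p \<Longrightarrow> qmap A z = qmap A p"
    using qmap_mate by blast
qed

end

section \<open>Families of strip homeomorphisms\<close>

lemma foliated_homeo_iff: "foliated_homeo T F T' F' f \<longleftrightarrow> homeomorphic_map T T' f \<and> (`) f ` F = F'"
proof -
  have "F' \<subseteq> (`) f ` F \<longleftrightarrow> (\<forall>L'\<in>F'. \<exists>L\<in>F. f ` L = L')"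
    by (simp add: subset_eq image_iff eq_commute)
  then show ?thesis
    by (simp add: foliated_homeo_def image_subset_iff set_eq_subset)
qed

lemma strip_leaf_nonempty:
  assumes "L \<in> strip_leaves S"
  shows "L \<noteq> {}"
proof -
  consider y where "L = UNIV \<times> {y}" | s where "L \<in> components (bd s S)"
    using assms by (auto simp: strip_leaves_eq)
  then show ?thesis
    by cases (simp, blast dest: in_components_nonempty)
qed

lemma S0_leaves_eq: "S0_leaves A = (\<Union>l\<in>Lam A. (\<lambda>L. {l} \<times> L) ` strip_leaves (strip A l))"
  by (auto simp: S0_leaves_def)

lemma d_eq_image: "d A s l = (\<lambda>B. {l} \<times> B) ` components (bd s (strip A l))"
  by (auto simp: d_def)

lemma induced_delta_eq:
  assumes S: "is_strip (strip A l)" and F: "strip_homeo \<delta> \<tau> (strip A l) T (\<lambda>p. snd (h (l, p)))"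
  shows "induced_delta A h l = \<delta>"
proof -
  have mono: "\<delta> * fst (snd (h (l, (a, y)))) < \<delta> * fst (snd (h (l, (b, y))))"
    if "strip_lo (strip A l) < y" "y < strip_hi (strip A l)" "a < b" for a b y
    using signed_mono_onD[OF strip_homeo_row_mono[OF F, of y], of "(a, y)" "(b, y)"] that
      mem_strip_iff[OF S]
    by simp
  obtain y where y: "strip_lo (strip A l) < y" "y < strip_hi (strip A l)"
    using strip_row_nonempty[OF S] by metis
  show ?thesis
  proof (cases "\<delta> = 1")
    case True
    then show ?thesis
      using mono by (simp add: induced_delta_def)
  next
    case False
    then have "\<delta> = -1"
      using strip_homeo_signs[OF F] by auto
    moreover from this have "\<not> fst (snd (h (l, (0, y)))) < fst (snd (h (l, (1, y))))"
      using mono[OF y, of 0 1] by simp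
    ultimately show ?thesis
      using y unfolding induced_delta_def by (metis zero_less_one)
  qed
qed

lemma induced_tau_eq:
  assumes S: "is_strip (strip A l)" and F: "strip_homeo \<delta> \<tau> (strip A l) T (\<lambda>p. snd (h (l, p)))"
  shows "induced_tau A h l = \<tau>"
proof -
  have mono: "\<tau> * snd (snd (h (l, p))) < \<tau> * snd (snd (h (l, q)))"
    if "p \<in> strip A l" "q \<in> strip A l" "snd p < snd q" for p q
    using signed_mono_onD[OF strip_homeo_height_mono[OF F] that] by simp
  obtain y where y: "strip_lo (strip A l) < y" "y < strip_hi (strip A l)"
    using strip_row_nonempty[OF S] by metis
  obtain z where z: "y < z" "z < strip_hi (strip A l)"
    using dense[OF y(2)] by blast
  have mem: "(0, y) \<in> strip A l" "(0, z) \<in> strip A l"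
    using mem_strip_iff[OF S] y z by auto
  show ?thesis
  proof (cases "\<tau> = 1")
    case True
    then show ?thesis
      using mono by (simp add: induced_tau_def)
  next
    case False
    then have "\<tau> = -1"
      using strip_homeo_signs[OF F] by auto
    moreover from this have "\<not> snd (snd (h (l, (0, y)))) < snd (snd (h (l, (0, z))))"
      using mono[OF mem] z(1) by simp
    ultimately show ?thesis
      using mem z(1) unfolding induced_tau_def by (metis snd_conv)
  qed
qed

locale striped_pair = A: striped A + B: striped B
  for A :: "('i, 'g, 'z, 'm) striped_atlas_scheme" and B :: "('j, 'h, 'w, 'n) striped_atlas_scheme"

locale strip_family_homeo = striped_pair A B
  for A :: "('i, 'g, 'z, 'm) striped_atlas_scheme" and B :: "('j, 'h, 'w, 'n) striped_atlas_scheme" +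
  fixes h :: "'i \<times> (real \<times> real) \<Rightarrow> 'j \<times> (real \<times> real)" and \<nu> :: "'i \<Rightarrow> 'j" and \<delta> \<tau> :: "'i \<Rightarrow> int"
  assumes bij_\<nu>: "bij_betw \<nu> (Lam A) (Lam B)"
    and fst_h: "\<And>l p. l \<in> Lam A \<Longrightarrow> p \<in> strip A l \<Longrightarrow> fst (h (l, p)) = \<nu> l"
    and strip_homeo_h: "\<And>l. l \<in> Lam A \<Longrightarrow>
      strip_homeo (\<delta> l) (\<tau> l) (strip A l) (strip B (\<nu> l)) (\<lambda>p. snd (h (l, p)))"
begin

lemma \<nu>_in: "l \<in> Lam A \<Longrightarrow> \<nu> l \<in> Lam B"
  using bij_\<nu> by (auto simp: bij_betw_def)

lemma strips: "l \<in> Lam A \<Longrightarrow> is_strip (strip A l)" "l \<in> Lam A \<Longrightarrow> is_strip (strip B (\<nu> l))"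
  using A.is_strip_strip B.is_strip_strip \<nu>_in by blast+

lemma sign_values: "l \<in> Lam A \<Longrightarrow> \<delta> l \<in> {-1, 1}" "l \<in> Lam A \<Longrightarrow> \<tau> l \<in> {-1, 1}"
  using strip_homeo_signs[OF strip_homeo_h] by blast+

lemma h_eq: "l \<in> Lam A \<Longrightarrow> p \<in> strip A l \<Longrightarrow> h (l, p) = (\<nu> l, snd (h (l, p)))"
  using fst_h by (metis prod.collapse)

lemma image_slice:
  assumes l: "l \<in> Lam A" and M: "M \<subseteq> strip A l"
  shows "h ` ({l} \<times> M) = {\<nu> l} \<times> (\<lambda>p. snd (h (l, p))) ` M"
proof -
  have "h ` ({l} \<times> M) = (\<lambda>p. h (l, p)) ` M"
    by auto
  also have "\<dots> = (\<lambda>p. (\<nu> l, snd (h (l, p)))) ` M"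
    using h_eq[OF l] M by (intro image_cong) auto
  finally show ?thesis
    by auto
qed

lemma image_strip: "l \<in> Lam A \<Longrightarrow> h ` ({l} \<times> strip A l) = {\<nu> l} \<times> strip B (\<nu> l)"
  using image_slice strip_homeo_image[OF strip_homeo_h] by simp

lemma homeomorphic_map_h: "homeomorphic_map (S0top A) (S0top B) h"
proof (rule homeomorphic_map_eq)
  show "homeomorphic_map (S0top A) (S0top B) (\<lambda>(l, p). (\<nu> l, snd (h (l, p))))"
    unfolding S0top_eq_sum_topology
    by (rule homeomorphic_map_sum_topology[OF bij_\<nu>]) (use strip_homeo_h in \<open>simp add: strip_homeo_def\<close>)
  show "(\<lambda>(l, p). (\<nu> l, snd (h (l, p)))) x = h x" if "x \<in> topspace (S0top A)" for x
    using that h_eq by (auto simp: S0_def)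
qed

lemma h_in_S0: "p \<in> S0 A \<Longrightarrow> h p \<in> S0 B"
  and inj_on_h: "inj_on h (S0 A)"
  using homeomorphic_map_h by (auto simp: homeomorphic_eq_everything_map)

lemma h_S0_interior:
  assumes "p \<in> S0_interior A"
  shows "h p \<in> S0_interior B"
proof -
  obtain l z where z: "p = (l, z)" "l \<in> Lam A" "z \<in> interior (strip A l)"
    using assms by (auto simp: S0_interior_def)
  then have "snd (h p) \<in> interior (strip B (\<nu> l))" "fst (h p) = \<nu> l"
    using strip_homeo_interior[OF strip_homeo_h[OF z(2)]] fst_h interior_subset by blast+
  then show ?thesis
    using \<nu>_in[OF z(2)]
    by (simp add: S0_interior_def mem_Sigma_iff[of "fst (h p)" "snd (h p)", simplified])
qed

lemma image_d:
  assumes l: "l \<in> Lam A" and s: "s \<in> {-1, 1}"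
  shows "(`) h ` d A s l = d B (\<tau> l * s) (\<nu> l)"
proof -
  have "h ` ({l} \<times> C) = {\<nu> l} \<times> (\<lambda>p. snd (h (l, p))) ` C" if "C \<in> components (bd s (strip A l))" for C
    using in_components_subset[OF that] by (intro image_slice[OF l]) (auto simp: bd_def split: if_splits)
  then show ?thesis
    unfolding d_eq_image strip_homeo_components_bd[OF strip_homeo_h[OF l] strips[OF l] s] image_image
    by (intro image_cong refl)
qed

lemma bij_betw_image_H: "bij_betw ((`) h) (H A) (H B)"
proof (rule bij_betw_imageI)
  show "inj_on ((`) h) (H A)"
    using inj_on_image_eq_iff[OF inj_on_h] A.H_subset_S0 by (intro inj_onI) blast
  have "(\<Union>s\<in>{-1, 1}. d B (\<tau> l * s) (\<nu> l)) = (\<Union>s\<in>{-1, 1}. d B s (\<nu> l))" if "l \<in> Lam A" for l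
    using sign_values(2)[OF that] by auto
  then have "(`) h ` H A = (\<Union>m\<in>\<nu> ` Lam A. \<Union>s\<in>{-1, 1}. d B s m)"
    unfolding H_eq image_UN using image_d by simp
  also have "\<dots> = H B"
    by (simp only: H_eq bij_betw_imp_surj_on[OF bij_\<nu>])
  finally show "(`) h ` H A = H B" .
qed

lemma h_signed_mono_on:
  assumes l: "l \<in> Lam A"
  shows "signed_mono_on (\<delta> l) (\<Union> (d A s l)) xc (xc \<circ> h)"
  unfolding Union_d signed_mono_on_image
proof (rule signed_mono_onI[OF sign_values(1)[OF l]])
  fix x y assume "x \<in> bd_trace s (strip A l)" "y \<in> bd_trace s (strip A l)"
    "(xc \<circ> bd_point A s l) x < (xc \<circ> bd_point A s l) y"
  then show "\<delta> l * (xc \<circ> h \<circ> bd_point A s l) x < \<delta> l * (xc \<circ> h \<circ> bd_point A s l) y"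
    using signed_mono_onD[OF strip_homeo_row_mono[OF strip_homeo_h[OF l], of "bd_height s (strip A l)"],
        of "(x, bd_height s (strip A l))" "(y, bd_height s (strip A l))"]
    by (simp add: bd_point_def xc_def bd_trace_def)
qed

lemma image_S0_leaves: "(`) h ` S0_leaves A = S0_leaves B"
proof -
  have "(`) h ` (\<lambda>L. {l} \<times> L) ` strip_leaves (strip A l)
      = (\<lambda>L. {\<nu> l} \<times> L) ` strip_leaves (strip B (\<nu> l))"
    if l: "l \<in> Lam A" for l
    using image_slice[OF l] strip_leaf_subset[OF strips(1)[OF l]]
    unfolding strip_homeo_image_leaves[OF strip_homeo_h[OF l] strips[OF l], symmetric] image_image
    by (intro image_cong refl) blast
  then have "(`) h ` S0_leaves A = (\<Union>m\<in>\<nu> ` Lam A. (\<lambda>L. {m} \<times> L) ` strip_leaves (strip B m))"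
    by (simp add: S0_leaves_eq image_UN)
  also have "\<dots> = S0_leaves B"
    by (simp only: S0_leaves_eq bij_betw_imp_surj_on[OF bij_\<nu>])
  finally show ?thesis .
qed

lemma induced_nu_h:
  assumes l: "l \<in> Lam A"
  shows "induced_nu A B h l = \<nu> l"
  unfolding induced_nu_def
proof (rule the_equality)
  show "\<nu> l \<in> Lam B \<and> h ` ({l} \<times> strip A l) = {\<nu> l} \<times> strip B (\<nu> l)"
    using \<nu>_in image_strip l by simp
  fix m assume "m \<in> Lam B \<and> h ` ({l} \<times> strip A l) = {m} \<times> strip B m"
  then have "{m} \<times> strip B m = {\<nu> l} \<times> strip B (\<nu> l)"
    using image_strip[OF l] by simp
  moreover have "strip B (\<nu> l) \<noteq> {}"
    using strip_nonempty[OF strips(2)[OF l]] .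
  ultimately show "m = \<nu> l"
    by blast
qed

lemma induced_signs_h:
  assumes "l \<in> Lam A"
  shows "induced_delta A h l = \<delta> l" "induced_tau A h l = \<tau> l"
  using induced_delta_eq[OF strips(1)[OF assms] strip_homeo_h[OF assms]]
    induced_tau_eq[OF strips(1)[OF assms] strip_homeo_h[OF assms]] .

context
  assumes commutes: "\<And>p. p \<in> S0 A \<Longrightarrow> h (mate A p) = mate B (h p)"
begin

lemma xi_image:
  assumes P: "P \<in> H A"
  shows "xi B (h ` P) = h ` xi A P"
proof -
  have "xi B (h ` P) = mate B ` h ` P"
    using B.mate_image bij_betw_image_H P by (metis bij_betw_apply)
  also have "\<dots> = h ` mate A ` P"
    unfolding image_image using commutes A.H_subset_S0[OF P] by (intro image_cong refl) (metis subsetD)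
  finally show ?thesis
    by (simp add: A.mate_image[OF P])
qed

lemma sigma_image:
  assumes P: "P \<in> d A s l" "l \<in> Lam A" "s \<in> {-1, 1}" and Q: "xi A P \<in> d A r m" "m \<in> Lam A" "r \<in> {-1, 1}"
    and PQ: "xi A P \<noteq> P"
  shows "\<delta> l * sigma A P (xi A P) = sigma B (h ` P) (h ` xi A P) * \<delta> m"
proof -
  let ?Q = "xi A P"
  have PH: "P \<in> H A" "?Q \<in> H A"
    using P Q by (auto simp: H_eq)
  have glued: "glued A P ?Q"
    using PQ by (simp add: A.glued_iff_xi)
  have "h ` P \<noteq> h ` ?Q"
    using bij_betw_imp_inj_on[OF bij_betw_image_H] PH PQ by (metis inj_onD)
  then have glued_h: "glued B (h ` P) (h ` ?Q)"
    using xi_image[OF PH(1)] by (simp add: B.glued_iff_xi)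
  have via_B: "signed_mono_on (\<delta> l * sigma B (h ` P) (h ` ?Q)) P xc (xc \<circ> mate B \<circ> h)"
  proof (rule signed_mono_on_trans)
    show "signed_mono_on (\<delta> l) P xc (xc \<circ> h)"
      using P(1) by (intro signed_mono_on_subset[OF h_signed_mono_on[OF P(2)]]) blast
    show "signed_mono_on (sigma B (h ` P) (h ` ?Q)) P (xc \<circ> h) (xc \<circ> mate B \<circ> h)"
      using B.mate_signed_mono_on[OF glued_h] by (simp add: signed_mono_on_image)
  qed
  have via_A: "signed_mono_on (sigma A P ?Q * \<delta> m) P xc (xc \<circ> h \<circ> mate A)"
  proof (rule signed_mono_on_trans[OF A.mate_signed_mono_on[OF glued]])
    have "mate A ` P \<subseteq> \<Union> (d A r m)"
      using A.mate_image[OF PH(1)] Q(1) by blast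
    from signed_mono_on_subset[OF h_signed_mono_on[OF Q(2)] this]
    show "signed_mono_on (\<delta> m) P (xc \<circ> mate A) (xc \<circ> h \<circ> mate A)"
      by (simp add: signed_mono_on_image)
  qed
  have "signed_mono_on (sigma A P ?Q * \<delta> m) P xc (xc \<circ> mate B \<circ> h)"
    using via_A by (rule signed_mono_on_cong[THEN iffD1, rotated -1])
      (use commutes A.H_subset_S0[OF PH(1)] in auto)
  moreover obtain a b where "a \<in> P" "b \<in> P" "xc a < xc b"
    using PH(1) by (rule A.H_nontrivial)
  ultimately have "\<delta> l * sigma B (h ` P) (h ` ?Q) = sigma A P ?Q * \<delta> m"
    using via_B signed_mono_on_unique by metis
  then show ?thesis
    using sign_values(1)[OF P(2)] sign_values(1)[OF Q(2)]
      signed_mono_on_sign[OF A.mate_signed_mono_on[OF glued]]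
      signed_mono_on_sign[OF B.mate_signed_mono_on[OF glued_h]] by auto
qed

lemma is_graph_iso_h: "is_graph_iso A B \<nu> ((`) h) \<delta> \<tau>"
  unfolding is_graph_iso_def
proof (intro conjI ballI impI)
  show "bij_betw \<nu> (Lam A) (Lam B)" "bij_betw ((`) h) (H A) (H B)"
    by (fact bij_\<nu> bij_betw_image_H)+
  show "xi B (h ` P) = h ` xi A P" if "P \<in> H A" for P
    using xi_image[OF that] .
  show "\<delta> l * sigma A P (xi A P) = sigma B (h ` P) (h ` xi A P) * \<delta> m"
    if "P \<in> H A" "xi A P \<noteq> P" "l \<in> Lam A" "m \<in> Lam A" "P \<in> dall A l" "xi A P \<in> dall A m" for P l m
    using sigma_image that unfolding dall_def by blast
next
  fix l assume l: "l \<in> Lam A"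
  show "\<delta> l \<in> {-1, 1}" "\<tau> l \<in> {-1, 1}"
    by (fact sign_values[OF l])+
  fix s :: int assume s: "s \<in> {-1, 1}"
  show "(`) h ` d A s l = d B (\<tau> l * s) (\<nu> l)"
    using image_d[OF l s] .
  fix P Q assume PQ: "P \<in> d A s l" "Q \<in> d A s l" "hlt P Q"
  have "\<delta> l * xc (h p) < \<delta> l * xc (h q)" if "p \<in> P" "q \<in> Q" for p q
    using signed_mono_onD[OF h_signed_mono_on[OF l, of s], of p q] PQ that by (auto simp: hlt_def)
  then show "\<delta> l = 1 \<Longrightarrow> hlt (h ` P) (h ` Q)" "\<delta> l = -1 \<Longrightarrow> hlt (h ` Q) (h ` P)"
    by (auto simp: hlt_def)
qed

lemma atlas_equiv_exists: "\<exists>k. atlas_equiv A B h k"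
proof -
  have quotient: "quotient_map (S0top A) (Zsp B) (qmap B \<circ> h)"
    using homeomorphic_map_h B.quotient unfolding homeomorphic_map_def
    by (blast intro: quotient_map_compose)
  have "qmap A p = qmap A z \<longleftrightarrow> (qmap B \<circ> h) p = (qmap B \<circ> h) z" if p: "p \<in> S0 A" and z: "z \<in> S0 A" for p z
  proof -
    have "(qmap B \<circ> h) p = (qmap B \<circ> h) z \<longleftrightarrow> h p = h z \<or> h p = h (mate A z)"
      using B.qmap_eq_iff[OF h_in_S0[OF z] h_in_S0[OF p]] commutes[OF z] by simp
    also have "\<dots> \<longleftrightarrow> p = z \<or> p = mate A z"
      using inj_on_eq_iff[OF inj_on_h] p z A.mate_in_S0[OF z] by blast
    finally show ?thesis
      by (simp add: A.qmap_eq_iff[OF z p])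
  qed
  then obtain k
    where k: "homeomorphic_map (Zsp A) (Zsp B) k" "\<And>p. p \<in> S0 A \<Longrightarrow> k (qmap A p) = qmap B (h p)"
    using quotient_maps_same_fibres[OF A.quotient quotient] by (auto simp: o_def)
  have "k ` qmap A ` L = qmap B ` h ` L" if "L \<in> S0_leaves A" for L
  proof -
    have "L \<subseteq> S0 A"
      using that strip_leaf_subset[OF A.is_strip_strip] by (auto simp: S0_leaves_eq S0_def)
    then show ?thesis
      unfolding image_image using k(2) by (intro image_cong refl) blast
  qed
  then have "(`) k ` Z_leaves A = (`) (qmap B) ` (`) h ` S0_leaves A"
    unfolding Z_leaves_def image_image by (rule image_cong[OF refl])
  then have "(`) k ` Z_leaves A = Z_leaves B"
    by (simp add: Z_leaves_def image_S0_leaves)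
  then show ?thesis
    using homeomorphic_map_h image_S0_leaves k by (auto simp: atlas_equiv_def foliated_homeo_iff)
qed

end

end

section \<open>The graph isomorphism induced by an equivalence\<close>

lemma (in striped) connected_components_S0top:
  "connected_components_of (S0top A) = (\<lambda>l. {l} \<times> strip A l) ` Lam A"
proof -
  have "connected_space (top_of_set (strip A l))" "topspace (top_of_set (strip A l)) \<noteq> {}"
    if "l \<in> Lam A" for l
    using connected_strip[OF is_strip_strip[OF that]] strip_nonempty[OF is_strip_strip[OF that]]
    by (simp_all add: connected_space_subtopology)
  then show ?thesis
    unfolding S0top_eq_sum_topology by (subst connected_components_of_sum_topology) simp_all
qed

context striped_pair
begin

lemma homeomorphic_map_strip_image:
  assumes h: "homeomorphic_map (S0top A) (S0top B) h" and l: "l \<in> Lam A"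
  shows "induced_nu A B h l \<in> Lam B"
    "h ` ({l} \<times> strip A l) = {induced_nu A B h l} \<times> strip B (induced_nu A B h l)"
proof -
  have "h ` ({l} \<times> strip A l) \<in> (\<lambda>m. {m} \<times> strip B m) ` Lam B"
    using homeomorphic_map_connected_components_of[OF h] l
    unfolding A.connected_components_S0top B.connected_components_S0top by blast
  then obtain m where m: "m \<in> Lam B" "h ` ({l} \<times> strip A l) = {m} \<times> strip B m"
    by blast
  moreover have "strip B m \<noteq> {}"
    using strip_nonempty[OF B.is_strip_strip[OF m(1)]] .
  ultimately have "induced_nu A B h l = m"
    unfolding induced_nu_def by (intro the_equality) blast+
  then show "induced_nu A B h l \<in> Lam B"
    "h ` ({l} \<times> strip A l) = {induced_nu A B h l} \<times> strip B (induced_nu A B h l)"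
    using m by simp_all
qed

lemma bij_betw_induced_nu:
  assumes h: "homeomorphic_map (S0top A) (S0top B) h"
  shows "bij_betw (induced_nu A B h) (Lam A) (Lam B)"
proof (rule bij_betw_imageI)
  let ?S = "\<lambda>l. {l} \<times> strip A l" and ?T = "\<lambda>m. {m} \<times> strip B m"
  have nonempty: "l \<in> Lam A \<Longrightarrow> strip A l \<noteq> {}" "m \<in> Lam B \<Longrightarrow> strip B m \<noteq> {}" for l m
    using strip_nonempty A.is_strip_strip B.is_strip_strip by blast+
  show "inj_on (induced_nu A B h) (Lam A)"
  proof (rule inj_onI)
    fix l l' assume l: "l \<in> Lam A" "l' \<in> Lam A" and "induced_nu A B h l = induced_nu A B h l'"
    then have "h ` ?S l = h ` ?S l'"
      using homeomorphic_map_strip_image[OF h] by simp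
    moreover have "?S l \<subseteq> S0 A" "?S l' \<subseteq> S0 A"
      using l by (auto simp: S0_def)
    ultimately have "?S l = ?S l'"
      using inj_on_image_eq_iff homeomorphic_imp_injective_map[OF h] by (metis topspace_S0top)
    then show "l = l'"
      using nonempty(1)[OF l(1)] by (simp add: times_eq_iff)
  qed
  have "m \<in> induced_nu A B h ` Lam A" if m: "m \<in> Lam B" for m
  proof -
    have "?T m \<in> (`) h ` ?S ` Lam A"
      using homeomorphic_map_connected_components_of[OF h] m
      unfolding A.connected_components_S0top B.connected_components_S0top by blast
    then obtain l where l: "l \<in> Lam A" "?T m = h ` ?S l"
      by blast
    then have "?T m = ?T (induced_nu A B h l)"
      using homeomorphic_map_strip_image(2)[OF h l(1)] by simp
    then show ?thesis
      using nonempty(2)[OF m] l(1) by (simp add: times_eq_iff)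
  qed
  then show "induced_nu A B h ` Lam A = Lam B"
    using homeomorphic_map_strip_image(1)[OF h] by blast
qed

lemma homeomorphic_map_slice:
  assumes h: "homeomorphic_map (S0top A) (S0top B) h" and l: "l \<in> Lam A" and m: "m \<in> Lam B"
    and image: "h ` ({l} \<times> strip A l) = {m} \<times> strip B m"
  shows "homeomorphic_map (top_of_set (strip A l)) (top_of_set (strip B m)) (\<lambda>p. snd (h (l, p)))"
proof -
  have "homeomorphic_map (top_of_set (strip A l)) (subtopology (S0top A) ({l} \<times> strip A l)) (Pair l)"
    using homeomorphic_maps_S0_summand[OF l] by (rule homeomorphic_maps_imp_map)
  moreover have "homeomorphic_map (subtopology (S0top A) ({l} \<times> strip A l))
      (subtopology (S0top B) ({m} \<times> strip B m)) h"
    using image l m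
    by (intro homeomorphic_map_subtopologies[OF h]) (simp add: S0_def Int_absorb1 subset_iff)
  moreover have "homeomorphic_map (subtopology (S0top B) ({m} \<times> strip B m)) (top_of_set (strip B m)) snd"
    using homeomorphic_maps_S0_summand[OF m] homeomorphic_maps_imp_map homeomorphic_maps_sym by blast
  ultimately have
    "homeomorphic_map (top_of_set (strip A l)) (top_of_set (strip B m)) (snd \<circ> (h \<circ> Pair l))"
    by (meson homeomorphic_map_compose)
  then show ?thesis
    by (simp add: o_def)
qed

lemma slice_strip_leaf:
  assumes leaves: "\<And>L. L \<in> S0_leaves A \<Longrightarrow> h ` L \<in> S0_leaves B" and l: "l \<in> Lam A"
    and image: "h ` ({l} \<times> strip A l) = {m} \<times> strip B m" and L: "L \<in> strip_leaves (strip A l)"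
  shows "(\<lambda>p. snd (h (l, p))) ` L \<in> strip_leaves (strip B m)"
proof -
  have "h ` ({l} \<times> L) \<in> S0_leaves B"
    using L l by (intro leaves) (auto simp: S0_leaves_eq)
  then obtain m' L' where L': "L' \<in> strip_leaves (strip B m')" "h ` ({l} \<times> L) = {m'} \<times> L'"
    by (auto simp: S0_leaves_eq)
  obtain p where "p \<in> L"
    using strip_leaf_nonempty[OF L] by blast
  then have "h (l, p) \<in> {m'} \<times> L'" "h (l, p) \<in> {m} \<times> strip B m"
    using L'(2) image strip_leaf_subset[OF A.is_strip_strip[OF l] L] by blast+
  then have "m' = m"
    by auto
  moreover have "(\<lambda>p. snd (h (l, p))) ` L = snd ` h ` ({l} \<times> L)"
    by (auto simp: image_image image_iff)
  then have "(\<lambda>p. snd (h (l, p))) ` L = L'"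
    using L'(2) by simp
  ultimately show ?thesis
    using L'(1) by simp
qed

lemma foliated_homeo_strip_family:
  assumes h: "foliated_homeo (S0top A) (S0_leaves A) (S0top B) (S0_leaves B) h"
  shows "strip_family_homeo A B h (induced_nu A B h) (induced_delta A h) (induced_tau A h)"
proof
  let ?\<nu> = "induced_nu A B h"
  have homeo: "homeomorphic_map (S0top A) (S0top B) h"
    and leaves: "\<And>L. L \<in> S0_leaves A \<Longrightarrow> h ` L \<in> S0_leaves B"
    using h by (auto simp: foliated_homeo_def)
  show "bij_betw ?\<nu> (Lam A) (Lam B)"
    by (rule bij_betw_induced_nu[OF homeo])
  fix l assume l: "l \<in> Lam A"
  note image = homeomorphic_map_strip_image[OF homeo l]
  show "fst (h (l, p)) = ?\<nu> l" if "p \<in> strip A l" for p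
  proof -
    have "h (l, p) \<in> {?\<nu> l} \<times> strip B (?\<nu> l)"
      using image(2) that by blast
    then show ?thesis
      by auto
  qed
  let ?F = "\<lambda>p. snd (h (l, p))"
  have strips: "is_strip (strip A l)" "is_strip (strip B (?\<nu> l))"
    using A.is_strip_strip[OF l] B.is_strip_strip[OF image(1)] .
  obtain G where "homeomorphism (strip A l) (strip B (?\<nu> l)) ?F G"
    using homeomorphic_map_slice[OF homeo l image] by (auto simp: homeomorphic_map_top_of_set)
  then obtain \<delta> \<tau> where F: "strip_homeo \<delta> \<tau> (strip A l) (strip B (?\<nu> l)) ?F"
    using foliated_homeomorphism_strip_homeo[OF strips] slice_strip_leaf[OF leaves l image(2)] by blast
  then show "strip_homeo (induced_delta A h l) (induced_tau A h l) (strip A l) (strip B (?\<nu> l)) ?F"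
    using induced_delta_eq[of A l _ _ _ h, OF strips(1) F] induced_tau_eq[of A l _ _ _ h, OF strips(1) F]
    by simp
qed

lemma equivalence_commutes_mate:
  assumes equiv: "atlas_equiv A B h k" and p: "p \<in> S0 A"
  shows "h (mate A p) = mate B (h p)"
proof -
  have homeo: "homeomorphic_map (S0top A) (S0top B) h" "homeomorphic_map (Zsp A) (Zsp B) k"
    and qmap_h: "\<And>p. p \<in> S0 A \<Longrightarrow> qmap B (h p) = k (qmap A p)"
    using equiv by (auto simp: atlas_equiv_def foliated_homeo_def)
  have h: "inj_on h (S0 A)" "h ` S0 A = S0 B"
    using homeo(1) by (auto simp: homeomorphic_eq_everything_map)
  have qmap_h_eq_iff: "qmap B (h z) = qmap B (h p) \<longleftrightarrow> qmap A z = qmap A p" if "z \<in> S0 A" for z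
  proof -
    have "qmap A z \<in> topspace (Zsp A)" "qmap A p \<in> topspace (Zsp A)"
      using A.continuous_qmap that p by (auto simp: continuous_map_def)
    then show ?thesis
      using inj_on_eq_iff[OF homeomorphic_imp_injective_map[OF homeo(2)]] qmap_h that p by simp
  qed
  have hp: "h p \<in> S0 B"
    using h(2) p by blast
  have "mate B (h p) \<in> S0 B"
    using hp by (rule B.mate_in_S0)
  then obtain z where z: "z \<in> S0 A" "h z = mate B (h p)"
    using h(2) by (metis imageE)
  then have "qmap A z = qmap A p"
    using qmap_h_eq_iff[OF z(1)] B.qmap_mate by simp
  then have z_cases: "z = p \<or> z = mate A p"
    using A.qmap_eq_iff[OF p z(1)] by blast
  have "qmap B (h (mate A p)) = qmap B (h p)"
    using qmap_h_eq_iff[OF A.mate_in_S0[OF p]] A.qmap_mate by simp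
  then have "h (mate A p) = h p \<or> h (mate A p) = mate B (h p)"
    using B.qmap_eq_iff[OF hp] h(2) A.mate_in_S0[OF p] by blast
  then show ?thesis
    using z z_cases inj_onD[OF h(1) _ A.mate_in_S0[OF p] p] by metis
qed

theorem atlas_equiv_induces_graph_iso:
  assumes equiv: "atlas_equiv A B h k"
  shows "is_graph_iso A B (induced_nu A B h) (\<lambda>P. h ` P) (induced_delta A h) (induced_tau A h)"
proof -
  interpret strip_family_homeo A B h "induced_nu A B h" "induced_delta A h" "induced_tau A h"
    using equiv by (intro foliated_homeo_strip_family) (simp add: atlas_equiv_def)
  show ?thesis
    using equivalence_commutes_mate[OF equiv] by (rule is_graph_iso_h)
qed

end

section \<open>The equivalence realizing a graph isomorphism\<close>

definition vertex :: "('i \<times> (real \<times> real)) set \<Rightarrow> 'i" where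
  "vertex P = the_elem (fst ` P)"

lemma disjoint_connected_real_less:
  fixes I J :: "real set"
  assumes I: "connected I" "a \<in> I" "x \<in> I" and J: "connected J" "b \<in> J" "y \<in> J"
    and disj: "I \<inter> J = {}" and "a < b"
  shows "x < y"
proof (rule ccontr)
  assume "\<not> x < y"
  then consider "a \<le> y" "y \<le> x" | "y \<le> a" "a \<le> b"
    using \<open>a < b\<close> by linarith
  then show False
    using connectedD_interval[OF I, of y] connectedD_interval[OF J(1,3,2), of a] I(2) J(3) disj
    by cases blast+
qed

context striped
begin

lemma vertex_eq:
  assumes l: "l \<in> Lam A" and P: "P \<in> d A s l"
  shows "vertex P = l"
proof -
  obtain I where "I \<noteq> {}" "P = bd_point A s l ` I"
    using l P by (rule d_cases)
  then have "fst ` P = {l}"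
    by (simp add: bd_point_def image_image image_constant_conv)
  then show ?thesis
    by (simp add: vertex_def)
qed

lemma d_hlt:
  assumes PQ: "P \<in> d A s l" "Q \<in> d A s l" "P \<noteq> Q"
    and ab: "a \<in> P" "b \<in> Q" "xc a < xc b"
  shows "hlt P Q"
proof -
  obtain I J where I: "I \<in> components (bd_trace s (strip A l))" "P = bd_point A s l ` I"
    and J: "J \<in> components (bd_trace s (strip A l))" "Q = bd_point A s l ` J"
    using PQ by (auto simp: d_eq_components)
  then have "I \<inter> J = {}"
    using components_nonoverlap PQ(3) by blast
  then show ?thesis
    using disjoint_connected_real_less[OF in_components_connected[OF I(1)] _ _
      in_components_connected[OF J(1)]]
      ab I(2) J(2) by (fastforce simp: hlt_def)
qed

lemma Yg_xi:
  assumes "glued A P Q"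
  shows "P \<in> Yg A ` Gam A \<longleftrightarrow> Q \<notin> Yg A ` Gam A"
proof -
  have "Xg A ` Gam A \<inter> Yg A ` Gam A = {}"
    using atlas by (simp add: is_striped_atlas_def)
  then show ?thesis
    using assms by (auto simp: glued_def doubleton_eq_iff)
qed

end

locale graph_iso = striped_pair A B
  for A :: "('i, 'g, 'z, 'm) striped_atlas_scheme" and B :: "('j, 'h, 'w, 'n) striped_atlas_scheme" +
  fixes \<nu> :: "'i \<Rightarrow> 'j" and \<eta> :: "('i \<times> (real \<times> real)) set \<Rightarrow> ('j \<times> (real \<times> real)) set"
    and \<delta> \<tau> :: "'i \<Rightarrow> int"
  assumes iso: "is_graph_iso A B \<nu> \<eta> \<delta> \<tau>"
begin

lemma bij_\<nu>: "bij_betw \<nu> (Lam A) (Lam B)"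
  and bij_\<eta>: "bij_betw \<eta> (H A) (H B)"
  using iso by (simp_all add: is_graph_iso_def)

lemma sign_values: "l \<in> Lam A \<Longrightarrow> \<delta> l \<in> {-1, 1}" "l \<in> Lam A \<Longrightarrow> \<tau> l \<in> {-1, 1}"
  using iso by (simp_all add: is_graph_iso_def)

lemma \<eta>_d: "l \<in> Lam A \<Longrightarrow> s \<in> {-1, 1} \<Longrightarrow> \<eta> ` d A s l = d B (\<tau> l * s) (\<nu> l)"
  using iso by (cases "s = 1") (simp_all add: is_graph_iso_def)

lemma \<eta>_xi: "P \<in> H A \<Longrightarrow> xi B (\<eta> P) = \<eta> (xi A P)"
  using iso by (simp add: is_graph_iso_def)

lemma \<eta>_hlt:
  assumes "l \<in> Lam A" "s \<in> {-1, 1}" "P \<in> d A s l" "Q \<in> d A s l" "hlt P Q" "p \<in> \<eta> P" "q \<in> \<eta> Q"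
  shows "\<delta> l * xc p < \<delta> l * xc q"
proof -
  have "(\<delta> l = 1 \<longrightarrow> hlt (\<eta> P) (\<eta> Q)) \<and> (\<delta> l = -1 \<longrightarrow> hlt (\<eta> Q) (\<eta> P))"
    using iso assms(1-5) by (auto simp: is_graph_iso_def)
  then show ?thesis
    using sign_values(1)[OF assms(1)] assms(6,7) by (auto simp: hlt_def)
qed

lemma \<nu>_in: "l \<in> Lam A \<Longrightarrow> \<nu> l \<in> Lam B"
  using bij_\<nu> by (rule bij_betw_apply)

lemma \<eta>_in: "P \<in> H A \<Longrightarrow> \<eta> P \<in> H B"
  using bij_\<eta> by (rule bij_betw_apply)

lemma sigma_\<eta>:
  assumes P: "P \<in> H A" and PQ: "glued A P Q"
  shows "\<delta> (vertex P) * sigma A P Q = sigma B (\<eta> P) (\<eta> Q) * \<delta> (vertex Q)"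
proof -
  have Q: "xi A P = Q" "xi A P \<noteq> P" "Q \<in> H A"
    using A.glued_iff_xi[of P Q] A.glued_props(2)[OF PQ] PQ by auto
  obtain l s where l: "l \<in> Lam A" "s \<in> {-1, 1}" "P \<in> d A s l"
    using P by (rule A.H_cases)
  obtain m r where m: "m \<in> Lam A" "r \<in> {-1, 1}" "Q \<in> d A r m"
    using Q(3) by (rule A.H_cases)
  have "P \<in> dall A l" "xi A P \<in> dall A m"
    using l m Q(1) by (auto simp: dall_def)
  then have "\<delta> l * sigma A P (xi A P) = sigma B (\<eta> P) (\<eta> (xi A P)) * \<delta> m"
    using iso P Q(2) l(1) m(1) by (simp add: is_graph_iso_def)
  then show ?thesis
    using A.vertex_eq l m Q(1) by simp
qed

definition edge_iso :: "('i \<times> (real \<times> real)) set \<Rightarrow> ('i \<times> (real \<times> real) \<Rightarrow> 'j \<times> (real \<times> real)) \<Rightarrow> bool"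
  where
  "edge_iso P f \<longleftrightarrow> f ` P = \<eta> P \<and> signed_mono_on (\<delta> (vertex P)) P xc (xc \<circ> f)"

lemma edge_iso_cong: "(\<And>p. p \<in> P \<Longrightarrow> f p = g p) \<Longrightarrow> edge_iso P f \<longleftrightarrow> edge_iso P g"
  by (simp add: edge_iso_def signed_mono_on_def cong: image_cong)

lemma edge_iso_exists:
  assumes P: "P \<in> H A"
  shows "\<exists>f. edge_iso P f"
proof -
  obtain l s I where l: "l \<in> Lam A" "P \<in> d A s l"
    and I: "open I" "connected I" "I \<noteq> {}" "P = bd_point A s l ` I"
    using P by (rule A.H_cases)
  obtain m r J where J: "open J" "connected J" "J \<noteq> {}" "\<eta> P = bd_point B r m ` J"
    using \<eta>_in[OF P] by (rule B.H_cases)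
  obtain g where g: "g ` I = J" "signed_mono_on (\<delta> l) I (\<lambda>x. x) g"
    using open_interval_signed_iso[OF I(1-3) J(1-3) sign_values(1)[OF l(1)]] .
  have "(bd_point B r m \<circ> g \<circ> xc) ` P = \<eta> P"
    unfolding J(4) g(1)[symmetric] by (simp add: I(4) image_image)
  moreover have "signed_mono_on (\<delta> l) P xc (xc \<circ> (bd_point B r m \<circ> g \<circ> xc))"
    unfolding I(4) signed_mono_on_image using g(2) by (simp add: o_def)
  ultimately show ?thesis
    unfolding edge_iso_def A.vertex_eq[OF l] by blast
qed

lemma edge_iso_mate:
  assumes PQ: "glued A P Q" and f: "edge_iso Q f"
  shows "edge_iso P (mate B \<circ> f \<circ> mate A)"
proof -
  have H: "P \<in> H A" "Q \<in> H A" and xi: "xi A P = Q" "xi A Q = P"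
    using A.glued_props(1,2)[OF PQ] A.xi_eq_glued PQ glued_sym by blast+
  have mate_P: "mate A ` P = Q"
    using A.mate_image[OF H(1)] xi(1) by simp
  have f_image: "f ` Q = \<eta> Q"
    using f by (simp add: edge_iso_def)
  have "\<eta> P \<noteq> \<eta> Q"
    using bij_\<eta> H A.glued_props(3)[OF PQ] by (metis bij_betw_imp_inj_on inj_onD)
  then have glued_\<eta>: "glued B (\<eta> Q) (\<eta> P)"
    using \<eta>_xi[OF H(2)] xi(2) by (simp add: B.glued_iff_xi)
  have "signed_mono_on (sigma A P Q * \<delta> (vertex Q) * sigma B (\<eta> Q) (\<eta> P)) P xc
      (xc \<circ> (mate B \<circ> f \<circ> mate A))"
  proof (rule signed_mono_on_trans[OF signed_mono_on_trans[OF A.mate_signed_mono_on[OF PQ]]])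
    show "signed_mono_on (\<delta> (vertex Q)) P (xc \<circ> mate A) (xc \<circ> f \<circ> mate A)"
      using f mate_P unfolding edge_iso_def by (metis signed_mono_on_image)
    have "signed_mono_on (sigma B (\<eta> Q) (\<eta> P)) (f ` mate A ` P) xc (xc \<circ> mate B)"
      using B.mate_signed_mono_on[OF glued_\<eta>] by (simp add: mate_P f_image)
    then show "signed_mono_on (sigma B (\<eta> Q) (\<eta> P)) P (xc \<circ> f \<circ> mate A) (xc \<circ> (mate B \<circ> f \<circ> mate A))"
      by (simp add: signed_mono_on_image comp_assoc)
  qed
  moreover have "\<delta> (vertex P) = sigma A P Q * \<delta> (vertex Q) * sigma B (\<eta> Q) (\<eta> P)"
    using sigma_\<eta>[OF H(1) PQ] signed_mono_on_sign[OF A.mate_signed_mono_on[OF PQ]]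
      sigma_commute[of B "\<eta> P"]
    by (auto simp: mult_ac)
  moreover have "(mate B \<circ> f \<circ> mate A) ` P = \<eta> P"
    unfolding image_comp[symmetric] mate_P f_image
    using B.mate_image[OF \<eta>_in[OF H(2)]] B.xi_eq_glued[OF glued_\<eta>] by simp
  ultimately show ?thesis
    by (simp add: edge_iso_def)
qed

text \<open>The maps may be chosen freely on the intervals that are not of the form \<open>Y\<^sub>\<gamma>\<close>; on the latter
  compatibility with the gluing leaves no choice.\<close>

lemma edge_isos_exist:
  obtains f where "\<And>P. P \<in> H A \<Longrightarrow> edge_iso P (f P)"
    "\<And>P p. P \<in> H A \<Longrightarrow> p \<in> P \<Longrightarrow> f (xi A P) (mate A p) = mate B (f P p)"
proof -
  obtain g where g: "\<And>P. P \<in> H A \<Longrightarrow> edge_iso P (g P)"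
    using edge_iso_exists by metis
  define f where "f P = (if P \<in> Yg A ` Gam A then mate B \<circ> g (xi A P) \<circ> mate A else g P)" for P
  have f: "edge_iso P (f P)" if P: "P \<in> H A" for P
  proof (cases "P \<in> Yg A ` Gam A")
    case True
    then obtain Q where Q: "glued A P Q"
      by (auto simp: glued_def insert_commute)
    then show ?thesis
      using edge_iso_mate[OF Q] g A.glued_props(2)[OF Q] A.xi_eq_glued[OF Q] True by (simp add: f_def)
  qed (simp add: f_def g P)
  moreover have "f (xi A P) (mate A p) = mate B (f P p)" if P: "P \<in> H A" and p: "p \<in> P" for P p
  proof (cases "xi A P = P")
    case True
    then have "f P p \<in> \<eta> P" "xi B (\<eta> P) = \<eta> P"
      using f[OF P] p \<eta>_xi[OF P] by (auto simp: edge_iso_def)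
    then show ?thesis
      using A.mate_xi_fixed[OF P True p] B.mate_xi_fixed[OF \<eta>_in[OF P]] True by simp
  next
    case False
    then have glued: "glued A P (xi A P)"
      by (simp add: A.glued_iff_xi)
    then have "xi A (xi A P) = P"
      using A.xi_eq_glued glued_sym by blast
    then show ?thesis
      using A.Yg_xi[OF glued] A.mate_mate B.mate_mate by (simp add: f_def)
  qed
  ultimately show thesis
    by (rule that)
qed

lemma boundary_map_exists:
  obtains b where "\<And>P. P \<in> H A \<Longrightarrow> edge_iso P b" "\<And>P p. P \<in> H A \<Longrightarrow> p \<in> P \<Longrightarrow> b (mate A p) = mate B (b p)"
proof -
  obtain f where f: "\<And>P. P \<in> H A \<Longrightarrow> edge_iso P (f P)"
    "\<And>P p. P \<in> H A \<Longrightarrow> p \<in> P \<Longrightarrow> f (xi A P) (mate A p) = mate B (f P p)"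
    using edge_isos_exist by blast
  define b where "b p = f (THE P. P \<in> H A \<and> p \<in> P) p" for p
  have b: "b p = f P p" if "P \<in> H A" "p \<in> P" for P p
  proof -
    have "(THE P. P \<in> H A \<and> p \<in> P) = P"
      using that A.H_disjoint by (intro the_equality) blast+
    then show ?thesis
      by (simp add: b_def)
  qed
  have "edge_iso P b" if "P \<in> H A" for P
    using f(1)[OF that] edge_iso_cong[of P b "f P"] b[OF that] by blast
  moreover have "b (mate A p) = mate B (b p)" if P: "P \<in> H A" and p: "p \<in> P" for P p
  proof -
    have "mate A p \<in> xi A P"
      using A.mate_image[OF P] p by blast
    then show ?thesis
      using f(2)[OF P p] b[OF A.xi_in_H[OF P]] b[OF P p] by simp
  qed
  ultimately show thesis
    by (rule that)
qed

context
  fixes b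
  assumes b: "\<And>P. P \<in> H A \<Longrightarrow> edge_iso P b"
begin

lemma boundary_map_signed_mono_on:
  assumes l: "l \<in> Lam A" and s: "s \<in> {-1, 1}"
  shows "signed_mono_on (\<delta> l) (\<Union> (d A s l)) xc (xc \<circ> b)"
proof (rule signed_mono_onI[OF sign_values(1)[OF l]])
  fix p q assume "p \<in> \<Union> (d A s l)" "q \<in> \<Union> (d A s l)" and pq: "xc p < xc q"
  then obtain P Q where P: "P \<in> d A s l" "p \<in> P" and Q: "Q \<in> d A s l" "q \<in> Q"
    by blast
  then have H: "P \<in> H A" "Q \<in> H A"
    using l s by (auto simp: H_eq)
  show "\<delta> l * (xc \<circ> b) p < \<delta> l * (xc \<circ> b) q"
  proof (cases "P = Q")
    case True
    have "signed_mono_on (\<delta> l) P xc (xc \<circ> b)"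
      using b[OF H(1)] A.vertex_eq[OF l P(1)] by (simp add: edge_iso_def)
    from signed_mono_onD[OF this P(2) _ pq] show ?thesis
      using Q(2) True by simp
  next
    case False
    have "b p \<in> \<eta> P" "b q \<in> \<eta> Q"
      using b H P(2) Q(2) unfolding edge_iso_def by blast+
    then show ?thesis
      using \<eta>_hlt[OF l s P(1) Q(1) A.d_hlt[OF P(1) Q(1) False P(2) Q(2) pq]] by simp
  qed
qed

lemma boundary_map_image:
  assumes l: "l \<in> Lam A" and s: "s \<in> {-1, 1}"
  shows "b ` \<Union> (d A s l) = \<Union> (d B (\<tau> l * s) (\<nu> l))"
proof -
  have "b ` P = \<eta> P" if "P \<in> d A s l" for P
    using b that l s by (auto simp: edge_iso_def H_eq)
  then have "b ` \<Union> (d A s l) = \<Union> (\<eta> ` d A s l)"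
    by (simp add: image_Union)
  then show ?thesis
    by (simp add: \<eta>_d[OF l s])
qed

lemma strip_map_exists:
  assumes l: "l \<in> Lam A"
  shows "\<exists>F. strip_homeo (\<delta> l) (\<tau> l) (strip A l) (strip B (\<nu> l)) F \<and>
    (\<forall>p\<in>\<Union> (d A (-1) l) \<union> \<Union> (d A 1 l). (\<nu> l, F (snd p)) = b p)"
proof -
  define f where "f s x = xc (b (bd_point A s l x))" for s x
  have b_eq: "b (bd_point A s l x) = bd_point B (\<tau> l * s) (\<nu> l) (f s x)"
    if "s \<in> {-1, 1}" "x \<in> bd_trace s (strip A l)" for s x
  proof -
    have "b (bd_point A s l x) \<in> bd_point B (\<tau> l * s) (\<nu> l) ` bd_trace (\<tau> l * s) (strip B (\<nu> l))"
      using boundary_map_image[OF l that(1)] that(2) unfolding Union_d by blast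
    then show ?thesis
      by (auto simp: f_def)
  qed
  have mono: "signed_mono_on (\<delta> l) (bd_trace s (strip A l)) (\<lambda>x. x) (f s)" if "s \<in> {-1, 1}" for s
    using boundary_map_signed_mono_on[OF l that] unfolding Union_d signed_mono_on_image
    by (simp add: o_def f_def[abs_def])
  have image: "f s ` bd_trace s (strip A l) = bd_trace (\<tau> l * s) (strip B (\<nu> l))" if "s \<in> {-1, 1}" for s
  proof -
    have "f s ` bd_trace s (strip A l) = xc ` b ` \<Union> (d A s l)"
      by (simp add: f_def[abs_def] Union_d image_image)
    also have "\<dots> = xc ` bd_point B (\<tau> l * s) (\<nu> l) ` bd_trace (\<tau> l * s) (strip B (\<nu> l))"
      unfolding boundary_map_image[OF l that] unfolding Union_d ..
    finally show ?thesis
      by (simp add: image_image)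
  qed
  obtain F where F: "strip_homeo (\<delta> l) (\<tau> l) (strip A l) (strip B (\<nu> l)) F"
    "\<And>s x. s \<in> {-1, 1} \<Longrightarrow> x \<in> bd_trace s (strip A l) \<Longrightarrow>
      F (x, bd_height s (strip A l)) = (f s x, bd_height (\<tau> l * s) (strip B (\<nu> l)))"
    using strip_extension[OF A.is_strip_strip[OF l] B.is_strip_strip[OF \<nu>_in[OF l]]
        sign_values[OF l] mono image] by blast
  have "(\<nu> l, F (snd p)) = b p" if s: "s \<in> {-1, 1}" and p: "p \<in> \<Union> (d A s l)" for s p
  proof -
    obtain x where x: "p = bd_point A s l x" "x \<in> bd_trace s (strip A l)"
      using p unfolding Union_d by blast
    then have "(\<nu> l, F (snd p)) = bd_point B (\<tau> l * s) (\<nu> l) (f s x)"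
      using F(2)[OF s x(2)] by (simp add: bd_point_def)
    also have "\<dots> = b p"
      using b_eq[OF s x(2)] x(1) by simp
    finally show ?thesis .
  qed
  then show ?thesis
    using F(1) by blast
qed

end

theorem graph_iso_realized:
  obtains h k where "atlas_equiv A B h k" "strip_family_homeo A B h \<nu> \<delta> \<tau>" "\<And>P. P \<in> H A \<Longrightarrow> h ` P = \<eta> P"
proof -
  obtain b where b: "\<And>P. P \<in> H A \<Longrightarrow> edge_iso P b" "\<And>P p. P \<in> H A \<Longrightarrow> p \<in> P \<Longrightarrow> b (mate A p) = mate B (b p)"
    using boundary_map_exists by blast
  obtain F where F: "\<And>l. l \<in> Lam A \<Longrightarrow> strip_homeo (\<delta> l) (\<tau> l) (strip A l) (strip B (\<nu> l)) (F l)"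
    "\<And>l p. l \<in> Lam A \<Longrightarrow> p \<in> \<Union> (d A (-1) l) \<union> \<Union> (d A 1 l) \<Longrightarrow> (\<nu> l, F l (snd p)) = b p"
    using strip_map_exists[OF b(1)] by metis
  define h where "h = (\<lambda>(l, p). (\<nu> l, F l p))"
  interpret strip_family_homeo A B h \<nu> \<delta> \<tau>
    by unfold_locales (simp_all add: h_def bij_\<nu> F(1))
  have h_b: "h p = b p" if P: "P \<in> H A" and p: "p \<in> P" for P p
  proof -
    obtain l s where l: "l \<in> Lam A" "s \<in> {-1, 1}" "P \<in> d A s l"
      using P by (rule A.H_cases)
    moreover have "fst p = l"
      using A.d_cases[OF l(1,3)] p by (metis bd_point_def fst_conv imageE)
    ultimately show ?thesis
      using F(2)[OF l(1), of p] p by (auto simp: h_def case_prod_unfold)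
  qed
  have "h (mate A p) = mate B (h p)" if p: "p \<in> S0 A" for p
  proof (cases "p \<in> S0_interior A")
    case True
    then show ?thesis
      using A.mate_S0_interior B.mate_S0_interior h_S0_interior by simp
  next
    case False
    obtain P where P: "P \<in> H A" "p \<in> P"
      using p False by (rule A.S0_boundary_cases)
    then have "mate A p \<in> xi A P"
      using A.mate_image by blast
    then show ?thesis
      using b(2)[OF P] h_b[OF P] h_b[OF A.xi_in_H[OF P(1)]] by simp
  qed
  then obtain k where "atlas_equiv A B h k"
    using atlas_equiv_exists by blast
  moreover have "h ` P = \<eta> P" if "P \<in> H A" for P
    using b(1)[OF that] h_b[OF that] by (simp add: edge_iso_def cong: image_cong)
  ultimately show thesis
    using that strip_family_homeo_axioms by blast
qed

end

theorem mainTheorem7: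
  fixes A :: "('i, 'g, 'z) striped_atlas" and B :: "('j, 'h, 'w) striped_atlas"
  assumes "is_striped_atlas A" and "is_striped_atlas B"
  shows "(\<forall>h k. atlas_equiv A B h k \<longrightarrow>
            is_graph_iso A B (induced_nu A B h) (\<lambda>P. h ` P) (induced_delta A h) (induced_tau A h))
       \<and> (\<forall>nu eta delta tau. is_graph_iso A B nu eta delta tau \<longrightarrow>
            (\<exists>h k. atlas_equiv A B h k \<and>
               (\<forall>lam\<in>Lam A. h ` ({lam} \<times> strip A lam) = {nu lam} \<times> strip B (nu lam)) \<and>
               (\<forall>lam\<in>Lam A. induced_nu A B h lam = nu lam) \<and>
               (\<forall>P\<in>H A. h ` P = eta P) \<and>
               (\<forall>lam\<in>Lam A. induced_delta A h lam = delta lam \<and> induced_tau A h lam = tau lam)))"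
proof (intro conjI allI impI)
  interpret striped_pair A B
    using assms by unfold_locales
  show "is_graph_iso A B (induced_nu A B h) (\<lambda>P. h ` P) (induced_delta A h) (induced_tau A h)"
    if "atlas_equiv A B h k" for h k
    using that by (rule atlas_equiv_induces_graph_iso)
  fix nu eta delta tau assume "is_graph_iso A B nu eta delta tau"
  then interpret graph_iso A B nu eta delta tau
    by unfold_locales
  obtain h k where equiv: "atlas_equiv A B h k" and family: "strip_family_homeo A B h nu delta tau"
    and edges: "\<And>P. P \<in> H A \<Longrightarrow> h ` P = eta P"
    using graph_iso_realized by blast
  interpret strip_family_homeo A B h nu delta tau
    by (fact family)
  show "\<exists>h k. atlas_equiv A B h k \<and>
      (\<forall>lam\<in>Lam A. h ` ({lam} \<times> strip A lam) = {nu lam} \<times> strip B (nu lam)) \<and>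
      (\<forall>lam\<in>Lam A. induced_nu A B h lam = nu lam) \<and>
      (\<forall>P\<in>H A. h ` P = eta P) \<and>
      (\<forall>lam\<in>Lam A. induced_delta A h lam = delta lam \<and> induced_tau A h lam = tau lam)"
    by (intro exI[of _ h] exI[of _ k]) (simp add: equiv edges image_strip induced_nu_h induced_signs_h)
qed

end
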